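(* Let $m>1$, $\alpha\in(0,1)$, let $\mathbf X$ be an $\alpha$-rough path (over $\mathbb R^d$) and let $\sigma\in C^N(\mathbb R^k,\mathbb R^{k\times d})$, $y_0\in\mathbb R^k$. Let $\mathbf Y$ be a solution on $[0,1]$ of $$dY(t)=-|Y(t)|^{m-1}Y(t)\,dt+\sigma(Y(t))\,dX(t),\qquad Y(0)=y_0,$$ in the sense defined in the context, and let $Y(t)=\langle \mathbf 1,\mathbf Y_t\rangle\in\mathbb R^k$. (1) If $\sigma$ satisfies the bounded-coefficients assumption, then for all $t\in(0,1]$ $$|Y(t)|\le C\max\Big\{t^{-\frac1{m-1}},\ \max_{h\in\mathring{\mathcal T}_{\le N}}[\mathbf X:h]^{\frac{1}{m\alpha|h|}}\Big\}.$$ (2) If $\sigma$ satisfies the polynomial-growth assumption with an exponent $\gamma$ such that $1\le\gamma<(m-1)\alpha+1$, then for all $t\in(0,1]$ $$|Y(t)|\le C\max\Big\{t^{-\frac1{m-1}},\ \max_{h\in\mathring{\mathcal T}_{\le N}}[\mathbf X:h]^{\frac{1}{((m-1)\alpha-\gamma+1)|h|}}\Big\}.$$ In both statements, $C<\infty$ denotes a constant that depends on $d,k,m,\alpha$ and $C_\sigma$.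
   Context: Fix integers $d,k\ge 1$ and $\alpha\in(0,1)$; $N$ is the unique natural number with $N\alpha\le 1<(N+1)\alpha$. $[d]=\{1,\dots,d\}$, $\langle x\rangle=(1+|x|^2)^{1/2}$ for $x\in\mathbb R^k$. The columns of $\sigma$ are $\sigma_\mu:\mathbb R^k\to\mathbb R^k$, $\mu\in[d]$. Bounded-coefficients assumption: $\sup_{x\in\mathbb R^k}|\partial^\beta\sigma(x)|\le C_\sigma$ for every multi-index $\beta\in\mathbb N^k$ with $|\beta|\le N$, for some constant $C_\sigma<\infty$. Polynomial-growth assumption with exponent $\gamma>0$: $|\partial^\beta\sigma(x)|\le C_\sigma\langle x\rangle^{\gamma-|\beta|}$ for all $x\in\mathbb R^k$ and all $|\beta|\le N$, for some constant $C_\sigma<\infty$. Trees and forests. Consider finite rooted trees (non-planar) with vertices decorated by elements of $[d]$. A forest is a finite, possibly empty, multiset of such trees, written as a commutative product; $\mathbf 1$ is the empty forest. For a forest $f$ and $\mu\in[d]$, $[f]_\mu$ is the tree obtained by joining the roots of all trees of $f$ to a new root decorated by $\mu$; every tree is uniquely of this form. $|f|$ is the number of vertices. $\mathring{\mathcal T}_{\le j}$ is the set of trees $h$ with $|h|\le j$, $\mathcal T_{\le j}=\mathring{\mathcal T}_{\le j}\cup\{\mathbf 1\}$, $\mathcal F$ is the set of forests all of whose trees lie in $\mathring{\mathcal T}_{\le N}$, and $\mathcal F_{\le j}=\{f\in\mathcal F:|f|\le j\}$. $\mathrm{Span}(\mathcal F)$ is the free real vector space on $\mathcal F$, a commutative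 unital algebra under the forest product; $\langle\cdot,\cdot\rangle$ denotes the inner product making forests orthonormal, its tensor version, and duality pairings. $P_{\le n}$ is the linear projection annihilating forests $f$ with $|f|>n$ and fixing the others. Coproduct. $\Delta$ is the multiplicative linear map with $\Delta\mathbf 1=\mathbf 1\otimes\mathbf 1$ and $\Delta[f]_\mu=[f]_\mu\otimes\mathbf 1+(\mathrm{id}\otimes[\,\cdot\,]_\mu)\Delta f$. Rough paths. An $\alpha$-rough path is a map $\mathbf X:[0,1]^2\to\mathrm{Char}$, $(s,t)\mapsto\mathbf X_{s,t}$, where $\mathrm{Char}$ is the set of unital algebra homomorphisms $\mathrm{Span}(\mathcal F)\to\mathbb R$, such that $\langle\mathbf X_{s,u}\otimes\mathbf X_{u,t},\Delta h\rangle=\langle\mathbf X_{s,t},h\rangle$ for all $s,u,t\in[0,1]$, $h\in\mathcal T_{\le N}$, and $[\mathbf X:h]<\infty$ for all $h\in\mathring{\mathcal T}_{\le N}$, where for $f\in\mathcal F$ $$[\mathbf X:f]=\sup_{s\ne t\in[0,1]}\frac{|\langle\mathbf X_{s,t},f\rangle|}{|s-t|^{\alpha|f|}}.$$ Controlled paths. A tree path (resp. forest path) is a map $\mathbf Y:[0,1]\to\mathrm{Span}(\mathcal T_{\le N-1})^k$ (resp. $\mathrm{Span}(\mathcal F_{\le N-1})^k$); operations act componentwise. Write $Y_s=\langle\mathbf 1,\mathbf Y_s\rangle\in\mathbb R^k$ and $\mathbf Y_s=Y_s\mathbf 1+\delta\mathbf Y_s$. For $f\in\mathcal F_{\le N-1}$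 let $R^{\mathbf Y,f}_{s,t}=\langle f,\mathbf Y_t\rangle-\langle\mathbf X_{s,t}\otimes f,\Delta\mathbf Y_s\rangle\in\mathbb R^k$. $\mathbf Y$ is $\mathbf X$-controlled if for all $f\in\mathcal F_{\le N-1}$ $$\sup_{s,t\in[0,1],\,0<|s-t|<1}\frac{|R^{\mathbf Y,f}_{s,t}|}{|t-s|^{(N-|f|)\alpha}}<\infty.$$ For a tree path $\mathbf Y$ and $g:\mathbb R^k\to\mathbb R^k$ of class $C^{N-1}$, $g(\mathbf Y)$ is the forest path $$g(\mathbf Y)_s=g(Y_s)\mathbf 1+P_{\le N-1}\sum_{p=1}^{N-1}\frac1{p!}\sum_{h_1,\dots,h_p\in\mathring{\mathcal T}_{\le N-1}}D^pg(Y_s)[\langle\mathbf Y_s,h_1\rangle,\dots,\langle\mathbf Y_s,h_p\rangle]\;h_1\cdots h_p .$$ Integration and solutions. For an $\mathbf X$-controlled forest path $\mathbf U$ and $\mu\in[d]$, $\int_s^t\mathbf U_r\,d\mathbf X^{(\mu)}_r\in\mathbb R^k$ is the limit, as the mesh of partitions of $[s,t]$ tends to $0$, of $\sum_n\Xi_{s_n,s_{n+1}}$, where $\Xi_{s,t}=\sum_{f\in\mathcal F_{\le N-1}}\langle f,\mathbf U_s\rangle\langle\mathbf X_{s,t},[f]_\mu\rangle$. A solution of the equation is an $\mathbf X$-controlled tree path $\mathbf Y$ such that for all $s\in[0,1]$ $$\mathbf Y_s=y_0\mathbf 1-\Big(\int_0^s|Y_r|^{m-1}Y_r\,dr\Big)\mathbf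 1+\mathbf Z_s,\qquad \mathbf Z_s=\sum_{\mu\in[d]}\Big(\int_0^s\sigma_\mu(\mathbf Y)_r\,d\mathbf X^{(\mu)}_r\Big)\mathbf 1+\sum_{\mu\in[d]}\sum_{f\in\mathcal F_{\le N-2}}\langle f,\sigma_\mu(\mathbf Y)_s\rangle[f]_\mu .$$
   Formalization: In (2) the constant C may also depend on the growth exponent γ; a constant depending only on d, k, m, α and C_σ cannot exist, since solutions driven by X(t) = -(1-t)^α become unbounded as γ increases to (m-1)α+1. *)

theory Defs
  imports "HOL-Analysis.Analysis" "HOL-Library.Multiset" "HOL-Library.Poly_Mapping"
begin

section \<open>Decorated trees and forests\<close>

text \<open>
  The tree \<open>[f]\<^sub>\<mu>\<close> is \<open>Node \<mu> f\<close>. Forests are multisets of trees, so the forest product is \<open>+\<close> on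
  multisets and the empty forest is \<open>{#}\<close>; a tree \<open>h\<close> regarded as a forest is \<open>{#h#}\<close>.
\<close>

datatype 'd rtree = Node 'd "'d rtree multiset"

type_synonym 'd forest = "'d rtree multiset"

primrec vertices :: "'d rtree \<Rightarrow> nat" where
  "vertices (Node \<mu> f) = 1 + sum_mset (image_mset vertices f)"

definition fvertices :: "'d forest \<Rightarrow> nat" where
  "fvertices f = sum_mset (image_mset vertices f)"

text \<open>
  The bounds below are integers because the index \<open>N - 2\<close> is used, and for \<open>N = 1\<close> no forest has at
  most \<open>N - 2 = -1\<close> vertices.
\<close>

definition trees_le :: "int \<Rightarrow> 'd rtree set" where
  "trees_le j = {h. int (vertices h) \<le> j}"

definition utrees_le :: "int \<Rightarrow> 'd forest set" where
  "utrees_le j = insert {#} ((\<lambda>h. {#h#}) ` trees_le j)"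

definition forests :: "nat \<Rightarrow> 'd forest set" where
  "forests N = {f. set_mset f \<subseteq> trees_le (int N)}"

definition forests_le :: "nat \<Rightarrow> int \<Rightarrow> 'd forest set" where
  "forests_le N j = {f \<in> forests N. int (fvertices f) \<le> j}"

lemma fvertices_mono: "h \<in># f \<Longrightarrow> vertices h \<le> fvertices f"
  by (auto simp: fvertices_def dest!: multi_member_split)

lemma vertices_pos: "0 < vertices h"
  by (cases h) simp

lemma size_le_fvertices: "size f \<le> fvertices f"
proof (induction f)
  case (add h f)
  then show ?case using vertices_pos[of h] by (simp add: fvertices_def)
qed simp

lemma finite_multisets_bounded:
  assumes "finite A"
  shows "finite {M. set_mset M \<subseteq> A \<and> size M \<le> n}"
proof (rule finite_subset)
  show "finite (mset ` {xs. set xs \<subseteq> A \<and> length xs \<le> n})"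
    using assms by (intro finite_imageI finite_lists_length_le)
  show "{M. set_mset M \<subseteq> A \<and> size M \<le> n} \<subseteq> mset ` {xs. set xs \<subseteq> A \<and> length xs \<le> n}"
  proof
    fix M assume "M \<in> {M. set_mset M \<subseteq> A \<and> size M \<le> n}"
    moreover obtain xs where "M = mset xs" using ex_mset by metis
    ultimately show "M \<in> mset ` {xs. set xs \<subseteq> A \<and> length xs \<le> n}" by auto
  qed
qed

lemma finite_vertices_le: "finite {h :: 'd::finite rtree. vertices h \<le> n}"
proof (induction n)
  case 0
  have "{h :: 'd rtree. vertices h \<le> 0} = {}"
    using vertices_pos by (auto simp: neq0_conv[symmetric] simp del: neq0_conv)
  then show ?case by (simp only: finite.emptyI)
next
  case (Suc n)
  let ?A = "{h :: 'd rtree. vertices h \<le> n}"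
  have "{h :: 'd rtree. vertices h \<le> Suc n}
      \<subseteq> case_prod Node ` (UNIV \<times> {M. set_mset M \<subseteq> ?A \<and> size M \<le> n})"
  proof
    fix h :: "'d rtree" assume "h \<in> {h. vertices h \<le> Suc n}"
    moreover obtain \<mu> f where h: "h = Node \<mu> f" by (cases h)
    ultimately have "fvertices f \<le> n" by (simp add: fvertices_def)
    then have "f \<in> {M. set_mset M \<subseteq> ?A \<and> size M \<le> n}"
      using fvertices_mono[of _ f] size_le_fvertices[of f] by (blast intro: order_trans)
    then show "h \<in> case_prod Node ` (UNIV \<times> {M. set_mset M \<subseteq> ?A \<and> size M \<le> n})"
      using h by auto
  qed
  then show ?case
    by (rule finite_subset)
      (intro finite_imageI finite_cartesian_product finite_multisets_bounded Suc finite)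
qed

lemma finite_trees_le: "finite (trees_le j :: 'd::finite rtree set)"
  by (rule finite_subset[OF _ finite_vertices_le[of "nat j"]]) (auto simp: trees_le_def)

lemma finite_forests_le: "finite (forests_le N j :: 'd::finite forest set)"
proof (rule finite_subset)
  show "finite {f :: 'd forest. set_mset f \<subseteq> trees_le (int N) \<and> size f \<le> nat j}"
    by (intro finite_multisets_bounded finite_trees_le)
  show "forests_le N j \<subseteq> {f :: 'd forest. set_mset f \<subseteq> trees_le (int N) \<and> size f \<le> nat j}"
  proof
    fix f :: "'d forest" assume f: "f \<in> forests_le N j"
    then have "size f \<le> nat j"
      using size_le_fvertices[of f] unfolding forests_le_def by simp linarith
    with f show "f \<in> {f. set_mset f \<subseteq> trees_le (int N) \<and> size f \<le> nat j}"
      by (simp add: forests_le_def forests_def)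
  qed
qed


section \<open>Free vector spaces\<close>

text \<open>
  The free real vector space on a set \<open>A\<close> of basis elements consists of the finitely supported
  functions on \<open>A\<close>. With values in \<open>real^'k\<close> these functions are the elements of \<open>Span(A)\<^sup>k\<close>.
  For real values, the convolution product \<open>*\<close> from \<open>HOL-Library.Poly_Mapping\<close> on
  \<open>'d forest \<Rightarrow>\<^sub>0 real\<close> is the bilinear extension of the forest product, and on
  \<open>'d forest \<times> 'd forest \<Rightarrow>\<^sub>0 real\<close>, which represents the tensor square with \<open>(a, b)\<close> standing for
  \<open>a \<otimes> b\<close>, it is the usual product of the tensor square algebra.
  The pairing \<open>\<langle>f, p\<rangle>\<close> with a basis element \<open>f\<close> is \<open>Poly_Mapping.lookup p f\<close>.
\<close>

definition Span :: "'a set \<Rightarrow> ('a \<Rightarrow>\<^sub>0 'v::zero) set" where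
  "Span A = {p. Poly_Mapping.keys p \<subseteq> A}"

definition lin_ext :: "('a \<Rightarrow> 'b \<Rightarrow>\<^sub>0 real) \<Rightarrow> ('a \<Rightarrow>\<^sub>0 'v::real_vector) \<Rightarrow> ('b \<Rightarrow>\<^sub>0 'v)" where
  "lin_ext F p =
    (\<Sum>a\<in>Poly_Mapping.keys p. Poly_Mapping.map (\<lambda>c. c *\<^sub>R Poly_Mapping.lookup p a) (F a))"

definition pairing :: "('a \<Rightarrow> real) \<Rightarrow> ('a \<Rightarrow>\<^sub>0 'v::real_vector) \<Rightarrow> 'v" where
  "pairing \<phi> p = (\<Sum>a\<in>Poly_Mapping.keys p. \<phi> a *\<^sub>R Poly_Mapping.lookup p a)"

definition proj_le :: "int \<Rightarrow> ('d forest \<Rightarrow>\<^sub>0 'v::real_vector) \<Rightarrow> ('d forest \<Rightarrow>\<^sub>0 'v)" where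
  "proj_le n p = (\<Sum>f\<in>{f \<in> Poly_Mapping.keys p. int (fvertices f) \<le> n}.
     Poly_Mapping.single f (Poly_Mapping.lookup p f))"

definition of_forest :: "'d forest \<Rightarrow> ('d forest \<Rightarrow>\<^sub>0 real)" where
  "of_forest f = Poly_Mapping.single f 1"


section \<open>Coproduct\<close>

primrec coproduct_tree :: "'d rtree \<Rightarrow> ('d forest \<times> 'd forest \<Rightarrow>\<^sub>0 real)" where
  "coproduct_tree (Node \<mu> f) =
     Poly_Mapping.single ({#Node \<mu> f#}, {#}) 1
     + lin_ext (\<lambda>(a, b). Poly_Mapping.single (a, {#Node \<mu> b#}) 1)
         (prod_mset (image_mset coproduct_tree f))"

definition coproduct_forest :: "'d forest \<Rightarrow> ('d forest \<times> 'd forest \<Rightarrow>\<^sub>0 real)" where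
  "coproduct_forest f = prod_mset (image_mset coproduct_tree f)"

definition coproduct ::
    "('d forest \<Rightarrow>\<^sub>0 'v::real_vector) \<Rightarrow> ('d forest \<times> 'd forest \<Rightarrow>\<^sub>0 'v)" where
  "coproduct = lin_ext coproduct_forest"


section \<open>Rough paths\<close>

text \<open>Only the values of a character on \<open>Span (forests N)\<close> are meaningful.\<close>

definition characters :: "nat \<Rightarrow> (('d forest \<Rightarrow>\<^sub>0 real) \<Rightarrow> real) set" where
  "characters N = {\<xi>. \<xi> 1 = 1 \<and>
     (\<forall>p \<in> Span (forests N). \<forall>q \<in> Span (forests N).
        \<xi> (p + q) = \<xi> p + \<xi> q \<and> \<xi> (p * q) = \<xi> p * \<xi> q) \<and>
     (\<forall>c. \<forall>p \<in> Span (forests N). \<xi> (Poly_Mapping.map (\<lambda>x. c * x) p) = c * \<xi> p)}"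

definition tensor_fun ::
    "(('d forest \<Rightarrow>\<^sub>0 real) \<Rightarrow> real) \<Rightarrow> (('d forest \<Rightarrow>\<^sub>0 real) \<Rightarrow> real) \<Rightarrow> 'd forest \<times> 'd forest \<Rightarrow> real"
  where "tensor_fun \<xi> \<psi> = (\<lambda>(a, b). \<xi> (of_forest a) * \<psi> (of_forest b))"

definition seminorm_ratios ::
    "real \<Rightarrow> (real \<Rightarrow> real \<Rightarrow> ('d forest \<Rightarrow>\<^sub>0 real) \<Rightarrow> real) \<Rightarrow> 'd forest \<Rightarrow> real set" where
  "seminorm_ratios \<alpha> X f =
     {\<bar>X s t (of_forest f)\<bar> / \<bar>s - t\<bar> powr (\<alpha> * real (fvertices f)) |s t.
        s \<in> {0..1} \<and> t \<in> {0..1} \<and> s \<noteq> t}"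

definition rp_seminorm ::
    "real \<Rightarrow> (real \<Rightarrow> real \<Rightarrow> ('d forest \<Rightarrow>\<^sub>0 real) \<Rightarrow> real) \<Rightarrow> 'd forest \<Rightarrow> real" where
  "rp_seminorm \<alpha> X f = Sup (seminorm_ratios \<alpha> X f)"

definition rough_path ::
    "real \<Rightarrow> nat \<Rightarrow> (real \<Rightarrow> real \<Rightarrow> ('d forest \<Rightarrow>\<^sub>0 real) \<Rightarrow> real) \<Rightarrow> bool" where
  "rough_path \<alpha> N X \<longleftrightarrow>
     (\<forall>s\<in>{0..1}. \<forall>t\<in>{0..1}. X s t \<in> characters N) \<and>
     (\<forall>s\<in>{0..1}. \<forall>u\<in>{0..1}. \<forall>t\<in>{0..1}. \<forall>h \<in> utrees_le (int N).
        pairing (tensor_fun (X s u) (X u t)) (coproduct (of_forest h)) = X s t (of_forest h)) \<and>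
     (\<forall>h \<in> trees_le (int N). bdd_above (seminorm_ratios \<alpha> X {#h#}))"


section \<open>Derivatives and coefficient assumptions\<close>

text \<open>The \<open>p\<close>-th derivative \<open>D\<^sup>pg(x)[v\<^sub>1,\<dots>,v\<^sub>p]\<close>, where \<open>vs = [v\<^sub>1,\<dots>,v\<^sub>p]\<close>.\<close>

fun Dn :: "('a::real_normed_vector \<Rightarrow> 'b::real_normed_vector) \<Rightarrow> 'a list \<Rightarrow> 'a \<Rightarrow> 'b" where
  "Dn g [] = g"
| "Dn g (v # vs) = (\<lambda>x. frechet_derivative (Dn g vs) (at x) v)"

text \<open>The class \<open>C\<^sup>n\<close>; in finite dimension, continuity of all directional derivatives of order
  \<open>n\<close> is continuity of \<open>D\<^sup>ng\<close>.\<close>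

fun Ck :: "nat \<Rightarrow> ('a::real_normed_vector \<Rightarrow> 'b::real_normed_vector) \<Rightarrow> bool" where
  "Ck 0 g \<longleftrightarrow> continuous_on UNIV g"
| "Ck (Suc n) g \<longleftrightarrow>
     (\<forall>x. g differentiable at x) \<and> (\<forall>v. Ck n (\<lambda>x. frechet_derivative g (at x) v))"

text \<open>
  For a multi-index \<open>\<beta>\<close>, \<open>\<partial>\<^sup>\<beta>g\<close> differentiates \<open>\<beta> i\<close> times in the \<open>i\<close>-th coordinate direction. The
  derivatives are taken in some unspecified order, on which the result does not depend when \<open>g\<close> is
  of class \<open>C\<^sup>n\<close> with \<open>n \<ge> |\<beta>|\<close>.
\<close>

definition mi_order :: "('k::finite \<Rightarrow> nat) \<Rightarrow> nat" where
  "mi_order \<beta> = (\<Sum>i\<in>UNIV. \<beta> i)"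

definition partial_deriv ::
    "('k::finite \<Rightarrow> nat) \<Rightarrow> (real^'k \<Rightarrow> 'b::real_normed_vector) \<Rightarrow> real^'k \<Rightarrow> 'b" where
  "partial_deriv \<beta> g =
     Dn g (map (\<lambda>i. axis i 1) (SOME is. \<forall>i. count_list is i = \<beta> i))"

definition bounded_coeffs ::
    "nat \<Rightarrow> real \<Rightarrow> (real^'k::finite \<Rightarrow> 'b::real_normed_vector) \<Rightarrow> bool" where
  "bounded_coeffs N C \<sigma> \<longleftrightarrow> (\<forall>\<beta>. mi_order \<beta> \<le> N \<longrightarrow> (\<forall>x. norm (partial_deriv \<beta> \<sigma> x) \<le> C))"

definition japanese_bracket :: "'a::real_normed_vector \<Rightarrow> real" where
  "japanese_bracket x = sqrt (1 + (norm x)\<^sup>2)"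

definition polynomial_growth ::
    "nat \<Rightarrow> real \<Rightarrow> real \<Rightarrow> (real^'k::finite \<Rightarrow> 'b::real_normed_vector) \<Rightarrow> bool" where
  "polynomial_growth N \<gamma> C \<sigma> \<longleftrightarrow>
     (\<forall>\<beta>. mi_order \<beta> \<le> N \<longrightarrow>
        (\<forall>x. norm (partial_deriv \<beta> \<sigma> x) \<le> C * japanese_bracket x powr (\<gamma> - real (mi_order \<beta>))))"


section \<open>Controlled paths\<close>

definition tree_path :: "nat \<Rightarrow> (real \<Rightarrow> 'd forest \<Rightarrow>\<^sub>0 real^'k::finite) \<Rightarrow> bool" where
  "tree_path N Y \<longleftrightarrow> (\<forall>s\<in>{0..1}. Y s \<in> Span (utrees_le (int N - 1)))"

definition forest_path :: "nat \<Rightarrow> (real \<Rightarrow> 'd forest \<Rightarrow>\<^sub>0 real^'k::finite) \<Rightarrow> bool" where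
  "forest_path N Y \<longleftrightarrow> (\<forall>s\<in>{0..1}. Y s \<in> Span (forests_le N (int N - 1)))"

text \<open>\<open>\<langle>X\<^sub>s\<^sub>t \<otimes> f, \<Delta>Y\<^sub>s\<rangle>\<close>: the second slot is paired with the basis element \<open>f\<close>.\<close>

definition remainder ::
    "(real \<Rightarrow> real \<Rightarrow> ('d forest \<Rightarrow>\<^sub>0 real) \<Rightarrow> real) \<Rightarrow> (real \<Rightarrow> 'd forest \<Rightarrow>\<^sub>0 real^'k::finite)
     \<Rightarrow> 'd forest \<Rightarrow> real \<Rightarrow> real \<Rightarrow> real^'k" where
  "remainder X Y f s t = Poly_Mapping.lookup (Y t) f
     - pairing (\<lambda>(a, b). X s t (of_forest a) * (if b = f then 1 else 0)) (coproduct (Y s))"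

definition controlled ::
    "real \<Rightarrow> nat \<Rightarrow> (real \<Rightarrow> real \<Rightarrow> ('d forest \<Rightarrow>\<^sub>0 real) \<Rightarrow> real)
     \<Rightarrow> (real \<Rightarrow> 'd forest \<Rightarrow>\<^sub>0 real^'k::finite) \<Rightarrow> bool" where
  "controlled \<alpha> N X Y \<longleftrightarrow> forest_path N Y \<and>
     (\<forall>f \<in> forests_le N (int N - 1).
        bdd_above {norm (remainder X Y f s t) / \<bar>t - s\<bar> powr ((real N - real (fvertices f)) * \<alpha>) |s t.
          s \<in> {0..1} \<and> t \<in> {0..1} \<and> 0 < \<bar>s - t\<bar> \<and> \<bar>s - t\<bar> < 1})"

definition compose_path ::
    "nat \<Rightarrow> (real^'k \<Rightarrow> real^'k) \<Rightarrow> (real \<Rightarrow> 'd forest \<Rightarrow>\<^sub>0 real^'k)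
     \<Rightarrow> real \<Rightarrow> 'd forest \<Rightarrow>\<^sub>0 real^'k::finite" where
  "compose_path N g Y s =
     Poly_Mapping.single {#} (g (Poly_Mapping.lookup (Y s) {#}))
     + proj_le (int N - 1)
         (\<Sum>p = 1..N - 1. \<Sum>hs | set hs \<subseteq> trees_le (int N - 1) \<and> length hs = p.
            Poly_Mapping.single (mset hs)
              ((1 / fact p) *\<^sub>R
               Dn g (map (\<lambda>h. Poly_Mapping.lookup (Y s) {#h#}) hs) (Poly_Mapping.lookup (Y s) {#})))"


section \<open>Integration and solutions\<close>

definition germ ::
    "nat \<Rightarrow> (real \<Rightarrow> real \<Rightarrow> ('d forest \<Rightarrow>\<^sub>0 real) \<Rightarrow> real) \<Rightarrow> (real \<Rightarrow> 'd forest \<Rightarrow>\<^sub>0 real^'k::finite)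
     \<Rightarrow> 'd \<Rightarrow> real \<Rightarrow> real \<Rightarrow> real^'k" where
  "germ N X U \<mu> s t =
     (\<Sum>f \<in> forests_le N (int N - 1). X s t (of_forest {#Node \<mu> f#}) *\<^sub>R Poly_Mapping.lookup (U s) f)"

text \<open>A partition of \<open>[s, t]\<close> is the strictly increasing list of its points; \<open>mesh_filter s t\<close>
  describes the convergence of the mesh to \<open>0\<close>.\<close>

definition partitions :: "real \<Rightarrow> real \<Rightarrow> real list set" where
  "partitions s t = {xs. xs \<noteq> [] \<and> hd xs = s \<and> last xs = t \<and> sorted_wrt (<) xs}"

definition mesh_filter :: "real \<Rightarrow> real \<Rightarrow> real list filter" where
  "mesh_filter s t =
     (INF \<delta>\<in>{0<..}. principal {xs \<in> partitions s t. \<forall>n < length xs - 1. xs ! Suc n - xs ! n < \<delta>})"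

definition rough_integral ::
    "nat \<Rightarrow> (real \<Rightarrow> real \<Rightarrow> ('d forest \<Rightarrow>\<^sub>0 real) \<Rightarrow> real) \<Rightarrow> (real \<Rightarrow> 'd forest \<Rightarrow>\<^sub>0 real^'k::finite)
     \<Rightarrow> 'd \<Rightarrow> real \<Rightarrow> real \<Rightarrow> real^'k" where
  "rough_integral N X U \<mu> s t =
     Lim (mesh_filter s t) (\<lambda>xs. \<Sum>n < length xs - 1. germ N X U \<mu> (xs ! n) (xs ! Suc n))"

definition is_solution ::
    "real \<Rightarrow> real \<Rightarrow> nat \<Rightarrow> (real \<Rightarrow> real \<Rightarrow> ('d::finite forest \<Rightarrow>\<^sub>0 real) \<Rightarrow> real)
     \<Rightarrow> (real^'k \<Rightarrow> real^'d^'k) \<Rightarrow> real^'k \<Rightarrow> (real \<Rightarrow> 'd forest \<Rightarrow>\<^sub>0 real^'k::finite) \<Rightarrow> bool" where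
  "is_solution m \<alpha> N X \<sigma> y0 Y \<longleftrightarrow>
     tree_path N Y \<and> controlled \<alpha> N X Y \<and>
     (let y = (\<lambda>r. Poly_Mapping.lookup (Y r) {#});
          \<sigma>Y = (\<lambda>\<mu>. compose_path N (\<lambda>x. column \<mu> (\<sigma> x)) Y)
      in \<forall>s\<in>{0..1}.
           Y s = Poly_Mapping.single {#} y0
             - Poly_Mapping.single {#} (integral {0..s} (\<lambda>r. norm (y r) powr (m - 1) *\<^sub>R y r))
             + ((\<Sum>\<mu>\<in>UNIV. Poly_Mapping.single {#} (rough_integral N X (\<sigma>Y \<mu>) \<mu> 0 s))
                + (\<Sum>\<mu>\<in>UNIV. \<Sum>f \<in> forests_le N (int N - 2).
                     Poly_Mapping.single {#Node \<mu> f#} (Poly_Mapping.lookup (\<sigma>Y \<mu> s) f))))"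

end

theory Submission
  imports Defs "HOL-Combinatorics.Multiset_Permutations"
begin

text \<open>
  The coefficients of a solution are determined by its value: coherence makes the coefficient of a tree
  an elementary differential of \<open>\<sigma>\<close> at \<open>Y\<^sub>s\<close>. A Taylor expansion, together with the fact that the coproduct
  describes exactly how elementary differentials transform under a change of the base point, bounds all
  remainders of \<open>\<sigma>(Y)\<close> by the remainder \<open>R\<close> of the lowest level alone. On a time scale on which \<open>X\<close>, measured
  against \<open>M = sup |Y|\<close>, is of small size \<open>\<epsilon>\<close>, sewing then bounds \<open>R\<close> by the drift plus \<open>\<epsilon>\<close> times \<open>R\<close> itself;
  absorbing, the rough integral changes by at most a small multiple of \<open>M\<close> over times of order \<open>M powr (1 - m)\<close>.
  On such a time interval the damping decreases \<open>|Y|\<close> by a fixed factor as long as \<open>M\<close> dominates the noise,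
  and summing the geometric series of these times gives the bound.
\<close>

section \<open>Iterated derivatives\<close>

text \<open>The exponents are a matter of units. A window of length \<tau> on which the fields have
  size \<kappa>\<omega> and vary on the length scale \<omega> feels the tree h with strength [X:h]
  (\<kappa> \<tau>^\<alpha>)^|h|. Bounded fields have \<omega> = 1, so the drift may move the path
  by O(1) only: \<tau> = M^(-m), \<kappa> = 1, and about M windows are chained. Growing fields have
  \<omega> of order up to M and \<kappa> = M^(\<gamma>-1), and one window \<tau> = M^(1-m) is
  enough. This makes \<kappa> \<tau>^\<alpha> equal to M^(-m\<alpha>) or
  M^(-((m-1)\<alpha>-\<gamma>+1)). Two obstacles shape the rest. The constant must not depend on X,
  \<sigma> or the path, so the estimates are scale invariant and their constants are quantified
  before these data. And R must enter its own estimate linearly, although Taylor's formula produces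
  powers of the increment; increments below and above half the local length scale are therefore
  treated separately. That R has a finite bound at all is known from controlledness and makes the
  absorption legitimate. (N+1)\<alpha> > 1 is the exponent of sewing, and N\<alpha> \<le> 1 lets the
  drift count as part of R.\<close>

lemma Dn_append: "Dn g (vs @ ws) = Dn (Dn g ws) vs"
  by (induction vs) simp_all

lemma Ck_Suc_imp: "Ck (Suc n) g \<Longrightarrow> Ck n g"
proof (induction n arbitrary: g)
  case 0
  then show ?case
    by (auto intro!: continuous_at_imp_continuous_on differentiable_imp_continuous_within)
next
  case (Suc n)
  then show ?case by (metis Ck.simps(2))
qed

lemma Ck_mono: "Ck n g \<Longrightarrow> m \<le> n \<Longrightarrow> Ck m g"
proof (induction n arbitrary: m)
  case (Suc n)
  then show ?case using Ck_Suc_imp[OF Suc.prems(1)] by (metis le_SucE)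
qed simp

lemma Ck_Dn: "Ck (n + length vs) g \<Longrightarrow> Ck n (Dn g vs)"
proof (induction vs arbitrary: g rule: rev_induct)
  case (snoc v vs)
  have "Ck (n + length vs) (Dn g [v])" using snoc.prems by simp
  then show ?case unfolding Dn_append by (rule snoc.IH)
qed simp

lemma Dn_differentiable: "Ck n g \<Longrightarrow> length vs < n \<Longrightarrow> Dn g vs differentiable (at x)"
  using Ck_Dn[of "Suc 0" vs g] Ck_mono[of n g "Suc 0 + length vs"] by simp

lemma linear_Dn_Cons: "Ck n g \<Longrightarrow> length vs < n \<Longrightarrow> linear (\<lambda>v. Dn g (v # vs) x)"
  using linear_frechet_derivative[OF Dn_differentiable] by simp

lemma Dn_linear_image:
  assumes "bounded_linear L"
  shows "Ck (length vs) g \<Longrightarrow> Dn (\<lambda>x. L (g x)) vs = (\<lambda>x. L (Dn g vs x))"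
proof (induction vs)
  case (Cons v vs)
  have IH: "Dn (\<lambda>x. L (g x)) vs = (\<lambda>x. L (Dn g vs x))"
    using Cons Ck_Suc_imp by fastforce
  have "((\<lambda>x. L (Dn g vs x)) has_derivative (\<lambda>v. L (frechet_derivative (Dn g vs) (at x) v))) (at x)" for x
    by (intro bounded_linear.has_derivative[OF assms] frechet_derivative_works[THEN iffD1]
        Dn_differentiable[OF Cons.prems]) simp
  then show ?case unfolding Dn.simps IH by (metis frechet_derivative_at)
qed simp

lemma Ck_linear_image:
  assumes "bounded_linear L"
  shows "Ck n g \<Longrightarrow> Ck n (\<lambda>x. L (g x))"
proof (induction n arbitrary: g)
  case 0
  then show ?case
    using bounded_linear.continuous_on[OF assms] by simp
next
  case (Suc n)
  have "((\<lambda>x. L (g x)) has_derivative (\<lambda>v. L (frechet_derivative g (at x) v))) (at x)" for x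
    using Suc.prems
    by (intro bounded_linear.has_derivative[OF assms] frechet_derivative_works[THEN iffD1]) simp
  then have "frechet_derivative (\<lambda>x. L (g x)) (at x) = (\<lambda>v. L (frechet_derivative g (at x) v))"
      and "(\<lambda>x. L (g x)) differentiable (at x)" for x
    by (metis frechet_derivative_at, auto simp: differentiable_def)
  then show ?case using Suc by simp
qed

section \<open>Symmetry of iterated derivatives\<close>

lemma line_derivative:
  assumes "g differentiable (at (x + t *\<^sub>R v))"
  shows "((\<lambda>t. g (x + t *\<^sub>R v)) has_vector_derivative
           frechet_derivative g (at (x + t *\<^sub>R v)) v) (at t within S)"
proof -
  have g: "(g has_derivative frechet_derivative g (at (x + t *\<^sub>R v))) (at (x + t *\<^sub>R v))"
    using assms by (rule frechet_derivative_works[THEN iffD1])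
  have "((\<lambda>t. x + t *\<^sub>R v) has_derivative (\<lambda>h. h *\<^sub>R v)) (at t within S)"
    by (auto intro!: derivative_eq_intros)
  from has_derivative_compose[OF this g] show ?thesis
    using linear_cmul[OF linear_frechet_derivative[OF assms]]
    by (simp add: has_vector_derivative_def)
qed

text \<open>Two applications of the mean value theorem: in direction \<open>v\<close> to the
  difference of \<open>g\<close> at points shifted by \<open>t *\<^sub>R w\<close>, then in
  direction \<open>w\<close> to the derivative along \<open>v\<close>. The left-hand side is
  symmetric in \<open>v\<close> and \<open>w\<close> although the right-hand side is not, which the
  swap of derivatives exploits.\<close>

lemma double_difference_mvt:
  fixes g :: "'a::real_normed_vector \<Rightarrow> real"
  assumes "Ck 2 g" "0 < t"
  obtains a b where "0 < a" "a < t" "0 < b" "b < t"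
    "g (x + t *\<^sub>R v + t *\<^sub>R w) - g (x + t *\<^sub>R v) - g (x + t *\<^sub>R w) + g x
      = t * t * Dn g [w, v] (x + a *\<^sub>R v + b *\<^sub>R w)"
proof -
  let ?D = "\<lambda>x. frechet_derivative g (at x) v"
  have dg: "g differentiable (at x)" and dD: "?D differentiable (at x)" for x
    using assms(1) by (simp_all add: numeral_2_eq_2)
  define f where "f a = g (x + t *\<^sub>R w + a *\<^sub>R v) - g (x + a *\<^sub>R v)" for a
  have df: "(f has_real_derivative (?D (x + t *\<^sub>R w + a *\<^sub>R v) - ?D (x + a *\<^sub>R v))) (at a)" for a
    unfolding f_def has_real_derivative_iff_has_vector_derivative
    by (intro has_vector_derivative_diff line_derivative dg)
  obtain a where a: "0 < a" "a < t"
    "f t - f 0 = (t - 0) * (?D (x + t *\<^sub>R w + a *\<^sub>R v) - ?D (x + a *\<^sub>R v))"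
    using MVT2[OF assms(2), of f "\<lambda>a. ?D (x + t *\<^sub>R w + a *\<^sub>R v) - ?D (x + a *\<^sub>R v)"] df by metis
  define h where "h b = ?D (x + a *\<^sub>R v + b *\<^sub>R w)" for b
  have dh: "(h has_real_derivative frechet_derivative ?D (at (x + a *\<^sub>R v + b *\<^sub>R w)) w) (at b)" for b
    unfolding h_def has_real_derivative_iff_has_vector_derivative by (intro line_derivative dD)
  obtain b where b: "0 < b" "b < t"
    "h t - h 0 = (t - 0) * frechet_derivative ?D (at (x + a *\<^sub>R v + b *\<^sub>R w)) w"
    using MVT2[OF assms(2), of h "\<lambda>b. frechet_derivative ?D (at (x + a *\<^sub>R v + b *\<^sub>R w)) w"] dh by metis
  show ?thesis
  proof
    have "f t - f 0 = t * (h t - h 0)"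
      unfolding a(3) h_def by (simp add: algebra_simps)
    then show "g (x + t *\<^sub>R v + t *\<^sub>R w) - g (x + t *\<^sub>R v) - g (x + t *\<^sub>R w) + g x
      = t * t * Dn g [w, v] (x + a *\<^sub>R v + b *\<^sub>R w)"
      unfolding b(3) by (simp add: f_def algebra_simps)
  qed (use a b in auto)
qed

text \<open>Dividing the double difference by t^2 and letting t tend to 0 yields both mixed
  derivatives. Continuity of the functions \<open>Dn g [w, v]\<close> with fixed directions is
  enough for this, and it is exactly what \<open>Ck\<close> provides.\<close>

lemma Dn_swap_real:
  fixes g :: "'a::real_normed_vector \<Rightarrow> real"
  assumes "Ck 2 g"
  shows "Dn g [v, w] x = Dn g [w, v] x"
proof -
  define t where "t n = 1 / real (Suc n)" for n
  have t: "0 < t n" for n by (simp add: t_def)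
  have t0: "t \<longlonglongrightarrow> 0" unfolding t_def by (rule LIMSEQ_Suc[OF lim_1_over_n])
  have lim: "\<exists>F. (\<forall>n. t n * t n * F n = g (x + t n *\<^sub>R v + t n *\<^sub>R w)
        - g (x + t n *\<^sub>R v) - g (x + t n *\<^sub>R w) + g x) \<and> F \<longlonglongrightarrow> Dn g [w, v] x" for v w
  proof -
    have "\<forall>n. \<exists>a b. 0 < a \<and> a < t n \<and> 0 < b \<and> b < t n \<and>
      g (x + t n *\<^sub>R v + t n *\<^sub>R w) - g (x + t n *\<^sub>R v) - g (x + t n *\<^sub>R w) + g x
        = t n * t n * Dn g [w, v] (x + a *\<^sub>R v + b *\<^sub>R w)"
      using double_difference_mvt[OF assms t] by metis
    then obtain a b where ab: "\<And>n. 0 < a n" "\<And>n. a n < t n" "\<And>n. 0 < b n" "\<And>n. b n < t n"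
      "\<And>n. g (x + t n *\<^sub>R v + t n *\<^sub>R w) - g (x + t n *\<^sub>R v) - g (x + t n *\<^sub>R w) + g x
        = t n * t n * Dn g [w, v] (x + a n *\<^sub>R v + b n *\<^sub>R w)"
      by metis
    have "a \<longlonglongrightarrow> 0" "b \<longlonglongrightarrow> 0"
      using ab(1-4) by (intro tendsto_sandwich[OF _ _ tendsto_const t0]; simp add: less_imp_le)+
    then have "(\<lambda>n. x + a n *\<^sub>R v + b n *\<^sub>R w) \<longlonglongrightarrow> x + 0 *\<^sub>R v + 0 *\<^sub>R w"
      by (intro tendsto_intros)
    moreover have "isCont (Dn g [w, v]) x"
      using Ck_Dn[of 0 "[w, v]" g] assms
      by (simp add: numeral_2_eq_2 continuous_on_eq_continuous_at)
    ultimately have "(\<lambda>n. Dn g [w, v] (x + a n *\<^sub>R v + b n *\<^sub>R w)) \<longlonglongrightarrow> Dn g [w, v] x"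
      using isCont_tendsto_compose by fastforce
    then show ?thesis
      by (intro exI[of _ "\<lambda>n. Dn g [w, v] (x + a n *\<^sub>R v + b n *\<^sub>R w)"])
        (simp only: ab(5) simp_thms)
  qed
  obtain F G where F: "\<And>n. t n * t n * F n = g (x + t n *\<^sub>R v + t n *\<^sub>R w)
        - g (x + t n *\<^sub>R v) - g (x + t n *\<^sub>R w) + g x" "F \<longlonglongrightarrow> Dn g [w, v] x"
    and G: "\<And>n. t n * t n * G n = g (x + t n *\<^sub>R w + t n *\<^sub>R v)
        - g (x + t n *\<^sub>R w) - g (x + t n *\<^sub>R v) + g x" "G \<longlonglongrightarrow> Dn g [v, w] x"
    using lim[of v w] lim[of w v] by blast
  have "t n * t n * F n = t n * t n * G n" for n
    unfolding F(1) G(1) by (simp add: add_ac diff_diff_eq)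
  then have "F n = G n" for n using t[of n] by (metis mult_cancel_left less_irrefl mult_eq_0_iff)
  then have "F = G" by (rule ext)
  then show ?thesis using F(2) G(2) LIMSEQ_unique by blast
qed

text \<open>The mean value theorem is scalar, so the identity is tested against every vector
  \<open>e\<close>.\<close>

lemma Dn_swap:
  fixes g :: "'a::real_normed_vector \<Rightarrow> 'b::real_inner"
  assumes "Ck 2 g"
  shows "Dn g [v, w] = Dn g [w, v]"
proof
  fix x
  have "Dn g [v, w] x \<bullet> e = Dn g [w, v] x \<bullet> e" for e
  proof -
    have L: "bounded_linear (\<lambda>y. y \<bullet> e)" by (rule bounded_linear_inner_left)
    have "Ck (length [v, w]) g" "Ck (length [w, v]) g" using assms by (simp_all add: numeral_2_eq_2)
    from Dn_linear_image[OF L this(1)] Dn_linear_image[OF L this(2)]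
    show ?thesis using Dn_swap_real[OF Ck_linear_image[OF L assms], of v w x] by metis
  qed
  then show "Dn g [v, w] x = Dn g [w, v] x" by (metis vector_eq_rdot)
qed

lemma Dn_move_front:
  fixes g :: "'a::real_normed_vector \<Rightarrow> 'b::real_inner"
  shows "Ck (Suc (length (us @ vs))) g \<Longrightarrow> Dn g (us @ v # vs) = Dn g (v # us @ vs)"
proof (induction us)
  case (Cons u us)
  have "Dn g (us @ v # vs) = Dn g (v # us @ vs)"
    using Cons Ck_Suc_imp[of "Suc (length (us @ vs))" g] by simp
  then have "Dn g ((u # us) @ v # vs) = Dn g ([u, v] @ (us @ vs))" by simp
  also have "\<dots> = Dn (Dn g (us @ vs)) [u, v]" by (rule Dn_append)
  also have "\<dots> = Dn (Dn g (us @ vs)) [v, u]"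
    using Cons.prems Ck_Dn[of 2 "us @ vs" g] by (intro Dn_swap) simp
  finally show ?case by (simp add: Dn_append[symmetric])
qed simp

text \<open>One direction after the other is moved to the front. Derivatives along the trees of a
  forest are therefore independent of the order in which the trees are listed.\<close>

lemma Dn_mset_cong:
  fixes g :: "'a::real_normed_vector \<Rightarrow> 'b::real_inner"
  shows "Ck (length vs) g \<Longrightarrow> mset vs = mset ws \<Longrightarrow> Dn g vs = Dn g ws"
proof (induction vs arbitrary: ws)
  case (Cons v vs)
  then have "v \<in> set ws" by (metis list.set_intros(1) set_mset_mset)
  then obtain as bs where ws: "ws = as @ v # bs" by (meson split_list)
  have "mset vs = mset (as @ bs)" using Cons.prems(2) ws by simp
  moreover have "Ck (length vs) g" using Cons.prems(1) Ck_Suc_imp by simp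
  ultimately have "Dn g vs = Dn g (as @ bs)" by (rule Cons.IH[rotated])
  moreover have "length (as @ bs) = length vs"
    using \<open>mset vs = mset (as @ bs)\<close> by (metis mset_eq_length)
  then have "Ck (Suc (length (as @ bs))) g" using Cons.prems(1) by simp
  ultimately show ?case using Dn_move_front[of as bs g v] ws by simp
qed simp

section \<open>Bounds from partial derivatives, and Taylor expansion\<close>

lemma Dn_basis_bound:
  fixes g :: "real^'k::finite \<Rightarrow> 'b::real_inner"
  assumes "Ck n g" "\<And>is. length is = n \<Longrightarrow> norm (Dn g (map (\<lambda>i. axis i 1) is) x) \<le> B"
  shows "length vs + length is = n \<Longrightarrow>
    norm (Dn g (vs @ map (\<lambda>i. axis i 1) is) x)
      \<le> B * real CARD('k) ^ length vs * prod_list (map norm vs)"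
proof (induction vs arbitrary: "is")
  case Nil
  then show ?case using assms(2)[of "is"] by simp
next
  case (Cons v vs)
  let ?bs = "map (\<lambda>i. axis i 1) is" and ?K = "B * real CARD('k) ^ length vs * prod_list (map norm vs)"
  have n: "length (vs @ ?bs) < n" using Cons.prems by simp
  have IH: "norm (Dn g (axis i 1 # vs @ ?bs) x) \<le> ?K" for i
  proof -
    have "Ck (Suc (length (vs @ ?bs))) g" using Cons.prems assms(1) by simp
    then have "Dn g (axis i 1 # vs @ ?bs) = Dn g (vs @ axis i 1 # ?bs)"
      by (rule Dn_move_front[symmetric])
    also have "\<dots> = Dn g (vs @ map (\<lambda>i. axis i 1) (i # is))" by simp
    finally show ?thesis using Cons.IH[of "i # is"] Cons.prems by simp
  qed
  \<comment> \<open>Expanding the first direction in the standard basis costs a factor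
    \<open>CARD('k)\<close> and turns it into an entry of \<open>is\<close>; this is why the
    statement speaks of lists that mix arbitrary and coordinate directions.\<close>
  have v: "v = (\<Sum>i\<in>UNIV. (v $ i) *\<^sub>R axis i 1)"
    using basis_expansion[of v] by (simp add: scalar_mult_eq_scaleR)
  have lin: "linear (\<lambda>v. Dn g (v # vs @ ?bs) x)" using assms(1) n by (rule linear_Dn_Cons)
  have "Dn g (v # vs @ ?bs) x = (\<Sum>i\<in>UNIV. (v $ i) *\<^sub>R Dn g (axis i 1 # vs @ ?bs) x)"
    by (subst v) (simp only: linear_sum[OF lin] linear_cmul[OF lin])
  also have "norm \<dots> \<le> (\<Sum>i\<in>(UNIV :: 'k set). norm v * ?K)"
    by (intro sum_norm_le) (auto intro!: mult_mono IH[unfolded Dn.simps] component_le_norm_cart)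
  finally show ?case by (simp add: algebra_simps)
qed

lemma sum_count_list_UNIV: "(\<Sum>i\<in>UNIV. count_list is i) = length (is :: 'k::finite list)"
proof (induction "is")
  case (Cons a "is")
  have "(\<Sum>i\<in>UNIV. count_list (a # is) i) = (\<Sum>i\<in>UNIV. count_list is i + (if i = a then 1 else 0))"
    by (intro sum.cong) auto
  then show ?case using Cons by (simp add: sum.distrib)
qed simp

text \<open>\<open>partial_deriv\<close> picks an unspecified list with the right multiplicities; by
  symmetry the choice does not matter. Every list of coordinate directions thus falls under the
  hypotheses on multi-indices.\<close>

lemma partial_deriv_eq:
  fixes g :: "real^'k::finite \<Rightarrow> 'b::real_inner"
  assumes "Ck (length is) g"
  shows "partial_deriv (count_list is) g = Dn g (map (\<lambda>i. axis i 1) is)"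
    and "mi_order (count_list is) = length is"
proof -
  define js where "js = (SOME js. \<forall>i. count_list js i = count_list is i)"
  have "\<forall>i. count_list js i = count_list is i"
    unfolding js_def by (rule someI[of _ "is"]) simp
  then have "mset js = mset is" by (simp add: multiset_eq_iff count_mset)
  then have "Dn g (map (\<lambda>i. axis i 1) is) = Dn g (map (\<lambda>i. axis i 1) js)"
    using assms by (intro Dn_mset_cong) simp_all
  then show "partial_deriv (count_list is) g = Dn g (map (\<lambda>i. axis i 1) is)"
    by (simp add: partial_deriv_def js_def)
  show "mi_order (count_list is) = length is"
    unfolding mi_order_def by (subst sum_count_list_UNIV) simp_all
qed

text \<open>The Lagrange form of the remainder is scalar. Pairing \<open>g\<close> with the
  remainder vector \<open>r\<close> itself gives |r|^2 \<le> K |r|, so the vector-valued bound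
  follows with no loss depending on the dimension.\<close>

lemma Taylor_Dn:
  fixes g :: "'a::real_normed_vector \<Rightarrow> 'b::real_inner"
  assumes "Ck n g" "0 < n"
    and K: "\<And>\<theta>. 0 \<le> \<theta> \<Longrightarrow> \<theta> \<le> 1 \<Longrightarrow> norm (Dn g (replicate n v) (x + \<theta> *\<^sub>R v)) \<le> K"
  shows "norm (g (x + v) - (\<Sum>q<n. (1 / fact q) *\<^sub>R Dn g (replicate q v) x)) \<le> K"
proof -
  define r where "r = g (x + v) - (\<Sum>q<n. (1 / fact q) *\<^sub>R Dn g (replicate q v) x)"
  define D where "D q \<theta> = Dn g (replicate q v) (x + \<theta> *\<^sub>R v) \<bullet> r" for q \<theta>
  have "(D q has_real_derivative D (Suc q) \<theta>) (at \<theta>)" if "q < n" for q \<theta>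
  proof -
    have "((\<lambda>\<theta>. Dn g (replicate q v) (x + \<theta> *\<^sub>R v)) has_vector_derivative
      Dn g (replicate (Suc q) v) (x + \<theta> *\<^sub>R v)) (at \<theta>)"
      using that by (simp only: replicate_Suc Dn.simps)
        (intro line_derivative Dn_differentiable[OF assms(1)], simp)
    from bounded_linear.has_vector_derivative[OF bounded_linear_inner_left this, of r]
    show ?thesis unfolding D_def has_real_derivative_iff_has_vector_derivative by simp
  qed
  then obtain \<theta> where \<theta>: "0 < \<theta>" "\<theta> < 1"
    "D 0 1 = (\<Sum>q<n. D q 0 / fact q * 1 ^ q) + D n \<theta> / fact n * 1 ^ n"
    using Maclaurin[of 1 n D "D 0"] assms(2) by auto
  have "r \<bullet> r = D n \<theta> / fact n"
    using \<theta>(3) unfolding D_def by (simp add: r_def inner_diff_left inner_sum_left)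
  also have "\<dots> \<le> \<bar>D n \<theta>\<bar>"
  proof -
    have "D n \<theta> / fact n \<le> \<bar>D n \<theta>\<bar> / fact n" by (intro divide_right_mono) auto
    also have "\<dots> \<le> \<bar>D n \<theta>\<bar> / 1" by (intro divide_left_mono) auto
    finally show ?thesis by simp
  qed
  also have "\<dots> \<le> norm (Dn g (replicate n v) (x + \<theta> *\<^sub>R v)) * norm r"
    unfolding D_def by (rule Cauchy_Schwarz_ineq2)
  also have "\<dots> \<le> K * norm r" using K[of \<theta>] \<theta> by (intro mult_right_mono) auto
  finally have "norm r * norm r \<le> K * norm r" by (simp add: dot_square_norm power2_eq_square)
  moreover have "0 \<le> K" using order_trans[OF norm_ge_zero K[of 0]] by simp
  ultimately show ?thesis unfolding r_def[symmetric]
    by (cases "r = 0") (simp_all add: mult_le_cancel_right)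
qed

section \<open>Contraction of the coproduct with a character\<close>

lemma poly_mapping_sum_single:
  assumes "finite S" "Poly_Mapping.keys p \<subseteq> S"
  shows "p = (\<Sum>k\<in>S. Poly_Mapping.single k (Poly_Mapping.lookup p k))"
proof (rule poly_mapping_eqI)
  fix k
  have "(\<Sum>l\<in>S. Poly_Mapping.lookup (Poly_Mapping.single l (Poly_Mapping.lookup p l)) k)
      = (\<Sum>l\<in>S. if l = k then Poly_Mapping.lookup p k else 0)"
    by (intro sum.cong) (auto simp: lookup_single when_def)
  also have "\<dots> = Poly_Mapping.lookup p k"
    using assms by (auto simp: in_keys_iff)
  finally show "Poly_Mapping.lookup p k
      = Poly_Mapping.lookup (\<Sum>k\<in>S. Poly_Mapping.single k (Poly_Mapping.lookup p k)) k"
    by (simp add: lookup_sum)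
qed

section \<open>Linear pairings and contraction of the first tensor factor\<close>

lemma pairing_superset:
  assumes "finite S" "Poly_Mapping.keys p \<subseteq> S"
  shows "pairing \<phi> p = (\<Sum>a\<in>S. \<phi> a *\<^sub>R Poly_Mapping.lookup p a)"
  unfolding pairing_def using assms
  by (intro sum.mono_neutral_left) (auto simp: in_keys_iff)

lemma pairing_add: "pairing \<phi> (p + q) = pairing \<phi> p + pairing \<phi> q"
proof -
  let ?S = "Poly_Mapping.keys p \<union> Poly_Mapping.keys q"
  have "Poly_Mapping.keys (p + q) \<subseteq> ?S" by (rule keys_add)
  then show ?thesis
    by (simp add: pairing_superset[of ?S] lookup_add scaleR_add_right sum.distrib)
qed

lemma pairing_zero [simp]: "pairing \<phi> 0 = 0"
  by (simp add: pairing_def)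

lemma pairing_sum: "pairing \<phi> (\<Sum>i\<in>I. p i) = (\<Sum>i\<in>I. pairing \<phi> (p i))"
  by (induction I rule: infinite_finite_induct) (simp_all add: pairing_add)

lemma pairing_single [simp]: "pairing \<phi> (Poly_Mapping.single k c) = \<phi> k *\<^sub>R c"
  by (simp add: pairing_def)

lemma pairing_cong:
  "(\<And>a. a \<in> Poly_Mapping.keys p \<Longrightarrow> \<phi> a = \<psi> a) \<Longrightarrow> pairing \<phi> p = pairing \<psi> p"
  by (simp add: pairing_def)

lemma pairing_lin_ext:
  fixes p :: "'a \<Rightarrow>\<^sub>0 'v::real_vector"
  shows "pairing \<phi> (lin_ext F p) = (\<Sum>a\<in>Poly_Mapping.keys p. pairing \<phi> (F a) *\<^sub>R Poly_Mapping.lookup p a)"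
proof -
  have "pairing \<phi> (Poly_Mapping.map (\<lambda>c. c *\<^sub>R v) q) = pairing \<phi> q *\<^sub>R v" for q and v :: 'v
  proof -
    have "Poly_Mapping.keys (Poly_Mapping.map (\<lambda>c. c *\<^sub>R v) q) \<subseteq> Poly_Mapping.keys q"
      by (auto simp: in_keys_iff map.rep_eq)
    then have "pairing \<phi> (Poly_Mapping.map (\<lambda>c. c *\<^sub>R v) q)
        = (\<Sum>a\<in>Poly_Mapping.keys q. \<phi> a *\<^sub>R (Poly_Mapping.lookup q a *\<^sub>R v))"
      by (subst pairing_superset[OF finite_keys]) (auto simp: map.rep_eq when_def in_keys_iff intro!: sum.cong)
    then show ?thesis by (simp add: pairing_def scaleR_sum_left)
  qed
  then show ?thesis by (simp add: lin_ext_def pairing_sum)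
qed

definition fwt :: "('d rtree \<Rightarrow> real) \<Rightarrow> 'd forest \<Rightarrow> real" where
  "fwt \<xi> a = prod_mset (image_mset \<xi> a)"

lemma fwt_simps [simp]:
  "fwt \<xi> {#} = 1" "fwt \<xi> (add_mset h a) = \<xi> h * fwt \<xi> a" "fwt \<xi> (a + b) = fwt \<xi> a * fwt \<xi> b"
  by (simp_all add: fwt_def)

text \<open>\<open>(\<xi> \<otimes> id) p\<close> for the multiplicative extension of \<open>\<xi>\<close>.\<close>

definition contract ::
    "('d rtree \<Rightarrow> real) \<Rightarrow> ('d forest \<times> 'd forest \<Rightarrow>\<^sub>0 real) \<Rightarrow> ('d forest \<Rightarrow>\<^sub>0 real)" where
  "contract \<xi> p = (\<Sum>k\<in>Poly_Mapping.keys p.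
     Poly_Mapping.single (snd k) (fwt \<xi> (fst k) * Poly_Mapping.lookup p k))"

lemma contract_superset:
  assumes "finite S" "Poly_Mapping.keys p \<subseteq> S"
  shows "contract \<xi> p = (\<Sum>k\<in>S. Poly_Mapping.single (snd k) (fwt \<xi> (fst k) * Poly_Mapping.lookup p k))"
  unfolding contract_def using assms
  by (intro sum.mono_neutral_left) (auto simp: in_keys_iff)

lemma contract_add: "contract \<xi> (p + q) = contract \<xi> p + contract \<xi> q"
proof -
  let ?S = "Poly_Mapping.keys p \<union> Poly_Mapping.keys q"
  have "Poly_Mapping.keys (p + q) \<subseteq> ?S" by (rule keys_add)
  then show ?thesis
    by (simp add: contract_superset[of ?S] lookup_add distrib_left single_add sum.distrib)
qed

lemma contract_zero [simp]: "contract \<xi> 0 = 0"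
  by (simp add: contract_def)

lemma contract_sum: "contract \<xi> (\<Sum>i\<in>I. p i) = (\<Sum>i\<in>I. contract \<xi> (p i))"
  by (induction I rule: infinite_finite_induct) (simp_all add: contract_add)

lemma contract_single [simp]:
  "contract \<xi> (Poly_Mapping.single k c) = Poly_Mapping.single (snd k) (fwt \<xi> (fst k) * c)"
  by (simp add: contract_def)

lemma contract_one [simp]: "contract \<xi> 1 = 1"
proof -
  have "contract \<xi> (Poly_Mapping.single 0 1) = Poly_Mapping.single 0 1"
    by (simp only: contract_single) (simp add: zero_prod_def)
  then show ?thesis by simp
qed

text \<open>The weight \<open>fwt \<xi>\<close> and the product of the second factors are both
  multiplicative, so \<open>\<xi> \<otimes> id\<close> is an algebra morphism. Together with the
  multiplicative coproduct this makes \<open>fcut\<close> multiplicative on forests.\<close>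

lemma contract_mult: "contract \<xi> (p * q) = contract \<xi> p * contract \<xi> q"
proof -
  let ?P = "Poly_Mapping.keys p" and ?Q = "Poly_Mapping.keys q"
  have "p * q = (\<Sum>k\<in>?P. Poly_Mapping.single k (Poly_Mapping.lookup p k))
      * (\<Sum>l\<in>?Q. Poly_Mapping.single l (Poly_Mapping.lookup q l))"
    using poly_mapping_sum_single[OF finite_keys order_refl, of p]
      poly_mapping_sum_single[OF finite_keys order_refl, of q] by (rule arg_cong2)
  also have "\<dots> = (\<Sum>k\<in>?P. \<Sum>l\<in>?Q. Poly_Mapping.single (k + l) (Poly_Mapping.lookup p k * Poly_Mapping.lookup q l))"
    by (simp add: sum_product mult_single)
  also have "contract \<xi> \<dots> = (\<Sum>k\<in>?P. \<Sum>l\<in>?Q.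
      Poly_Mapping.single (snd k) (fwt \<xi> (fst k) * Poly_Mapping.lookup p k)
      * Poly_Mapping.single (snd l) (fwt \<xi> (fst l) * Poly_Mapping.lookup q l))"
    by (simp add: contract_sum mult_single mult_ac)
  also have "\<dots> = contract \<xi> p * contract \<xi> q"
    by (simp add: contract_def sum_product)
  finally show ?thesis .
qed

lemma lookup_contract:
  "Poly_Mapping.lookup (contract \<xi> p) f = pairing (\<lambda>(a, b). fwt \<xi> a * (if b = f then 1 else 0)) p"
  unfolding contract_def pairing_def
  by (auto simp: lookup_sum lookup_single when_def case_prod_beta intro!: sum.cong)

lemma pairing_contract:
  "pairing (\<lambda>(a, b). fwt \<xi> a * \<psi> b) p = pairing \<psi> (contract \<xi> p)"
  unfolding contract_def pairing_sum pairing_single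
  by (simp add: pairing_def case_prod_beta mult_ac)

text \<open>This is \<open>(\<xi> \<otimes> id) \<Delta>f\<close>: the coefficient of
  \<open>b\<close> sums, over all ways to prune \<open>f\<close> down to the trunk \<open>b\<close>,
  the values of \<xi> on the branches cut off. It describes the change of base point.\<close>

definition fcut :: "('d rtree \<Rightarrow> real) \<Rightarrow> 'd forest \<Rightarrow> ('d forest \<Rightarrow>\<^sub>0 real)" where
  "fcut \<xi> f = contract \<xi> (coproduct_forest f)"

lemma coproduct_forest_simps [simp]:
  "coproduct_forest {#} = 1" "coproduct_forest (add_mset h f) = coproduct_tree h * coproduct_forest f"
  by (simp_all add: coproduct_forest_def)

lemma fcut_empty [simp]: "fcut \<xi> {#} = 1"
  by (simp add: fcut_def)

lemma fcut_add_mset: "fcut \<xi> (add_mset h f) = fcut \<xi> {#h#} * fcut \<xi> f"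
  by (simp add: fcut_def contract_mult)

lemma fcut_Node:
  "fcut \<xi> {#Node \<mu> f#} = Poly_Mapping.single {#} (\<xi> (Node \<mu> f))
     + (\<Sum>b\<in>Poly_Mapping.keys (fcut \<xi> f). Poly_Mapping.single {#Node \<mu> b#} (Poly_Mapping.lookup (fcut \<xi> f) b))"
proof -
  let ?p = "coproduct_forest f" and ?S = "Poly_Mapping.keys (fcut \<xi> f) \<union> snd ` Poly_Mapping.keys (coproduct_forest f)"
  have "fcut \<xi> {#Node \<mu> f#} = Poly_Mapping.single {#} (\<xi> (Node \<mu> f))
      + contract \<xi> (lin_ext (\<lambda>(a, b). Poly_Mapping.single (a, {#Node \<mu> b#}) 1) ?p)"
    by (simp add: fcut_def coproduct_forest_def contract_add)
  also have "lin_ext (\<lambda>(a, b). Poly_Mapping.single (a, {#Node \<mu> b#}) 1) ?p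
      = (\<Sum>k\<in>Poly_Mapping.keys ?p. Poly_Mapping.single (fst k, {#Node \<mu> (snd k)#}) (Poly_Mapping.lookup ?p k))"
    by (simp add: lin_ext_def case_prod_beta)
  also have "contract \<xi> \<dots> = (\<Sum>k\<in>Poly_Mapping.keys ?p.
      Poly_Mapping.single {#Node \<mu> (snd k)#} (fwt \<xi> (fst k) * Poly_Mapping.lookup ?p k))"
    by (simp add: contract_sum)
  \<comment> \<open>Cuts with the same trunk \<open>b\<close> are to be collected. \<open>?S\<close>
    contains every trunk that occurs, also those whose coefficients cancel and which are no keys of
    \<open>fcut \<xi> f\<close>.\<close>
  also have "\<dots> = (\<Sum>k\<in>Poly_Mapping.keys ?p. \<Sum>b\<in>?S.
      Poly_Mapping.single {#Node \<mu> b#} (fwt \<xi> (fst k) * (if snd k = b then 1 else 0) * Poly_Mapping.lookup ?p k))"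
  proof (intro sum.cong refl)
    fix k assume k: "k \<in> Poly_Mapping.keys ?p"
    have "(\<Sum>b\<in>?S. Poly_Mapping.single {#Node \<mu> b#}
        (fwt \<xi> (fst k) * (if snd k = b then 1 else 0) * Poly_Mapping.lookup ?p k))
      = (\<Sum>b\<in>{snd k}. Poly_Mapping.single {#Node \<mu> b#}
        (fwt \<xi> (fst k) * (if snd k = b then 1 else 0) * Poly_Mapping.lookup ?p k))"
      using k by (intro sum.mono_neutral_right) auto
    then show "Poly_Mapping.single {#Node \<mu> (snd k)#} (fwt \<xi> (fst k) * Poly_Mapping.lookup ?p k) =
      (\<Sum>b\<in>?S. Poly_Mapping.single {#Node \<mu> b#}
        (fwt \<xi> (fst k) * (if snd k = b then 1 else 0) * Poly_Mapping.lookup ?p k))" by simp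
  qed
  also have "\<dots> = (\<Sum>b\<in>?S. Poly_Mapping.single {#Node \<mu> b#} (Poly_Mapping.lookup (fcut \<xi> f) b))"
  proof (subst sum.swap, intro sum.cong refl)
    fix b
    have single_sum: "(\<Sum>k\<in>K. Poly_Mapping.single x (c k)) = Poly_Mapping.single x (\<Sum>k\<in>K. c k)"
      for x :: "'d forest" and c :: "'d forest \<times> 'd forest \<Rightarrow> real" and K
      by (induction K rule: infinite_finite_induct) (simp_all add: single_add)
    show "(\<Sum>k\<in>Poly_Mapping.keys ?p. Poly_Mapping.single {#Node \<mu> b#}
        (fwt \<xi> (fst k) * (if snd k = b then 1 else 0) * Poly_Mapping.lookup ?p k))
      = Poly_Mapping.single {#Node \<mu> b#} (Poly_Mapping.lookup (fcut \<xi> f) b)"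
      unfolding single_sum fcut_def lookup_contract by (simp add: pairing_def case_prod_beta)
  qed
  also have "\<dots> = (\<Sum>b\<in>Poly_Mapping.keys (fcut \<xi> f). Poly_Mapping.single {#Node \<mu> b#} (Poly_Mapping.lookup (fcut \<xi> f) b))"
    by (intro sum.mono_neutral_right) (auto simp: in_keys_iff)
  finally show ?thesis .
qed

lemma lookup_fcut_Node:
  "Poly_Mapping.lookup (fcut \<xi> {#h#}) {#} = \<xi> h"
  "Poly_Mapping.lookup (fcut \<xi> {#Node \<mu> f#}) {#Node \<nu> b#}
     = (if \<mu> = \<nu> then Poly_Mapping.lookup (fcut \<xi> f) b else 0)"
proof -
  obtain \<mu> f where h: "h = Node \<mu> f" by (cases h)
  show "Poly_Mapping.lookup (fcut \<xi> {#h#}) {#} = \<xi> h"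
    by (simp add: h fcut_Node lookup_add lookup_sum lookup_single)
  show "Poly_Mapping.lookup (fcut \<xi> {#Node \<mu> f#}) {#Node \<nu> b#}
     = (if \<mu> = \<nu> then Poly_Mapping.lookup (fcut \<xi> f) b else 0)" for \<mu> f
    by (simp add: fcut_Node lookup_add lookup_sum lookup_single when_def in_keys_iff sum.delta')
qed

lemma keys_fcut_tree:
  assumes "b \<in> Poly_Mapping.keys (fcut \<xi> {#h#})" "b \<noteq> {#}"
  shows "\<exists>h'. b = {#h'#}"
proof -
  obtain \<mu> f where h: "h = Node \<mu> f" by (cases h)
  show ?thesis
  proof (rule ccontr)
    assume n: "\<nexists>h'. b = {#h'#}"
    then have "Poly_Mapping.lookup (fcut \<xi> {#h#}) b = 0"
      using assms(2)
      by (auto simp: h fcut_Node lookup_add lookup_sum lookup_single when_def intro!: sum.neutral)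
    then show False using assms(1) by (simp add: in_keys_iff)
  qed
qed

lemma pairing_fcut_Node:
  "pairing \<psi> (fcut \<xi> {#Node \<mu> f#})
     = \<psi> {#} * \<xi> (Node \<mu> f) + pairing (\<lambda>b. \<psi> {#Node \<mu> b#}) (fcut \<xi> f)"
  unfolding fcut_Node pairing_add pairing_sum pairing_single by (simp add: pairing_def)

subsection \<open>Grading\<close>

lemma fvertices_simps [simp]:
  "fvertices {#} = 0" "fvertices (add_mset h f) = vertices h + fvertices f"
  "fvertices (f + g) = fvertices f + fvertices g"
  by (simp_all add: fvertices_def)

lemma vertices_Node [simp]: "vertices (Node \<mu> f) = Suc (fvertices f)"
  by (simp add: fvertices_def)

declare vertices.simps [simp del]

text \<open>The grading of single trees is a hypothesis because an induction over trees knows it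
  only for the trees of \<open>f\<close>. The second conclusion bounds the cut-off trees by trees of
  \<open>f\<close>, so that the first tensor factor stays in \<open>forests N\<close>, where
  characters are multiplicative.\<close>

lemma keys_coproduct_forest_aux:
  assumes "\<And>h a b. h \<in># f \<Longrightarrow> (a, b) \<in> Poly_Mapping.keys (coproduct_tree h) \<Longrightarrow>
     fvertices a + fvertices b = vertices h"
  shows "(a, b) \<in> Poly_Mapping.keys (coproduct_forest f) \<Longrightarrow>
     fvertices a + fvertices b = fvertices f \<and> (\<forall>h\<in>#a. \<exists>h'\<in>#f. vertices h \<le> vertices h')"
  using assms
proof (induction f arbitrary: a b)
  case empty
  then show ?case by (simp add: zero_prod_def)
next
  case (add h f)
  obtain a1 b1 a2 b2 where ab: "(a1, b1) \<in> Poly_Mapping.keys (coproduct_tree h)"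
    "(a2, b2) \<in> Poly_Mapping.keys (coproduct_forest f)" "a = a1 + a2" "b = b1 + b2"
    using add.prems(1) keys_mult[of "coproduct_tree h" "coproduct_forest f"]
    by (fastforce simp: plus_prod_def)
  have 1: "fvertices a1 + fvertices b1 = vertices h"
    using add.prems(2)[of h a1 b1] ab(1) by simp
  have 2: "fvertices a2 + fvertices b2 = fvertices f \<and> (\<forall>h\<in>#a2. \<exists>h'\<in>#f. vertices h \<le> vertices h')"
    using add.IH[OF ab(2)] add.prems(2) by simp
  have "vertices h' \<le> vertices h" if "h' \<in># a1" for h'
    using fvertices_mono[OF that] 1 by linarith
  then show ?case using 1 2 ab(3,4) by auto
qed

lemma keys_coproduct_tree:
  "(a, b) \<in> Poly_Mapping.keys (coproduct_tree h) \<Longrightarrow> fvertices a + fvertices b = vertices h"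
proof (induction h arbitrary: a b)
  case (Node \<mu> f)
  have "lin_ext (\<lambda>(a, b). Poly_Mapping.single (a, {#Node \<mu> b#}) 1) (coproduct_forest f)
      = (\<Sum>k\<in>Poly_Mapping.keys (coproduct_forest f).
          Poly_Mapping.single (fst k, {#Node \<mu> (snd k)#}) (Poly_Mapping.lookup (coproduct_forest f) k))"
    by (simp add: lin_ext_def case_prod_beta)
  then have "(a, b) \<in> Poly_Mapping.keys (Poly_Mapping.single ({#Node \<mu> f#}, {#}) (1::real)
      + (\<Sum>k\<in>Poly_Mapping.keys (coproduct_forest f).
          Poly_Mapping.single (fst k, {#Node \<mu> (snd k)#}) (Poly_Mapping.lookup (coproduct_forest f) k)))"
    using Node.prems by (simp add: coproduct_forest_def)
  then consider "(a, b) = ({#Node \<mu> f#}, {#})"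
    | k where "k \<in> Poly_Mapping.keys (coproduct_forest f)" "(a, b) = (fst k, {#Node \<mu> (snd k)#})"
    by (auto dest!: keys_add[THEN subsetD] keys_sum[THEN subsetD] split: if_splits)
  then show ?case
  proof cases
    case 2
    then show ?thesis using keys_coproduct_forest_aux[of f a "snd k"] Node.IH by simp
  qed simp
qed

lemma keys_coproduct_forest:
  "(a, b) \<in> Poly_Mapping.keys (coproduct_forest f) \<Longrightarrow>
     fvertices a + fvertices b = fvertices f \<and> (\<forall>h\<in>#a. \<exists>h'\<in>#f. vertices h \<le> vertices h')"
  using keys_coproduct_forest_aux keys_coproduct_tree by metis

lemma keys_fcutD: "b \<in> Poly_Mapping.keys (fcut \<xi> f) \<Longrightarrow> fvertices b \<le> fvertices f"
proof -
  assume "b \<in> Poly_Mapping.keys (fcut \<xi> f)"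
  then have "pairing (\<lambda>(a, b'). fwt \<xi> a * (if b' = b then 1 else 0)) (coproduct_forest f) \<noteq> 0"
    by (simp add: in_keys_iff fcut_def lookup_contract)
  then have "\<exists>k\<in>Poly_Mapping.keys (coproduct_forest f). snd k = b"
    by (rule contrapos_np) (auto simp: pairing_def case_prod_beta intro!: sum.neutral)
  then obtain k where "k \<in> Poly_Mapping.keys (coproduct_forest f)" "snd k = b" by blast
  then show ?thesis using keys_coproduct_forest[of "fst k" "snd k" f] by (cases k) auto
qed

lemma lookup_fcut_eq_0: "fvertices f < fvertices b \<Longrightarrow> Poly_Mapping.lookup (fcut \<xi> f) b = 0"
  using keys_fcutD[of b \<xi> f] by (fastforce simp: in_keys_iff)

text \<open>One factor \<open>E\<close> per tree is raised to one factor per vertex, which is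
  possible because every tree has a vertex and \<open>1 \<le> E\<close>; the bound then depends on
  the grading alone.\<close>

lemma fwt_bound:
  assumes "\<And>h. h \<in># a \<Longrightarrow> \<bar>\<xi> h\<bar> \<le> E * z ^ vertices h" "1 \<le> E" "0 \<le> z"
  shows "\<bar>fwt \<xi> a\<bar> \<le> E ^ fvertices a * z ^ fvertices a"
  using assms(1)
proof (induction a)
  case (add h a)
  have "\<bar>\<xi> h\<bar> \<le> E ^ vertices h * z ^ vertices h"
  proof -
    have "E ^ 1 \<le> E ^ vertices h"
      using assms(2) vertices_pos[of h] by (intro power_increasing) auto
    then have "E * z ^ vertices h \<le> E ^ vertices h * z ^ vertices h"
      using assms(3) by (intro mult_right_mono) auto
    then show ?thesis using add.prems[of h] by simp
  qed
  moreover have "\<bar>fwt \<xi> a\<bar> \<le> E ^ fvertices a * z ^ fvertices a"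
    using add by simp
  ultimately have "\<bar>\<xi> h\<bar> * \<bar>fwt \<xi> a\<bar> \<le> (E ^ vertices h * z ^ vertices h) * (E ^ fvertices a * z ^ fvertices a)"
    using assms by (intro mult_mono) auto
  then show ?case by (simp add: abs_mult power_add mult_ac)
qed simp

definition coproduct_mass :: "'d forest \<Rightarrow> real" where
  "coproduct_mass f = (\<Sum>k\<in>Poly_Mapping.keys (coproduct_forest f). \<bar>Poly_Mapping.lookup (coproduct_forest f) k\<bar>)"

text \<open>Every cut of \<open>f\<close> with trunk \<open>b\<close> removes exactly
  \<open>fvertices f - fvertices b\<close> vertices, so all contributions carry the same power of
  \<open>z\<close>.\<close>

lemma lookup_fcut_bound:
  assumes \<xi>: "\<And>h. h \<in> trees_le (int N) \<Longrightarrow> \<bar>\<xi> h\<bar> \<le> E * z ^ vertices h" and "1 \<le> E" "0 \<le> z"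
    and f: "f \<in> forests N"
  shows "\<bar>Poly_Mapping.lookup (fcut \<xi> f) b\<bar> \<le> coproduct_mass f * E ^ fvertices f * z ^ (fvertices f - fvertices b)"
proof -
  have "\<bar>fwt \<xi> (fst k) * (if snd k = b then 1 else 0)\<bar> \<le> E ^ fvertices f * z ^ (fvertices f - fvertices b)"
    if k: "k \<in> Poly_Mapping.keys (coproduct_forest f)" for k
  proof (cases "snd k = b")
    case True
    have kk: "(fst k, snd k) \<in> Poly_Mapping.keys (coproduct_forest f)" using k by simp
    have v: "fvertices (fst k) = fvertices f - fvertices b" "fvertices (fst k) \<le> fvertices f"
      using keys_coproduct_forest[OF kk] True by auto
    have "\<bar>\<xi> h\<bar> \<le> E * z ^ vertices h" if "h \<in># fst k" for h
      using keys_coproduct_forest[OF kk] that f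
      by (intro \<xi>) (force simp: forests_def trees_le_def)
    then have "\<bar>fwt \<xi> (fst k)\<bar> \<le> E ^ fvertices (fst k) * z ^ fvertices (fst k)"
      using assms by (intro fwt_bound) auto
    also have "\<dots> \<le> E ^ fvertices f * z ^ fvertices (fst k)"
      using assms v by (intro mult_right_mono power_increasing) auto
    finally show ?thesis using True v by simp
  qed (use assms in simp)
  then have "\<bar>Poly_Mapping.lookup (fcut \<xi> f) b\<bar> \<le> (\<Sum>k\<in>Poly_Mapping.keys (coproduct_forest f).
      (E ^ fvertices f * z ^ (fvertices f - fvertices b)) * \<bar>Poly_Mapping.lookup (coproduct_forest f) k\<bar>)"
    unfolding fcut_def lookup_contract pairing_def
    by (intro order_trans[OF sum_abs] sum_mono) (simp add: case_prod_beta abs_mult mult_right_mono)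
  then show ?thesis by (simp add: coproduct_mass_def sum_distrib_left sum_distrib_right mult_ac)
qed

subsection \<open>Characters and Chen's relation\<close>

definition tree_values :: "(('d forest \<Rightarrow>\<^sub>0 real) \<Rightarrow> real) \<Rightarrow> 'd rtree \<Rightarrow> real" where
  "tree_values \<zeta> h = \<zeta> (of_forest {#h#})"

lemma of_forest_in_Span: "f \<in> A \<Longrightarrow> of_forest f \<in> Span A"
  by (simp add: of_forest_def Span_def)

lemma character_of_forest:
  assumes "\<zeta> \<in> characters N" "f \<in> forests N"
  shows "\<zeta> (of_forest f) = fwt (tree_values \<zeta>) f"
  using assms(2)
proof (induction f)
  case empty
  have "of_forest {#} = (1 :: 'a forest \<Rightarrow>\<^sub>0 real)"
    by (simp add: of_forest_def flip: single_one zero_multiset_def)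
  then show ?case using assms(1) by (simp add: characters_def)
next
  case (add h f)
  then have f: "f \<in> forests N" "{#h#} \<in> forests N" by (auto simp: forests_def)
  have "of_forest (add_mset h f) = of_forest {#h#} * of_forest f"
    by (simp add: of_forest_def mult_single)
  then have "\<zeta> (of_forest (add_mset h f)) = \<zeta> (of_forest {#h#}) * \<zeta> (of_forest f)"
    using assms(1) f[THEN of_forest_in_Span] by (simp add: characters_def)
  then show ?case using add.IH f by (simp add: tree_values_def)
qed

lemma coproduct_of_forest [simp]: "coproduct (of_forest f) = coproduct_forest f"
proof -
  have "Poly_Mapping.map (\<lambda>c. c) p = p" for p :: "'a forest \<times> 'a forest \<Rightarrow>\<^sub>0 real"
    by (rule poly_mapping_eqI) (simp add: map.rep_eq when_def)
  then show ?thesis by (simp add: coproduct_def lin_ext_def of_forest_def)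
qed

lemma forests_mono_keys:
  assumes "(a, b) \<in> Poly_Mapping.keys (coproduct_forest f)" "f \<in> forests N"
  shows "a \<in> forests N"
  using keys_coproduct_forest[OF assms(1)] assms(2) by (force simp: forests_def trees_le_def)

text \<open>A bound on the total number of vertices bounds each tree, so membership in
  \<open>forests N\<close> comes for free.\<close>

lemma forests_le_minus_iff: "f \<in> forests_le N (int N - int j) \<longleftrightarrow> fvertices f + j \<le> N"
  using fvertices_mono[of _ f] by (fastforce simp: forests_le_def forests_def trees_le_def)

lemma forests_le_1_iff: "f \<in> forests_le N (int N - 1) \<longleftrightarrow> fvertices f < N"
  using forests_le_minus_iff[of f N 1] by auto

lemma trees_le_iff: "h \<in> trees_le (int N) \<longleftrightarrow> vertices h \<le> N"
  "h \<in> trees_le (int N - 1) \<longleftrightarrow> vertices h < N"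
  by (auto simp: trees_le_def)

text \<open>The recursion of the coproduct splits Chen's relation on \<open>Node \<mu> f\<close>:
  cutting off the whole tree gives the value on (s, u); otherwise the root survives and only the
  forest \<open>f\<close> above it is pruned.\<close>

lemma Chen_Node:
  fixes X :: "real \<Rightarrow> real \<Rightarrow> ('d::finite forest \<Rightarrow>\<^sub>0 real) \<Rightarrow> real"
  assumes "rough_path \<alpha> N X" "s \<in> {0..1}" "u \<in> {0..1}" "t \<in> {0..1}" "fvertices f < N"
  shows "tree_values (X s t) (Node \<mu> f) = tree_values (X s u) (Node \<mu> f)
    + (\<Sum>b\<in>forests_le N (int N - 1). tree_values (X u t) (Node \<mu> b) * Poly_Mapping.lookup (fcut (tree_values (X s u)) f) b)"
proof -
  let ?h = "{#Node \<mu> f#}" and ?\<xi> = "tree_values (X s u)"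
  have "?h \<in> utrees_le (int N)" using assms(5) by (auto simp: utrees_le_def trees_le_def)
  then have "X s t (of_forest ?h) = pairing (tensor_fun (X s u) (X u t)) (coproduct (of_forest ?h))"
    using assms(1-4) unfolding rough_path_def by metis
  also have "\<dots> = pairing (\<lambda>(a, b). fwt ?\<xi> a * X u t (of_forest b)) (coproduct_forest ?h)"
    unfolding coproduct_of_forest
  proof (rule pairing_cong)
    fix k assume "k \<in> Poly_Mapping.keys (coproduct_forest ?h)"
    then have "(fst k, snd k) \<in> Poly_Mapping.keys (coproduct_forest ?h)" by simp
    moreover have "?h \<in> forests N" using assms(5) by (simp add: forests_def trees_le_def)
    ultimately have "fst k \<in> forests N" by (rule forests_mono_keys)
    moreover have "X s u \<in> characters N" using assms(1-3) by (simp add: rough_path_def)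
    ultimately show "tensor_fun (X s u) (X u t) k = (case k of (a, b) \<Rightarrow> fwt ?\<xi> a * X u t (of_forest b))"
      by (simp add: tensor_fun_def case_prod_beta character_of_forest)
  qed
  also have "\<dots> = pairing (\<lambda>b. X u t (of_forest b)) (fcut ?\<xi> ?h)"
    unfolding pairing_contract fcut_def ..
  also have "\<dots> = X u t (of_forest {#}) * ?\<xi> (Node \<mu> f)
      + pairing (\<lambda>b. tree_values (X u t) (Node \<mu> b)) (fcut ?\<xi> f)"
    unfolding pairing_fcut_Node tree_values_def ..
  also have "X u t (of_forest {#}) = 1"
  proof -
    have "X u t \<in> characters N" using assms(1-4) by (simp add: rough_path_def)
    then show ?thesis using character_of_forest[of "X u t" N "{#}"] by (simp add: forests_def)
  qed
  also have "pairing (\<lambda>b. tree_values (X u t) (Node \<mu> b)) (fcut ?\<xi> f) =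
      (\<Sum>b\<in>forests_le N (int N - 1). tree_values (X u t) (Node \<mu> b) *\<^sub>R Poly_Mapping.lookup (fcut ?\<xi> f) b)"
    using assms(5) keys_fcutD[of _ ?\<xi> f]
    by (intro pairing_superset finite_forests_le) (fastforce simp: forests_le_1_iff)
  finally show ?thesis by (simp add: tree_values_def)
qed

lemma sum_utrees_le:
  fixes F :: "'d::finite forest \<Rightarrow> 'b::comm_monoid_add"
  shows "(\<Sum>f\<in>utrees_le j. F f) = F {#} + (\<Sum>h\<in>trees_le j. F {#h#})"
proof -
  have "(\<Sum>f\<in>(\<lambda>h. {#h#}) ` trees_le j. F f) = (\<Sum>h\<in>trees_le j. F {#h#})"
    by (subst sum.reindex) (auto simp: inj_on_def)
  then show ?thesis
    unfolding utrees_le_def by (subst sum.insert) (auto simp: finite_trees_le)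
qed

text \<open>Pairing the second slot with the empty forest keeps only complete cuts, so the lowest
  remainder is the increment of Y minus its tree expansion.\<close>

lemma remainder_empty:
  fixes X :: "real \<Rightarrow> real \<Rightarrow> ('d::finite forest \<Rightarrow>\<^sub>0 real) \<Rightarrow> real"
  assumes "X s t \<in> characters N" "Y s \<in> Span (utrees_le (int N - 1))"
  shows "remainder X Y {#} s t = Poly_Mapping.lookup (Y t) {#} - Poly_Mapping.lookup (Y s) {#}
    - (\<Sum>h\<in>trees_le (int N - 1). tree_values (X s t) h *\<^sub>R Poly_Mapping.lookup (Y s) {#h#})"
proof -
  let ?\<xi> = "tree_values (X s t)" and ?\<phi> = "\<lambda>(a, b). X s t (of_forest a) * (if b = {#} then 1 else 0)"
  have keys: "Poly_Mapping.keys (Y s) \<subseteq> utrees_le (int N - 1)" using assms(2) by (simp add: Span_def)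
  have "pairing ?\<phi> (coproduct (Y s))
      = (\<Sum>g\<in>Poly_Mapping.keys (Y s). pairing ?\<phi> (coproduct_forest g) *\<^sub>R Poly_Mapping.lookup (Y s) g)"
    by (simp add: coproduct_def pairing_lin_ext)
  also have "\<dots> = (\<Sum>g\<in>Poly_Mapping.keys (Y s). Poly_Mapping.lookup (fcut ?\<xi> g) {#} *\<^sub>R Poly_Mapping.lookup (Y s) g)"
  proof (intro sum.cong refl arg_cong2[where f = scaleR])
    fix g assume "g \<in> Poly_Mapping.keys (Y s)"
    then have g: "g \<in> forests N" using keys by (force simp: utrees_le_def forests_def trees_le_def)
    show "pairing ?\<phi> (coproduct_forest g) = Poly_Mapping.lookup (fcut ?\<xi> g) {#}"
      unfolding fcut_def lookup_contract
      by (intro pairing_cong) (use g forests_mono_keys character_of_forest[OF assms(1)] in force)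
  qed
  also have "\<dots> = (\<Sum>g\<in>utrees_le (int N - 1). Poly_Mapping.lookup (fcut ?\<xi> g) {#} *\<^sub>R Poly_Mapping.lookup (Y s) g)"
    using keys by (intro sum.mono_neutral_left) (auto simp: in_keys_iff utrees_le_def finite_trees_le)
  also have "\<dots> = Poly_Mapping.lookup (Y s) {#}
      + (\<Sum>h\<in>trees_le (int N - 1). ?\<xi> h *\<^sub>R Poly_Mapping.lookup (Y s) {#h#})"
    by (simp add: sum_utrees_le lookup_fcut_Node)
  finally show ?thesis by (simp add: remainder_def)
qed

section \<open>Sums over lists of trees\<close>

definition tuples :: "'a set \<Rightarrow> nat \<Rightarrow> 'a list set" where
  "tuples A n = {xs. set xs \<subseteq> A \<and> length xs = n}"

lemma finite_tuples [simp]: "finite A \<Longrightarrow> finite (tuples A n)"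
  unfolding tuples_def by (rule finite_lists_length_eq)

lemma sum_tuples_0 [simp]: "(\<Sum>xs\<in>tuples A 0. F xs) = F []"
proof -
  have "tuples A 0 = {[]}" by (auto simp: tuples_def)
  then show ?thesis by simp
qed

lemma sum_tuples_Suc:
  "(\<Sum>xs\<in>tuples A (Suc n). F xs) = (\<Sum>x\<in>A. \<Sum>xs\<in>tuples A n. F (x # xs))"
proof -
  have "tuples A (Suc n) = (\<lambda>(x, xs). x # xs) ` (A \<times> tuples A n)"
    by (auto simp: tuples_def length_Suc_conv image_iff)
  then have "(\<Sum>xs\<in>tuples A (Suc n). F xs) = (\<Sum>(x, xs)\<in>A \<times> tuples A n. F (x # xs))"
    by (simp add: sum.reindex inj_on_def case_prod_beta)
  then show ?thesis by (simp add: sum.cartesian_product)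
qed

definition multilinear :: "nat \<Rightarrow> ('v::real_vector list \<Rightarrow> 'w::real_vector) \<Rightarrow> bool" where
  "multilinear n A \<longleftrightarrow> (\<forall>us vs. Suc (length us + length vs) = n \<longrightarrow> linear (\<lambda>v. A (us @ v # vs)))"

lemma multilinear_Cons: "multilinear (Suc n) A \<Longrightarrow> multilinear n (\<lambda>vs. A (v # vs))"
  unfolding multilinear_def using append_Cons[of v] by (auto simp flip: append_Cons)

lemma multilinear_hd: "multilinear (Suc n) A \<Longrightarrow> length vs = n \<Longrightarrow> linear (\<lambda>v. A (v # vs))"
  using append_Nil[of "_ # vs"] unfolding multilinear_def by (elim allE[of _ "[]"] allE[of _ vs]) simp

lemma multilinear_expand:
  assumes "finite T"
  shows "multilinear (length ws) A \<Longrightarrow>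
    A (map (\<lambda>w. \<Sum>g\<in>T. c g w *\<^sub>R Y g) ws)
      = (\<Sum>gs\<in>tuples T (length ws). prod_list (map2 c gs ws) *\<^sub>R A (map Y gs))"
proof (induction ws arbitrary: A)
  case (Cons w ws)
  let ?V = "\<lambda>w. \<Sum>g\<in>T. c g w *\<^sub>R Y g"
  have m: "multilinear (Suc (length ws)) A" using Cons.prems by simp
  have lin: "linear (\<lambda>v. A (v # map ?V ws))" by (rule multilinear_hd[OF m]) simp
  have "A (map ?V (w # ws)) = (\<Sum>g\<in>T. c g w *\<^sub>R A (Y g # map ?V ws))"
    by (simp add: linear_sum[OF lin] linear_cmul[OF lin])
  also have "\<dots> = (\<Sum>g\<in>T. c g w *\<^sub>R (\<Sum>gs\<in>tuples T (length ws). prod_list (map2 c gs ws) *\<^sub>R A (Y g # map Y gs)))"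
    by (intro sum.cong refl arg_cong2[where f = scaleR] Cons.IH multilinear_Cons[OF m])
  finally show ?case by (simp add: sum_tuples_Suc scaleR_sum_right)
qed simp

text \<open>Telescoping over the slots: the arguments are exchanged one at a time. The list
  \<open>bs\<close> bounds both families, and \<open>t\<close> measures their distance relative to
  \<open>bs\<close>.\<close>

lemma multilinear_diff_bound:
  fixes A :: "'v::real_normed_vector list \<Rightarrow> 'w::real_normed_vector"
  assumes "0 \<le> t" "0 \<le> K"
  shows "multilinear (length us) A \<Longrightarrow>
    (\<And>ws. length ws = length us \<Longrightarrow> norm (A ws) \<le> K * prod_list (map norm ws)) \<Longrightarrow>
    length vs = length us \<Longrightarrow> length bs = length us \<Longrightarrow>
    (\<And>i. i < length us \<Longrightarrow> norm (us ! i) \<le> bs ! i \<and> norm (vs ! i) \<le> bs ! i \<and> norm (us ! i - vs ! i) \<le> bs ! i * t) \<Longrightarrow>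
    norm (A us - A vs) \<le> real (length us) * K * t * prod_list bs"
  using assms(2)
proof (induction us arbitrary: A vs bs K)
  case (Cons u us)
  obtain v vs' b bs' where vs: "vs = v # vs'" and bs: "bs = b # bs'"
    using Cons.prems by (metis length_Suc_conv)
  have u: "norm u \<le> b" "norm v \<le> b" "norm (u - v) \<le> b * t"
    using Cons.prems(5)[of 0] vs bs by auto
  have us: "norm (us ! i) \<le> bs' ! i \<and> norm (vs' ! i) \<le> bs' ! i \<and> norm (us ! i - vs' ! i) \<le> bs' ! i * t"
    if "i < length us" for i
    using Cons.prems(5)[of "Suc i"] vs bs that by auto
  have len: "length vs' = length us" "length bs' = length us" using Cons.prems vs bs by auto
  have b0: "0 \<le> b" using u(1) norm_ge_zero order_trans by blast
  have prod_le: "prod_list (map norm vs') \<le> prod_list bs' \<and> 0 \<le> prod_list bs'"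
    using us len
  proof (induction vs' arbitrary: us bs')
    case (Cons v' vs')
    obtain u' us' b' bs'' where *: "us = u' # us'" "bs' = b' # bs''"
      using Cons.prems by (metis length_Suc_conv)
    have "prod_list (map norm vs') \<le> prod_list bs'' \<and> 0 \<le> prod_list bs''"
      using Cons.IH[of us' bs''] Cons.prems(1)[of "Suc _"] Cons.prems(2,3) * by auto
    moreover have "norm v' \<le> b'" using Cons.prems(1)[of 0] * by auto
    moreover from this have "0 \<le> b'" using norm_ge_zero order_trans by blast
    ultimately show ?case using * by (auto intro!: mult_mono mult_nonneg_nonneg prod_list_nonneg)
  qed simp
  have m: "multilinear (Suc (length us)) A" using Cons.prems by simp
  have "norm (A (u # us) - A (u # vs')) \<le> real (length us) * (K * b) * t * prod_list bs'"
  proof (rule Cons.IH)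
    show "multilinear (length us) (\<lambda>vs. A (u # vs))" using m by (rule multilinear_Cons)
    fix ws :: "'v list" assume "length ws = length us"
    then have "norm (A (u # ws)) \<le> K * (norm u * prod_list (map norm ws))"
      using Cons.prems(2)[of "u # ws"] by simp
    also have "\<dots> \<le> K * (b * prod_list (map norm ws))"
      using u Cons.prems(6) by (intro mult_left_mono mult_right_mono prod_list_nonneg) auto
    finally show "norm (A (u # ws)) \<le> K * b * prod_list (map norm ws)" by simp
  qed (use us len b0 Cons.prems(6) in auto)
  moreover have "norm (A (u # vs') - A (v # vs')) \<le> K * t * (b * prod_list bs')"
  proof -
    have "A (u # vs') - A (v # vs') = A ((u - v) # vs')"
      using linear_diff[OF multilinear_hd[OF m len(1)]] by simp
    also have "norm \<dots> \<le> K * (norm (u - v) * prod_list (map norm vs'))"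
      using Cons.prems(2)[of "(u - v) # vs'"] len by simp
    also have "\<dots> \<le> K * ((b * t) * prod_list bs')"
      using u prod_le b0 assms(1) Cons.prems(6)
      by (intro mult_left_mono mult_mono prod_list_nonneg) auto
    finally show ?thesis by (simp add: mult_ac)
  qed
  moreover have "A (u # us) - A vs = (A (u # us) - A (u # vs')) + (A (u # vs') - A (v # vs'))"
    by (simp add: vs)
  ultimately show ?case
    using norm_triangle_ineq[of "A (u # us) - A (u # vs')" "A (u # vs') - A (v # vs')"]
    by (simp add: bs algebra_simps)
qed simp

section \<open>Trunks of lists of trees\<close>

text \<open>A tree \<open>g\<close> is either cut off entirely (\<open>None\<close>) or pruned to a trunk \<open>h\<close> (\<open>Some h\<close>).\<close>

definition option_forest :: "'d rtree option \<Rightarrow> 'd forest" where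
  "option_forest w = (case w of None \<Rightarrow> {#} | Some h \<Rightarrow> {#h#})"

lemma option_forest_simps [simp]: "option_forest None = {#}" "option_forest (Some h) = {#h#}"
  by (simp_all add: option_forest_def)

definition fcut_coeff :: "('d rtree \<Rightarrow> real) \<Rightarrow> 'd rtree \<Rightarrow> 'd rtree option \<Rightarrow> real" where
  "fcut_coeff \<xi> g w = Poly_Mapping.lookup (fcut \<xi> {#g#}) (option_forest w)"

lemma fcut_tree_expand:
  fixes g :: "'d::finite rtree"
  assumes "g \<in> trees_le j"
  shows "fcut \<xi> {#g#} = (\<Sum>w\<in>insert None (Some ` trees_le j).
    Poly_Mapping.single (option_forest w) (fcut_coeff \<xi> g w))"
proof -
  let ?W = "insert None (Some ` (trees_le j :: 'd rtree set))"
  have "Poly_Mapping.keys (fcut \<xi> {#g#}) \<subseteq> option_forest ` ?W"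
  proof
    fix b assume b: "b \<in> Poly_Mapping.keys (fcut \<xi> {#g#})"
    show "b \<in> option_forest ` ?W"
    proof (cases "b = {#}")
      case False
      then obtain h where "b = {#h#}" using keys_fcut_tree[OF b] by blast
      moreover have "vertices h \<le> vertices g" using keys_fcutD[OF b] calculation by simp
      ultimately show ?thesis using assms by (force simp: trees_le_def)
    qed force
  qed
  then have "fcut \<xi> {#g#} = (\<Sum>k\<in>option_forest ` ?W. Poly_Mapping.single k (Poly_Mapping.lookup (fcut \<xi> {#g#}) k))"
    by (intro poly_mapping_sum_single) (simp_all add: finite_trees_le)
  also have "inj_on option_forest ?W" by (auto simp: inj_on_def)
  then have "(\<Sum>k\<in>option_forest ` ?W. Poly_Mapping.single k (Poly_Mapping.lookup (fcut \<xi> {#g#}) k))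
      = (\<Sum>w\<in>?W. Poly_Mapping.single (option_forest w) (fcut_coeff \<xi> g w))"
    by (simp only: sum.reindex comp_def fcut_coeff_def)
  finally show ?thesis .
qed

text \<open>Multiplicativity of \<open>fcut\<close> with the positions kept: each tree of the list
  has its own trunk. The result can thereby be inserted into a multilinear map slot by slot.\<close>

lemma fcut_list_expand:
  fixes gs :: "'d::finite rtree list"
  assumes "set gs \<subseteq> trees_le j"
  shows "fcut \<xi> (mset gs) = (\<Sum>ws\<in>tuples (insert None (Some ` trees_le j)) (length gs).
    Poly_Mapping.single (sum_list (map option_forest ws)) (prod_list (map2 (fcut_coeff \<xi>) gs ws)))"
  using assms
proof (induction gs)
  case Nil
  then show ?case by (simp flip: zero_multiset_def)
next
  case (Cons g gs)
  then have g: "g \<in> trees_le j" and gs: "set gs \<subseteq> trees_le j" by auto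
  show ?case
    by (simp add: fcut_add_mset[of \<xi> g] fcut_tree_expand[OF g] Cons.IH[OF gs] sum_product mult_single
        sum_tuples_Suc del: insert_iff sum.insert)
qed

text \<open>The lists of trunks with total trunk \<open>f\<close> are exactly the arrangements of
  the trees of \<open>f\<close> and a fixed number of \<open>None\<close>; counting them reduces to
  counting the permutations of a multiset.\<close>

lemma sum_list_option_forest_iff:
  "sum_list (map option_forest ws) = f \<longleftrightarrow>
     size f \<le> length ws \<and> mset ws = image_mset Some f + replicate_mset (length ws - size f) None"
proof
  assume "sum_list (map option_forest ws) = f"
  then show "size f \<le> length ws \<and> mset ws = image_mset Some f + replicate_mset (length ws - size f) None"
  proof (induction ws arbitrary: f)
    case (Cons w ws)
    let ?f = "sum_list (map option_forest ws)"
    have IH: "size ?f \<le> length ws" "mset ws = image_mset Some ?f + replicate_mset (length ws - size ?f) None"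
      using Cons.IH[OF refl] by auto
    show ?case
    proof (cases w)
      case None
      then show ?thesis using IH Cons.prems by (auto simp: Suc_diff_le)
    next
      case (Some h)
      then have "f = add_mset h ?f" using Cons.prems by simp
      then show ?thesis using IH Some by simp
    qed
  qed simp
next
  assume a: "size f \<le> length ws \<and> mset ws = image_mset Some f + replicate_mset (length ws - size f) None"
  have "sum_list (map option_forest ws) = sum_mset (image_mset option_forest (mset ws))"
    by (metis mset_map sum_mset_sum_list)
  also have "\<dots> = f"
    by (subst conjunct2[OF a]) (simp add: multiset.map_comp comp_def)
  finally show "sum_list (map option_forest ws) = f" .
qed

text \<open>The number of distinct listings of \<open>f\<close> divided by
  \<open>fact (size f)\<close>: the weight that is left when a symmetric average over listings is
  replaced by a single one.\<close>

definition sym_factor :: "'a multiset \<Rightarrow> real" where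
  "sym_factor f = 1 / (\<Prod>x\<in>set_mset f. fact (count f x))"

lemma sym_factor_bounds: "0 < sym_factor f" "sym_factor f \<le> 1"
proof -
  have "1 \<le> (\<Prod>x\<in>set_mset f. fact (count f x) :: real)"
    by (intro prod_ge_1) auto
  then show "0 < sym_factor f" "sym_factor f \<le> 1" unfolding sym_factor_def by (auto simp: divide_simps)
qed

lemma card_permutations_sym_factor:
  "real (card (permutations_of_multiset f)) = fact (size f) * sym_factor f"
proof -
  have "real (card (permutations_of_multiset f) * (\<Prod>x\<in>set_mset f. fact (count f x))) = fact (size f)"
    by (simp only: card_permutations_of_multiset_aux of_nat_fact)
  then show ?thesis by (simp add: sym_factor_def field_simps prod_zero_iff)
qed

lemma sym_factor_padding:
  "sym_factor (image_mset Some f + replicate_mset k None) = sym_factor f / fact k"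
proof -
  let ?M = "image_mset Some f + replicate_mset k None"
  have cS: "count ?M (Some x) = count f x" for x
    by (induction f) auto
  have cN: "count ?M None = k"
    by (induction f) auto
  have "(\<Prod>x\<in>set_mset ?M. fact (count ?M x) :: real) = (\<Prod>x\<in>insert None (Some ` set_mset f). fact (count ?M x))"
  proof (rule prod.mono_neutral_left)
    show "\<forall>i\<in>insert None (Some ` set_mset f) - set_mset ?M. (fact (count ?M i) :: real) = 1"
    proof
      fix i assume "i \<in> insert None (Some ` set_mset f) - set_mset ?M"
      then have "count ?M i = 0" unfolding not_in_iff[symmetric] by blast
      then show "(fact (count ?M i) :: real) = 1" by (simp only: fact_0)
    qed
  qed auto
  also have "\<dots> = fact k * (\<Prod>x\<in>set_mset f. fact (count f x))"
  proof (subst prod.insert)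
    have "(\<Prod>x\<in>Some ` set_mset f. fact (count ?M x) :: real) = (\<Prod>x\<in>set_mset f. fact (count f x))"
      by (subst prod.reindex) (simp, simp only: comp_def cS)
    then show "fact (count ?M None) * (\<Prod>x\<in>Some ` set_mset f. fact (count ?M x)) =
        (fact k * (\<Prod>x\<in>set_mset f. fact (count f x)) :: real)" by (simp only: cN)
  qed auto
  finally show ?thesis by (simp add: sym_factor_def)
qed

text \<open>The combinatorial core of the composition estimate: the coefficient of \<open>f\<close> in
  \<open>\<Prod>\<^sub>i (\<xi> \<otimes> id) \<Delta>g\<^sub>i\<close> selects the trees of \<open>f\<close> as trunks of some of the \<open>g\<^sub>i\<close> and cuts the others off
  entirely, and by symmetry of \<open>A\<close> all positions of the trunks contribute equally.\<close>

lemma sum_tuples_fcut: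
  fixes A :: "'v::real_vector list \<Rightarrow> 'w::real_vector" and hs :: "'d::finite rtree list"
    and \<xi> :: "'d rtree \<Rightarrow> real" and Y :: "'d rtree \<Rightarrow> 'v"
  assumes A: "multilinear n A"
    and sym: "\<And>us vs. length us = n \<Longrightarrow> mset us = mset vs \<Longrightarrow> A us = A vs"
    and hs: "set hs \<subseteq> trees_le j"
  defines "V \<equiv> \<lambda>w. \<Sum>g\<in>trees_le j. fcut_coeff \<xi> g w *\<^sub>R Y g"
  shows "(\<Sum>gs\<in>tuples (trees_le j) n. Poly_Mapping.lookup (fcut \<xi> (mset gs)) (mset hs) *\<^sub>R A (map Y gs))
    = (if length hs \<le> n then (fact n / fact (n - length hs) * sym_factor (mset hs))
         *\<^sub>R A (map (\<lambda>h. V (Some h)) hs @ replicate (n - length hs) (V None)) else 0)"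
proof -
  let ?T = "trees_le j :: 'd rtree set" and ?f = "mset hs"
  let ?W = "insert None (Some ` ?T)"
  let ?M = "image_mset Some ?f + replicate_mset (n - size ?f) None"
  let ?S = "{ws \<in> tuples ?W n. sum_list (map option_forest ws) = ?f}"
  have fin: "finite ?T" "finite ?W" by (simp_all add: finite_trees_le)
  have "(\<Sum>gs\<in>tuples ?T n. Poly_Mapping.lookup (fcut \<xi> (mset gs)) ?f *\<^sub>R A (map Y gs))
      = (\<Sum>gs\<in>tuples ?T n. \<Sum>ws\<in>?S. prod_list (map2 (fcut_coeff \<xi>) gs ws) *\<^sub>R A (map Y gs))"
  proof (intro sum.cong refl)
    fix gs assume "gs \<in> tuples ?T n"
    then have gs: "set gs \<subseteq> ?T" "length gs = n" by (auto simp: tuples_def)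
    have "Poly_Mapping.lookup (fcut \<xi> (mset gs)) ?f = (\<Sum>ws\<in>?S. prod_list (map2 (fcut_coeff \<xi>) gs ws))"
      unfolding fcut_list_expand[OF gs(1)] lookup_sum lookup_single gs(2)
      using fin by (simp add: when_def sum.If_cases Int_def)
    then show "Poly_Mapping.lookup (fcut \<xi> (mset gs)) ?f *\<^sub>R A (map Y gs)
        = (\<Sum>ws\<in>?S. prod_list (map2 (fcut_coeff \<xi>) gs ws) *\<^sub>R A (map Y gs))"
      by (simp add: scaleR_sum_left)
  qed
  also have "\<dots> = (\<Sum>ws\<in>?S. \<Sum>gs\<in>tuples ?T n. prod_list (map2 (fcut_coeff \<xi>) gs ws) *\<^sub>R A (map Y gs))"
    by (rule sum.swap)
  \<comment> \<open>For fixed trunks \<open>ws\<close> the weights factorise over the slots, so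
    multilinearity resums all \<open>gs\<close> into \<open>A\<close> at the values
    \<open>V\<close>.\<close>
  also have "\<dots> = (\<Sum>ws\<in>?S. A (map V ws))"
  proof (intro sum.cong refl)
    fix ws assume "ws \<in> ?S"
    then have l: "length ws = n" by (simp add: tuples_def)
    show "(\<Sum>gs\<in>tuples ?T n. prod_list (map2 (fcut_coeff \<xi>) gs ws) *\<^sub>R A (map Y gs)) = A (map V ws)"
      unfolding V_def using multilinear_expand[OF fin(1), of ws A "fcut_coeff \<xi>" Y] A l by simp
  qed
  also have "\<dots> = (if length hs \<le> n then (fact n / fact (n - length hs) * sym_factor ?f)
         *\<^sub>R A (map (\<lambda>h. V (Some h)) hs @ replicate (n - length hs) (V None)) else 0)"
  proof (cases "length hs \<le> n")
    case True
    have S: "?S = permutations_of_multiset ?M"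
    proof (intro set_eqI iffI)
      fix ws assume "ws \<in> ?S"
      then show "ws \<in> permutations_of_multiset ?M"
        using sum_list_option_forest_iff[of ws ?f] by (auto simp: tuples_def permutations_of_multiset_def)
    next
      fix ws assume "ws \<in> permutations_of_multiset ?M"
      then have m: "mset ws = ?M" by (simp add: permutations_of_multiset_def)
      then have l: "length ws = n" using True by (metis size_mset size_union size_image_mset size_replicate_mset le_add_diff_inverse)
      have "set ws = set_mset ?M" using m by (metis set_mset_mset)
      then have "set ws \<subseteq> ?W" using hs by auto
      then show "ws \<in> ?S" using m l True sum_list_option_forest_iff[of ws ?f] by (simp add: tuples_def)
    qed
    have "A (map V ws) = A (map (\<lambda>h. V (Some h)) hs @ replicate (n - length hs) (V None))" if "ws \<in> ?S" for ws
    proof (rule sym)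
      show "length (map V ws) = n" using that by (simp add: tuples_def)
      have "mset ws = mset (map Some hs @ replicate (n - length hs) None)"
        using that unfolding S by (simp add: permutations_of_multiset_def)
      then have "mset (map V ws) = mset (map V (map Some hs @ replicate (n - length hs) None))"
        by (metis mset_map)
      then show "mset (map V ws) = mset (map (\<lambda>h. V (Some h)) hs @ replicate (n - length hs) (V None))"
        by (simp add: comp_def)
    qed
    then have "(\<Sum>ws\<in>?S. A (map V ws)) = (\<Sum>ws\<in>?S. A (map (\<lambda>h. V (Some h)) hs @ replicate (n - length hs) (V None)))"
      by (rule sum.cong[OF refl])
    also have "\<dots> = real (card ?S) *\<^sub>R A (map (\<lambda>h. V (Some h)) hs @ replicate (n - length hs) (V None))"
      by (rule sum_constant_scaleR)
    \<comment> \<open>The number of arrangements of the padded multiset; the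
      \<open>n - length hs\<close> copies of \<open>None\<close> supply the factorial in the
      denominator.\<close>
    also have "real (card ?S) = fact n / fact (n - length hs) * sym_factor ?f"
      unfolding S card_permutations_sym_factor sym_factor_padding using True by simp
    finally show ?thesis using True by simp
  next
    case False
    then have "?S = {}" using sum_list_option_forest_iff[of _ ?f] by (auto simp: tuples_def)
    then show ?thesis using False by (simp only: sum.empty if_False)
  qed
  finally show ?thesis .
qed

section \<open>Composition with a smooth function\<close>

text \<open>The coefficient of \<open>f\<close> in the composition g(Y), summed over all listings as
  g(Y) is defined. For smooth \<open>g\<close> one listing represents all of them, by symmetry of
  the derivatives.\<close>

definition comp_coeff ::
    "('v::real_normed_vector \<Rightarrow> 'w::real_normed_vector) \<Rightarrow> ('d rtree \<Rightarrow> 'v) \<Rightarrow> 'v \<Rightarrow> 'd forest \<Rightarrow> 'w" where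
  "comp_coeff g Y y f = (1 / fact (size f)) *\<^sub>R (\<Sum>hs\<in>permutations_of_multiset f. Dn g (map Y hs) y)"

lemma comp_coeff_mset:
  fixes g :: "'v::real_normed_vector \<Rightarrow> 'w::real_inner"
  assumes "Ck (length hs) g"
  shows "comp_coeff g Y y (mset hs) = sym_factor (mset hs) *\<^sub>R Dn g (map Y hs) y"
proof -
  have "Dn g (map Y hs') y = Dn g (map Y hs) y" if "hs' \<in> permutations_of_multiset (mset hs)" for hs'
  proof -
    have "mset hs' = mset hs" using that by (rule permutations_of_multisetD)
    then have "mset (map Y hs) = mset (map Y hs')" by simp
    then have "Dn g (map Y hs) = Dn g (map Y hs')" using assms by (intro Dn_mset_cong) simp_all
    then show ?thesis by simp
  qed
  then have "(\<Sum>hs'\<in>permutations_of_multiset (mset hs). Dn g (map Y hs') y)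
      = real (card (permutations_of_multiset (mset hs))) *\<^sub>R Dn g (map Y hs) y"
    by (simp add: sum_constant_scaleR)
  then show ?thesis by (simp add: comp_coeff_def card_permutations_sym_factor)
qed

lemma multilinear_Dn:
  fixes g :: "'v::real_normed_vector \<Rightarrow> 'w::real_inner"
  assumes "Ck n g"
  shows "multilinear n (\<lambda>vs. Dn g vs x)"
  unfolding multilinear_def
proof (intro allI impI)
  fix us vs :: "'v list" assume n: "Suc (length us + length vs) = n"
  then have "Dn g (us @ v # vs) = Dn g (v # us @ vs)" for v
    using Dn_move_front[of us vs g v] assms by simp
  moreover have "linear (\<lambda>v. Dn g (v # us @ vs) x)"
    using n by (intro linear_Dn_Cons[OF assms]) simp
  ultimately show "linear (\<lambda>v. Dn g (us @ v # vs) x)" by (simp only:)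
qed

lemma lookup_proj_le:
  "Poly_Mapping.lookup (proj_le n p) f = (if int (fvertices f) \<le> n then Poly_Mapping.lookup p f else 0)"
proof -
  have "Poly_Mapping.lookup (proj_le n p) f
      = (\<Sum>g\<in>{g \<in> Poly_Mapping.keys p. int (fvertices g) \<le> n}. if g = f then Poly_Mapping.lookup p f else 0)"
    unfolding proj_le_def lookup_sum by (intro sum.cong) (auto simp: lookup_single when_def)
  also have "\<dots> = (if int (fvertices f) \<le> n then Poly_Mapping.lookup p f else 0)"
    by (subst sum.delta) (auto simp: in_keys_iff)
  finally show ?thesis .
qed

lemma lookup_compose_path:
  fixes Y :: "real \<Rightarrow> 'd::finite forest \<Rightarrow>\<^sub>0 real^'k::finite"
  assumes "fvertices f < N"
  shows "Poly_Mapping.lookup (compose_path N g Y s) f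
    = comp_coeff g (\<lambda>h. Poly_Mapping.lookup (Y s) {#h#}) (Poly_Mapping.lookup (Y s) {#}) f"
proof -
  let ?y = "Poly_Mapping.lookup (Y s) {#}" and ?Y = "\<lambda>h. Poly_Mapping.lookup (Y s) {#h#}"
  let ?T = "trees_le (int N - 1) :: 'd rtree set"
  let ?F = "\<lambda>p hs. (1 / fact p) *\<^sub>R Dn g (map ?Y hs) ?y"
  have inner: "Poly_Mapping.lookup (\<Sum>hs | set hs \<subseteq> ?T \<and> length hs = p. Poly_Mapping.single (mset hs) (?F p hs)) f
      = (if p = size f then comp_coeff g ?Y ?y f else 0)" for p
  proof -
    have fin: "finite {hs. set hs \<subseteq> ?T \<and> length hs = p}"
      by (intro finite_lists_length_eq finite_trees_le)
    have "Poly_Mapping.lookup (\<Sum>hs | set hs \<subseteq> ?T \<and> length hs = p. Poly_Mapping.single (mset hs) (?F p hs)) f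
        = (\<Sum>hs | (set hs \<subseteq> ?T \<and> length hs = p) \<and> mset hs = f. ?F p hs)"
      using fin by (simp add: lookup_sum lookup_single when_def sum.If_cases Int_def)
    also have "{hs. (set hs \<subseteq> ?T \<and> length hs = p) \<and> mset hs = f}
        = (if p = size f then permutations_of_multiset f else {})"
    proof -
      have "set hs \<subseteq> ?T" if "mset hs = f" for hs
        using that assms fvertices_mono[of _ f] by (force simp: trees_le_iff)
      then show ?thesis by (auto simp: permutations_of_multiset_def)
    qed
    finally show ?thesis by (simp add: comp_coeff_def scaleR_sum_right)
  qed
  have sz: "size f < N" using size_le_fvertices[of f] assms by simp
  show ?thesis
  proof (cases "f = {#}")
    case True
    then show ?thesis
      unfolding compose_path_def lookup_add lookup_proj_le lookup_sum[of _ "{1..N - 1}"] inner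
      by (simp add: comp_coeff_def)
  next
    case False
    then have "size f \<in> {1..N - 1}" using sz by (cases "size f") auto
    then show ?thesis using False assms
      unfolding compose_path_def lookup_add lookup_proj_le lookup_sum[of _ "{1..N - 1}"] inner
      by (simp add: lookup_single when_def)
  qed
qed

text \<open>Scale invariant: at \<open>x\<close> the field has size \<open>B * \<omega> x\<close>,
  and displacements are measured in units of \<open>\<omega> x\<close>. With \<omega> = 1 this means
  bounded derivatives; with the Japanese bracket it means that each derivative gains one power of
  decay.\<close>

definition deriv_bound ::
    "nat \<Rightarrow> real \<Rightarrow> 'v set \<Rightarrow> ('v \<Rightarrow> real) \<Rightarrow> ('v::real_normed_vector \<Rightarrow> 'w::real_normed_vector) \<Rightarrow> bool" where
  "deriv_bound N B S \<omega> g \<longleftrightarrow> (\<forall>vs. length vs \<le> N \<longrightarrow>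
     (\<forall>x\<in>S. norm (Dn g vs x) \<le> B * \<omega> x * prod_list (map (\<lambda>v. norm v / \<omega> x) vs)))"

lemma prod_list_mono_le:
  assumes "\<And>h. h \<in> set hs \<Longrightarrow> 0 \<le> F h \<and> F h \<le> (G h :: real)"
  shows "prod_list (map F hs) \<le> prod_list (map G hs)"
  using assms
proof (induction hs)
  case (Cons h hs)
  have "0 \<le> prod_list (map F hs)" using Cons.prems by (intro prod_list_nonneg) auto
  moreover have "0 \<le> F h" "F h \<le> G h" "prod_list (map F hs) \<le> prod_list (map G hs)"
    using Cons by auto
  ultimately show ?case by (simp add: mult_mono)
qed simp

lemma prod_list_vertices:
  "prod_list (map (\<lambda>h. c * \<kappa> ^ vertices h) hs) = (c :: real) ^ length hs * \<kappa> ^ fvertices (mset hs)"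
  by (induction hs) (simp_all add: power_add)

text \<open>By homogeneity every vertex of \<open>hs\<close> contributes a factor \<kappa> and all
  lengths are in units of \<omega>. The additional \<kappa> is that of the field \<open>g\<close>,
  that is, of the root which later joins the trees of \<open>hs\<close>.\<close>

lemma Dn_map_bound:
  fixes g :: "'v::real_normed_vector \<Rightarrow> 'w::real_inner"
  assumes g: "deriv_bound N (B * \<kappa>) S \<omega> g" and y: "y \<in> S" "0 < \<omega> y"
    and Y: "\<And>h. h \<in> set hs \<Longrightarrow> norm (Y h) \<le> D * \<kappa> ^ vertices h * \<omega> y"
    and len: "length hs \<le> N" and "1 \<le> D" "0 \<le> B" "0 < \<kappa>"
  shows "norm (Dn g (map Y hs) y) \<le> B * D ^ N * \<kappa> ^ Suc (fvertices (mset hs)) * \<omega> y"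
proof -
  have "norm (Dn g (map Y hs) y) \<le> B * \<kappa> * \<omega> y * prod_list (map (\<lambda>h. norm (Y h) / \<omega> y) hs)"
    using g(1) len y(1) unfolding deriv_bound_def by (auto simp: comp_def dest!: spec[of _ "map Y hs"])
  also have "\<dots> \<le> B * \<kappa> * \<omega> y * prod_list (map (\<lambda>h. D * \<kappa> ^ vertices h) hs)"
    using Y y assms by (intro mult_left_mono prod_list_mono_le) (auto simp: pos_divide_le_eq)
  also have "\<dots> = B * \<kappa> * \<omega> y * (D ^ length hs * \<kappa> ^ fvertices (mset hs))"
    unfolding prod_list_vertices ..
  also have "\<dots> \<le> B * \<kappa> * \<omega> y * (D ^ N * \<kappa> ^ fvertices (mset hs))"
    using assms by (intro mult_left_mono mult_right_mono power_increasing) auto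
  finally show ?thesis by (simp add: mult_ac)
qed

lemma comp_coeff_bound:
  fixes g :: "'v::real_normed_vector \<Rightarrow> 'w::real_inner"
  assumes g: "Ck N g" "deriv_bound N (B * \<kappa>) S \<omega> g" and y: "y \<in> S" "0 < \<omega> y"
    and Y: "\<And>h. h \<in># f \<Longrightarrow> norm (Y h) \<le> D * \<kappa> ^ vertices h * \<omega> y"
    and f: "fvertices f \<le> N" and "1 \<le> D" "0 \<le> B" "0 < \<kappa>"
  shows "norm (comp_coeff g Y y f) \<le> B * D ^ N * \<kappa> ^ Suc (fvertices f) * \<omega> y"
proof -
  obtain hs where hs: "f = mset hs" by (metis ex_mset)
  have len: "length hs \<le> N" using size_le_fvertices[of f] f hs by simp
  have "norm (comp_coeff g Y y f) = sym_factor f * norm (Dn g (map Y hs) y)"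
    using comp_coeff_mset[OF Ck_mono[OF g(1) len], of Y y] sym_factor_bounds[of f] hs by simp
  also have "\<dots> \<le> 1 * norm (Dn g (map Y hs) y)"
    by (intro mult_right_mono sym_factor_bounds) simp
  also have "1 * norm (Dn g (map Y hs) y) \<le> B * D ^ N * \<kappa> ^ Suc (fvertices (mset hs)) * \<omega> y"
    unfolding mult_1 using Y hs len assms by (intro Dn_map_bound[OF g(2)]) auto
  finally show ?thesis by (simp add: hs)
qed

lemma sum_forests_le_tuples:
  fixes F :: "'d::finite rtree list \<Rightarrow> 'v::real_vector"
  shows "(\<Sum>b\<in>forests_le N (int N - 1). \<Sum>gs\<in>permutations_of_multiset b. F gs)
    = (\<Sum>n<N. \<Sum>gs | gs \<in> tuples (trees_le (int N - 1)) n \<and> fvertices (mset gs) < N. F gs)"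
proof -
  let ?T = "trees_le (int N - 1) :: 'd rtree set"
  let ?A = "{gs :: 'd rtree list. fvertices (mset gs) < N}"
  have "(\<Sum>b\<in>forests_le N (int N - 1). \<Sum>gs\<in>permutations_of_multiset b. F gs)
      = sum F (\<Union>b\<in>forests_le N (int N - 1). permutations_of_multiset b)"
    by (rule sum.UNION_disjoint[symmetric]) (simp_all add: finite_forests_le, auto simp: permutations_of_multiset_def)
  also have "(\<Union>b\<in>forests_le N (int N - 1). permutations_of_multiset b) = ?A"
    by (auto simp: permutations_of_multiset_def forests_le_1_iff)
  also have "?A = (\<Union>n\<in>{..<N}. {gs \<in> tuples ?T n. fvertices (mset gs) < N})"
  proof -
    have "length gs < N \<and> set gs \<subseteq> ?T" if "fvertices (mset gs) < N" for gs :: "'d rtree list"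
      using that size_le_fvertices[of "mset gs"] fvertices_mono[of _ "mset gs"]
      by (fastforce simp: trees_le_iff)
    then show ?thesis by (auto simp: tuples_def)
  qed
  also have "sum F \<dots> = (\<Sum>n<N. \<Sum>gs | gs \<in> tuples ?T n \<and> fvertices (mset gs) < N. F gs)"
    by (rule sum.UNION_disjoint) (auto simp: finite_trees_le, auto simp: tuples_def)
  finally show ?thesis .
qed

text \<open>The forests with fewer than N vertices are completed to all lists of fewer than N trees
  with fewer than N vertices each; the excess is the subtracted tail. On the complete sum the
  selection of trunks applies: \<open>q\<close> trees are cut off entirely and give a Taylor term in
  the predicted increment \<open>V None\<close>, the others are pruned to the trees of
  \<open>hs\<close>. What results is the Taylor polynomial of the derivative of \<open>g\<close>
  along \<open>hs\<close>.\<close>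

lemma expand_composition:
  fixes g :: "real^'k::finite \<Rightarrow> 'w::real_inner" and hs :: "'d::finite rtree list" and \<xi> Y
  assumes g: "Ck N g" and hs: "fvertices (mset hs) < N"
  defines "V \<equiv> \<lambda>w. \<Sum>h\<in>trees_le (int N - 1). fcut_coeff \<xi> h w *\<^sub>R Y h"
  shows "(\<Sum>b\<in>forests_le N (int N - 1). Poly_Mapping.lookup (fcut \<xi> b) (mset hs) *\<^sub>R comp_coeff g Y y b)
    = sym_factor (mset hs) *\<^sub>R (\<Sum>q<N - length hs. (1 / fact q) *\<^sub>R
        Dn g (map (\<lambda>h. V (Some h)) hs @ replicate q (V None)) y)
      - (\<Sum>n<N. \<Sum>gs | gs \<in> tuples (trees_le (int N - 1)) n \<and> N \<le> fvertices (mset gs).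
          (Poly_Mapping.lookup (fcut \<xi> (mset gs)) (mset hs) / fact n) *\<^sub>R Dn g (map Y gs) y)"
proof -
  let ?T = "trees_le (int N - 1) :: 'd rtree set" and ?f = "mset hs"
  let ?F = "\<lambda>gs. (Poly_Mapping.lookup (fcut \<xi> (mset gs)) ?f / fact (length gs)) *\<^sub>R Dn g (map Y gs) y"
  have hsT: "set hs \<subseteq> ?T" using hs fvertices_mono[of _ ?f] by (force simp: trees_le_iff)
  have len: "length hs < N" using hs size_le_fvertices[of ?f] by simp
  have "(\<Sum>b\<in>forests_le N (int N - 1). Poly_Mapping.lookup (fcut \<xi> b) ?f *\<^sub>R comp_coeff g Y y b)
      = (\<Sum>b\<in>forests_le N (int N - 1). \<Sum>gs\<in>permutations_of_multiset b. ?F gs)"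
  proof (intro sum.cong refl)
    fix b :: "'d forest"
    have "(\<Sum>gs\<in>permutations_of_multiset b. ?F gs)
        = (\<Sum>gs\<in>permutations_of_multiset b. (Poly_Mapping.lookup (fcut \<xi> b) ?f / fact (size b)) *\<^sub>R Dn g (map Y gs) y)"
      by (intro sum.cong refl) (auto simp: permutations_of_multiset_def)
    then show "Poly_Mapping.lookup (fcut \<xi> b) ?f *\<^sub>R comp_coeff g Y y b = (\<Sum>gs\<in>permutations_of_multiset b. ?F gs)"
      by (simp add: comp_coeff_def scaleR_sum_right)
  qed
  also have "\<dots> = (\<Sum>n<N. \<Sum>gs | gs \<in> tuples ?T n \<and> fvertices (mset gs) < N. ?F gs)"
    by (rule sum_forests_le_tuples)
  also have "\<dots> = (\<Sum>n<N. (\<Sum>gs\<in>tuples ?T n. ?F gs) - (\<Sum>gs | gs \<in> tuples ?T n \<and> N \<le> fvertices (mset gs). ?F gs))"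
  proof (intro sum.cong refl)
    fix n
    have "tuples ?T n = {gs \<in> tuples ?T n. fvertices (mset gs) < N} \<union> {gs \<in> tuples ?T n. N \<le> fvertices (mset gs)}"
      by auto
    then have "(\<Sum>gs\<in>tuples ?T n. ?F gs) = (\<Sum>gs | gs \<in> tuples ?T n \<and> fvertices (mset gs) < N. ?F gs)
        + (\<Sum>gs | gs \<in> tuples ?T n \<and> N \<le> fvertices (mset gs). ?F gs)"
      by (subst (1) \<open>tuples ?T n = _\<close>, intro sum.union_disjoint) (auto simp: finite_trees_le)
    then show "(\<Sum>gs | gs \<in> tuples ?T n \<and> fvertices (mset gs) < N. ?F gs)
        = (\<Sum>gs\<in>tuples ?T n. ?F gs) - (\<Sum>gs | gs \<in> tuples ?T n \<and> N \<le> fvertices (mset gs). ?F gs)" by simp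
  qed
  also have "\<dots> = (\<Sum>n<N. \<Sum>gs\<in>tuples ?T n. ?F gs)
      - (\<Sum>n<N. \<Sum>gs | gs \<in> tuples ?T n \<and> N \<le> fvertices (mset gs). ?F gs)"
    by (rule sum_subtractf)
  also have "(\<Sum>n<N. \<Sum>gs | gs \<in> tuples ?T n \<and> N \<le> fvertices (mset gs). ?F gs)
      = (\<Sum>n<N. \<Sum>gs | gs \<in> tuples ?T n \<and> N \<le> fvertices (mset gs).
          (Poly_Mapping.lookup (fcut \<xi> (mset gs)) ?f / fact n) *\<^sub>R Dn g (map Y gs) y)"
    by (intro sum.cong refl) (auto simp: tuples_def)
  also have "(\<Sum>n<N. \<Sum>gs\<in>tuples ?T n. ?F gs) = (\<Sum>n<N. if length hs \<le> n then
      (sym_factor ?f / fact (n - length hs)) *\<^sub>R Dn g (map (\<lambda>h. V (Some h)) hs @ replicate (n - length hs) (V None)) y else 0)"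
  proof (intro sum.cong refl)
    fix n assume n: "n \<in> {..<N}"
    have gn: "Ck n g" using n Ck_mono[OF g] by simp
    have "(\<Sum>gs\<in>tuples ?T n. ?F gs)
        = (1 / fact n) *\<^sub>R (\<Sum>gs\<in>tuples ?T n. Poly_Mapping.lookup (fcut \<xi> (mset gs)) ?f *\<^sub>R Dn g (map Y gs) y)"
      unfolding scaleR_sum_right by (intro sum.cong refl) (auto simp: tuples_def)
    also have "\<dots> = (1 / fact n) *\<^sub>R (if length hs \<le> n then (fact n / fact (n - length hs) * sym_factor ?f)
        *\<^sub>R Dn g (map (\<lambda>h. V (Some h)) hs @ replicate (n - length hs) (V None)) y else 0)"
    proof (subst sum_tuples_fcut[OF multilinear_Dn[OF gn] _ hsT])
      show "Dn g us y = Dn g vs y" if "length us = n" "mset us = mset vs" for us vs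
        using Dn_mset_cong[of us g vs] gn that by simp
    qed (simp add: V_def)
    finally show "(\<Sum>gs\<in>tuples ?T n. ?F gs) = (if length hs \<le> n then
      (sym_factor ?f / fact (n - length hs)) *\<^sub>R Dn g (map (\<lambda>h. V (Some h)) hs @ replicate (n - length hs) (V None)) y else 0)"
      by simp
  qed
  also have "\<dots> = (\<Sum>n\<in>{length hs..<N}.
      (sym_factor ?f / fact (n - length hs)) *\<^sub>R Dn g (map (\<lambda>h. V (Some h)) hs @ replicate (n - length hs) (V None)) y)"
    by (rule sum.mono_neutral_cong_right) auto
  also have "\<dots> = (\<Sum>q<N - length hs.
      (sym_factor ?f / fact q) *\<^sub>R Dn g (map (\<lambda>h. V (Some h)) hs @ replicate q (V None)) y)"
    by (rule sum.reindex_bij_witness[of _ "\<lambda>q. q + length hs" "\<lambda>n. n - length hs"]) auto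
  also have "\<dots> = sym_factor ?f *\<^sub>R (\<Sum>q<N - length hs. (1 / fact q) *\<^sub>R
        Dn g (map (\<lambda>h. V (Some h)) hs @ replicate q (V None)) y)"
    by (simp add: scaleR_sum_right)
  finally show ?thesis .
qed

text \<open>If \<open>a\<close> dominates, so does its power; if \<open>b\<close> does, then
  \<open>c \<le> 1\<close> permits dropping all but one factor \<open>c\<close>. Keeping
  \<open>b\<close> to the first power only is what allows the remainder constant to be absorbed in
  the end.\<close>

lemma linear_taylor_power:
  fixes a b c :: real
  assumes "0 \<le> c" "c \<le> 1" "c \<le> 2 * a + 2 * b" "0 \<le> a" "0 \<le> b" "0 < j"
  shows "c ^ j \<le> (4 * a) ^ j + 4 * b"
proof (cases "b \<le> a")
  case True
  then have "c ^ j \<le> (4 * a) ^ j" using assms by (intro power_mono) auto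
  then show ?thesis using assms by linarith
next
  case False
  have "c ^ j \<le> c ^ 1" using assms by (intro power_decreasing) auto
  moreover have "0 \<le> (4 * a) ^ j" using assms by simp
  ultimately show ?thesis using False assms(3) unfolding power_one_right by linarith
qed

section \<open>Estimates for the coefficients at two times\<close>

text \<open>
  A tree-indexed jet at two times: \<open>ys\<close>, \<open>Ys\<close> and \<open>yu\<close>, \<open>Yu\<close> are the values of the controlled path, \<open>\<xi>\<close> is
  the increment of the rough path, \<open>r\<close> stands for \<open>((u - s) / \<tau>) powr \<alpha>\<close>, and \<open>\<omega>\<close> is the local length
  scale of the vector fields. The reals \<open>K\<close> and \<open>G\<close> bound combinatorial quantities.
\<close>

locale two_point =
  fixes N :: nat and E B D G K \<kappa> r L Q :: real and S :: "(real^'k::finite) set"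
    and \<omega> :: "real^'k \<Rightarrow> real" and \<xi> :: "'d::finite rtree \<Rightarrow> real"
    and Ys Yu :: "'d rtree \<Rightarrow> real^'k" and ys yu :: "real^'k"
  assumes params: "1 \<le> E" "0 \<le> B" "1 \<le> D" "1 \<le> G" "1 \<le> K" "0 < \<kappa>" "0 < r" "r \<le> 1" "0 \<le> Q"
    and G: "\<And>f :: 'd forest. f \<in> forests N \<Longrightarrow> size f \<le> N \<Longrightarrow> coproduct_mass f * E ^ fvertices f \<le> G"
    and K: "real (card (trees_le (int N - 1) :: 'd rtree set)) \<le> K"
      "real (card (forests_le N (int N - 1) :: 'd forest set)) \<le> K"
      "(\<Sum>n<N. real (card (tuples (trees_le (int N - 1) :: 'd rtree set) n))) \<le> K"
    and \<xi>: "\<And>h. h \<in> trees_le (int N) \<Longrightarrow> \<bar>\<xi> h\<bar> \<le> E * (r / \<kappa>) ^ vertices h"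
    and S: "convex S" "ys \<in> S" "yu \<in> S"
    and \<omega>: "\<And>x. x \<in> S \<Longrightarrow> 0 < \<omega> x" "\<And>x. x \<in> S \<Longrightarrow> \<omega> x \<le> L"
      "\<And>x y. x \<in> S \<Longrightarrow> y \<in> S \<Longrightarrow> \<omega> x \<le> \<omega> y + norm (x - y)"
    and Ys: "\<And>h. vertices h < N \<Longrightarrow> norm (Ys h) \<le> D * \<kappa> ^ vertices h * \<omega> ys"
    and Yu: "\<And>h. vertices h < N \<Longrightarrow> norm (Yu h) \<le> D * \<kappa> ^ vertices h * \<omega> yu"
    and inc: "norm (yu - ys - (\<Sum>h\<in>trees_le (int N - 1). \<xi> h *\<^sub>R Ys h)) \<le> Q * r ^ N"
begin

text \<open>The values at the second time as predicted from the first: \<open>V None\<close> for the increment \<open>yu - ys\<close>,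
  \<open>V (Some h)\<close> for \<open>Yu h\<close>.\<close>

definition V :: "'d rtree option \<Rightarrow> real^'k" where
  "V w = (\<Sum>g\<in>trees_le (int N - 1). fcut_coeff \<xi> g w *\<^sub>R Ys g)"

abbreviation "\<omega>s \<equiv> \<omega> ys"
abbreviation "\<delta> \<equiv> yu - ys"
abbreviation "CV \<equiv> K * G * E * D"

lemma \<omega>s_pos: "0 < \<omega>s" and \<omega>s_le: "\<omega>s \<le> L" and \<omega>u_pos: "0 < \<omega> yu"
  using \<omega> S by auto

lemma CV_ge: "K * G * D \<le> CV" "K * E * D \<le> CV" "1 \<le> CV" "D \<le> CV"
proof -
  have ge1: "1 \<le> x * y" if "1 \<le> x" "1 \<le> y" for x y :: real
    using mult_mono[OF that] that by simp
  have "K * G * D * 1 \<le> K * G * D * E" "K * E * D * 1 \<le> K * E * D * G" "D * 1 \<le> D * (K * G * E)"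
    using params ge1 by (intro mult_left_mono; simp)+
  then show "K * G * D \<le> CV" "K * E * D \<le> CV" "D \<le> CV" by (simp_all add: mult_ac)
  then show "1 \<le> CV" using params by linarith
qed

lemma scale_power: "b \<le> a \<Longrightarrow> (r / \<kappa>) ^ (a - b) * \<kappa> ^ a = r ^ (a - b) * \<kappa> ^ b"
  using params by (simp add: power_divide power_diff field_simps)

lemma lookup_fcut_le:
  assumes "f \<in> forests N" "size f \<le> N"
  shows "\<bar>Poly_Mapping.lookup (fcut \<xi> f) b\<bar> \<le> G * (r / \<kappa>) ^ (fvertices f - fvertices b)"
proof -
  have "\<bar>Poly_Mapping.lookup (fcut \<xi> f) b\<bar>
      \<le> coproduct_mass f * E ^ fvertices f * (r / \<kappa>) ^ (fvertices f - fvertices b)"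
    using \<xi> params assms by (intro lookup_fcut_bound) auto
  also have "\<dots> \<le> G * (r / \<kappa>) ^ (fvertices f - fvertices b)"
    using params G[OF assms] by (intro mult_right_mono) auto
  finally show ?thesis .
qed

text \<open>Each pruned vertex exchanges a factor \<kappa> in the size of \<open>v\<close> for a
  factor \<open>r\<close>. The summand \<open>i\<close> leaves room for the root that is added on
  top of \<open>f\<close>.\<close>

lemma fcut_scaled_le:
  assumes f: "f \<in> forests N" "size f \<le> N" and v: "norm v \<le> c * \<kappa> ^ (fvertices f + i) * x" and "0 \<le> c" "0 \<le> x"
  shows "norm (Poly_Mapping.lookup (fcut \<xi> f) b *\<^sub>R v)
    \<le> G * c * \<kappa> ^ (fvertices b + i) * r ^ (fvertices f - fvertices b) * x"
proof (cases "fvertices b \<le> fvertices f")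
  case True
  have "norm (Poly_Mapping.lookup (fcut \<xi> f) b *\<^sub>R v)
      \<le> (G * (r / \<kappa>) ^ (fvertices f - fvertices b)) * (c * \<kappa> ^ (fvertices f + i) * x)"
    unfolding norm_scaleR using v params by (intro mult_mono lookup_fcut_le f) auto
  also have "\<dots> = G * c * \<kappa> ^ i * x * ((r / \<kappa>) ^ (fvertices f - fvertices b) * \<kappa> ^ fvertices f)"
    by (simp add: power_add mult_ac)
  also have "\<dots> = G * c * \<kappa> ^ (fvertices b + i) * r ^ (fvertices f - fvertices b) * x"
    unfolding scale_power[OF True] by (simp add: power_add mult_ac)
  finally show ?thesis .
next
  case False
  then have "Poly_Mapping.lookup (fcut \<xi> f) b = 0" by (intro lookup_fcut_eq_0) simp
  then show ?thesis using params assms by simp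
qed

lemma V_None: "V None = (\<Sum>h\<in>trees_le (int N - 1). \<xi> h *\<^sub>R Ys h)"
  by (simp add: V_def fcut_coeff_def lookup_fcut_Node)

lemma sum_trees_le_bound:
  assumes "\<And>g. vertices g < N \<Longrightarrow> norm (F g) \<le> c" "0 \<le> c"
  shows "norm (\<Sum>g\<in>(trees_le (int N - 1) :: 'd rtree set). F g) \<le> K * c"
proof -
  have "norm (\<Sum>g\<in>(trees_le (int N - 1) :: 'd rtree set). F g)
      \<le> real (card (trees_le (int N - 1) :: 'd rtree set)) * c"
    using assms by (intro sum_norm_bound) (simp add: trees_le_iff)
  also have "\<dots> \<le> K * c" using K assms by (intro mult_right_mono) auto
  finally show ?thesis .
qed

lemma norm_V_None: "norm (V None) \<le> CV * r * \<omega>s"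
proof -
  have "norm (\<xi> g *\<^sub>R Ys g) \<le> E * D * r * \<omega>s" if g: "vertices g < N" for g
  proof -
    have "norm (\<xi> g *\<^sub>R Ys g) \<le> (E * (r / \<kappa>) ^ vertices g) * (D * \<kappa> ^ vertices g * \<omega>s)"
      unfolding norm_scaleR real_norm_def using g params
      by (intro mult_mono \<xi> Ys) (auto simp: trees_le_iff)
    also have "\<dots> = E * D * \<omega>s * r ^ vertices g"
      using scale_power[of 0 "vertices g"] by (simp add: mult_ac)
    also have "\<dots> \<le> E * D * \<omega>s * r ^ 1"
      using params \<omega>s_pos vertices_pos[of g] by (intro mult_left_mono power_decreasing) auto
    finally show ?thesis by (simp add: mult_ac)
  qed
  then have "norm (V None) \<le> K * (E * D * r * \<omega>s)"
    unfolding V_None using params \<omega>s_pos by (intro sum_trees_le_bound) auto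
  also have "\<dots> = (K * E * D) * (r * \<omega>s)" by simp
  also have "\<dots> \<le> CV * (r * \<omega>s)"
    using CV_ge params \<omega>s_pos by (intro mult_right_mono) auto
  finally show ?thesis by simp
qed

lemma norm_V_Some: "norm (V (Some h)) \<le> CV * \<kappa> ^ vertices h * \<omega>s"
proof -
  have "norm (fcut_coeff \<xi> g (Some h) *\<^sub>R Ys g) \<le> G * D * \<kappa> ^ vertices h * \<omega>s" if g: "vertices g < N" for g
  proof -
    have "{#g#} \<in> forests N" using g by (simp add: forests_def trees_le_iff)
    then have "norm (fcut_coeff \<xi> g (Some h) *\<^sub>R Ys g)
      \<le> G * D * \<kappa> ^ vertices h * r ^ (vertices g - vertices h) * \<omega>s"
      using fcut_scaled_le[of "{#g#}" "Ys g" D 0 \<omega>s "{#h#}"] Ys[OF g] g params \<omega>s_pos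
      by (simp add: fcut_coeff_def)
    also have "\<dots> \<le> G * D * \<kappa> ^ vertices h * 1 * \<omega>s"
      using params \<omega>s_pos by (intro mult_right_mono mult_left_mono power_le_one) auto
    finally show ?thesis by simp
  qed
  then have "norm (V (Some h)) \<le> K * (G * D * \<kappa> ^ vertices h * \<omega>s)"
    unfolding V_def using params \<omega>s_pos by (intro sum_trees_le_bound) auto
  also have "\<dots> = (K * G * D) * (\<kappa> ^ vertices h * \<omega>s)" by simp
  also have "\<dots> \<le> CV * (\<kappa> ^ vertices h * \<omega>s)"
    using CV_ge params \<omega>s_pos by (intro mult_right_mono) auto
  finally show ?thesis by simp
qed

lemma norm_\<delta>_diff: "norm (\<delta> - V None) \<le> Q * r ^ N"
  using inc by (simp add: V_None)

lemma norm_\<delta>: "norm \<delta> \<le> CV * r * \<omega>s + Q * r ^ N"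
  using norm_\<delta>_diff norm_V_None norm_triangle_sub[of \<delta> "V None"] by linarith

text \<open>No power of \<open>r\<close> is gained here. The bound serves large increments, where
  the terms of the composition remainder are estimated separately.\<close>

lemma comp_sum_bound:
  fixes g :: "real^'k \<Rightarrow> real^'k"
  assumes g: "Ck N g" "deriv_bound N (B * \<kappa>) S \<omega> g"
  shows "norm (\<Sum>b\<in>forests_le N (int N - 1). Poly_Mapping.lookup (fcut \<xi> b) f *\<^sub>R comp_coeff g Ys ys b)
    \<le> K * G * B * D ^ N * \<kappa> ^ Suc (fvertices f) * \<omega>s"
proof -
  let ?c = "G * (B * D ^ N) * \<kappa> ^ Suc (fvertices f) * \<omega>s"
  have c0: "0 \<le> ?c" using params \<omega>s_pos by simp
  have "norm (Poly_Mapping.lookup (fcut \<xi> b) f *\<^sub>R comp_coeff g Ys ys b) \<le> ?c"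
    if b: "b \<in> forests_le N (int N - 1)" for b
  proof -
    have bN: "fvertices b < N" "b \<in> forests N" using b forests_le_1_iff by (auto simp: forests_le_def)
    have "norm (comp_coeff g Ys ys b) \<le> B * D ^ N * \<kappa> ^ (fvertices b + 1) * \<omega>s"
      using comp_coeff_bound[OF g S(2) \<omega>s_pos, of b Ys D] bN fvertices_mono[of _ b] Ys params by force
    then have "norm (Poly_Mapping.lookup (fcut \<xi> b) f *\<^sub>R comp_coeff g Ys ys b)
        \<le> G * (B * D ^ N) * \<kappa> ^ (fvertices f + 1) * r ^ (fvertices b - fvertices f) * \<omega>s"
      using bN size_le_fvertices[of b] params \<omega>s_pos by (intro fcut_scaled_le) auto
    also have "\<dots> \<le> G * (B * D ^ N) * \<kappa> ^ (fvertices f + 1) * 1 * \<omega>s"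
      using params \<omega>s_pos by (intro mult_right_mono mult_left_mono power_le_one) auto
    finally show ?thesis by simp
  qed
  then have "norm (\<Sum>b\<in>forests_le N (int N - 1). Poly_Mapping.lookup (fcut \<xi> b) f *\<^sub>R comp_coeff g Ys ys b)
      \<le> real (card (forests_le N (int N - 1) :: 'd forest set)) * ?c"
    by (rule sum_norm_bound)
  also have "\<dots> \<le> K * ?c" using K c0 by (intro mult_right_mono) auto
  finally show ?thesis by (simp add: mult_ac)
qed

text \<open>A list with at least N vertices loses at least \<open>N - fvertices f\<close> of them
  when it is pruned to \<open>f\<close>, and each lost vertex is worth a factor
  \<open>r\<close>.\<close>

lemma tail_bound:
  fixes g :: "real^'k \<Rightarrow> real^'k"
  assumes g: "Ck N g" "deriv_bound N (B * \<kappa>) S \<omega> g"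
  shows "norm (\<Sum>n<N. \<Sum>gs | gs \<in> tuples (trees_le (int N - 1)) n \<and> N \<le> fvertices (mset gs).
          (Poly_Mapping.lookup (fcut \<xi> (mset gs)) f / fact n) *\<^sub>R Dn g (map Ys gs) ys)
    \<le> K * G * B * D ^ N * \<kappa> ^ Suc (fvertices f) * r ^ (N - fvertices f) * L"
proof -
  let ?T = "trees_le (int N - 1) :: 'd rtree set"
  let ?c = "G * (B * D ^ N) * \<kappa> ^ Suc (fvertices f) * r ^ (N - fvertices f) * L"
  have L0: "0 \<le> L" using \<omega>s_pos \<omega>s_le by simp
  have c0: "0 \<le> ?c" using params L0 by simp
  have "norm (\<Sum>n<N. \<Sum>gs | gs \<in> tuples ?T n \<and> N \<le> fvertices (mset gs).
          (Poly_Mapping.lookup (fcut \<xi> (mset gs)) f / fact n) *\<^sub>R Dn g (map Ys gs) ys)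
    \<le> (\<Sum>n<N. \<Sum>gs | gs \<in> tuples ?T n \<and> N \<le> fvertices (mset gs). ?c)"
  proof (intro order_trans[OF norm_sum] sum_mono)
    fix n gs assume n: "n \<in> {..<N}" and "gs \<in> {gs \<in> tuples ?T n. N \<le> fvertices (mset gs)}"
    then have gs: "set gs \<subseteq> ?T" "length gs = n" "N \<le> fvertices (mset gs)" by (auto simp: tuples_def)
    have "mset gs \<in> forests N" using gs(1) by (auto simp: forests_def trees_le_def)
    moreover have "norm (Dn g (map Ys gs) ys) \<le> B * D ^ N * \<kappa> ^ (fvertices (mset gs) + 1) * \<omega>s"
      using Dn_map_bound[OF g(2) S(2) \<omega>s_pos, of gs Ys D] gs n Ys params trees_le_iff(2) by force
    ultimately have "norm (Poly_Mapping.lookup (fcut \<xi> (mset gs)) f *\<^sub>R Dn g (map Ys gs) ys)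
        \<le> G * (B * D ^ N) * \<kappa> ^ (fvertices f + 1) * r ^ (fvertices (mset gs) - fvertices f) * \<omega>s"
      using gs n params \<omega>s_pos by (intro fcut_scaled_le) auto
    also have "r ^ (fvertices (mset gs) - fvertices f) * \<omega>s \<le> r ^ (N - fvertices f) * L"
      using params \<omega>s_pos \<omega>s_le gs L0 by (intro mult_mono power_decreasing) auto
    then have "G * (B * D ^ N) * \<kappa> ^ (fvertices f + 1) * r ^ (fvertices (mset gs) - fvertices f) * \<omega>s
        \<le> G * (B * D ^ N) * \<kappa> ^ (fvertices f + 1) * r ^ (N - fvertices f) * L"
      using params unfolding mult.assoc by (intro mult_left_mono) auto
    finally have *: "norm (Poly_Mapping.lookup (fcut \<xi> (mset gs)) f *\<^sub>R Dn g (map Ys gs) ys) \<le> ?c" by simp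
    have "norm ((Poly_Mapping.lookup (fcut \<xi> (mset gs)) f / fact n) *\<^sub>R Dn g (map Ys gs) ys)
        = norm (Poly_Mapping.lookup (fcut \<xi> (mset gs)) f *\<^sub>R Dn g (map Ys gs) ys) / fact n" by simp
    also have "\<dots> \<le> norm (Poly_Mapping.lookup (fcut \<xi> (mset gs)) f *\<^sub>R Dn g (map Ys gs) ys) / 1"
      by (intro divide_left_mono) auto
    finally show "norm ((Poly_Mapping.lookup (fcut \<xi> (mset gs)) f / fact n) *\<^sub>R Dn g (map Ys gs) ys) \<le> ?c"
      using * by linarith
  qed
  also have "\<dots> \<le> (\<Sum>n<N. real (card (tuples ?T n)) * ?c)"
  proof (intro sum_mono)
    fix n
    have "real (card {gs \<in> tuples ?T n. N \<le> fvertices (mset gs)}) \<le> real (card (tuples ?T n))"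
      by (intro of_nat_mono card_mono) (auto simp: finite_trees_le)
    then show "(\<Sum>gs | gs \<in> tuples ?T n \<and> N \<le> fvertices (mset gs). ?c) \<le> real (card (tuples ?T n)) * ?c"
      using c0 by (simp only: sum_constant mult_right_mono)
  qed
  also have "\<dots> \<le> K * ?c"
    unfolding sum_distrib_right[symmetric] using K c0 by (intro mult_right_mono) auto
  finally show ?thesis by (simp add: mult_ac)
qed

text \<open>Taylor expansion at \<open>ys\<close> of the derivative along \<open>hs\<close>. The
  hypothesis on \<delta> keeps \<omega> within a factor of two on the segment from \<open>ys\<close>
  to \<open>yu\<close>, so all units may be taken at \<open>ys\<close>.\<close>

lemma taylor_bound:
  fixes g :: "real^'k \<Rightarrow> real^'k"
  assumes g: "Ck N g" "deriv_bound N (B * \<kappa>) S \<omega> g" and hs: "fvertices (mset hs) < N" and \<delta>: "2 * norm \<delta> \<le> \<omega>s"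
  shows "norm (Dn g (map Yu hs) yu
      - (\<Sum>q<N - length hs. (1 / fact q) *\<^sub>R Dn g (replicate q \<delta> @ map Yu hs) ys))
    \<le> 8 * B * (4 * D) ^ N * (4 * CV) ^ N * \<kappa> ^ Suc (fvertices (mset hs)) * r ^ (N - fvertices (mset hs)) * (Q + L)"
proof -
  let ?n = "N - length hs" and ?f = "fvertices (mset hs)" and ?c = "2 * norm \<delta> / \<omega>s"
  let ?K = "B * \<kappa> * (2 * \<omega>s) * (?c ^ ?n * ((4 * D) ^ length hs * \<kappa> ^ ?f))"
  have len: "length hs \<le> ?f" "length hs < N" using size_le_fvertices[of "mset hs"] hs by auto
  have L0: "0 \<le> L" using \<omega>s_pos \<omega>s_le by simp
  have "norm (Dn g (map Yu hs) (ys + \<delta>)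
      - (\<Sum>q<?n. (1 / fact q) *\<^sub>R Dn (Dn g (map Yu hs)) (replicate q \<delta>) ys)) \<le> ?K"
  proof (rule Taylor_Dn)
    show "Ck ?n (Dn g (map Yu hs))" using g(1) len by (intro Ck_Dn) simp
    show "0 < ?n" using len by simp
    fix \<theta> :: real assume \<theta>: "0 \<le> \<theta>" "\<theta> \<le> 1"
    let ?x = "ys + \<theta> *\<^sub>R \<delta>"
    have "?x = (1 - \<theta>) *\<^sub>R ys + \<theta> *\<^sub>R yu" by (simp add: algebra_simps)
    then have x: "?x \<in> S" using S \<theta> by (auto intro: convexD)
    have "norm (ys - ?x) \<le> norm \<delta>" "norm (?x - ys) \<le> norm \<delta>"
      using \<theta> by (auto simp: mult_left_le_one_le)
    then have \<omega>x: "\<omega>s \<le> 2 * \<omega> ?x" "\<omega> ?x \<le> 2 * \<omega>s" and \<omega>u: "\<omega> yu \<le> 2 * \<omega>s"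
      using \<omega>(3)[OF S(2) x] \<omega>(3)[OF x S(2)] \<omega>(3)[OF S(3) S(2)] \<delta> by linarith+
    have px: "0 < \<omega> ?x" using \<omega>(1) x by simp
    have div_le: "v / \<omega> ?x \<le> 2 * v / \<omega>s" if "0 \<le> v" for v
      using \<omega>x px \<omega>s_pos that mult_left_mono[OF \<omega>x(1) that] by (simp add: field_simps)
    have "norm (Dn g (replicate ?n \<delta> @ map Yu hs) ?x) \<le> B * \<kappa> * \<omega> ?x
        * prod_list (map (\<lambda>v. norm v / \<omega> ?x) (replicate ?n \<delta> @ map Yu hs))"
      using x len by (intro g(2)[unfolded deriv_bound_def, rule_format]) auto
    also have "prod_list (map (\<lambda>v. norm v / \<omega> ?x) (replicate ?n \<delta> @ map Yu hs))
        = (norm \<delta> / \<omega> ?x) ^ ?n * prod_list (map (\<lambda>h. norm (Yu h) / \<omega> ?x) hs)"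
      by (simp add: comp_def)
    also have "B * \<kappa> * \<omega> ?x * \<dots> \<le> B * \<kappa> * (2 * \<omega>s) * (?c ^ ?n * prod_list (map (\<lambda>h. 4 * D * \<kappa> ^ vertices h) hs))"
    proof (intro mult_mono power_mono prod_list_mono_le)
      fix h assume h: "h \<in> set hs"
      then have "vertices h < N" using fvertices_mono[of h "mset hs"] hs by simp
      then have "norm (Yu h) \<le> D * \<kappa> ^ vertices h * \<omega> yu" by (rule Yu)
      also have "\<dots> \<le> D * \<kappa> ^ vertices h * (2 * \<omega>s)" using \<omega>u params by (intro mult_left_mono) auto
      finally have "2 * norm (Yu h) / \<omega>s \<le> 4 * D * \<kappa> ^ vertices h"
        using \<omega>s_pos by (simp add: field_simps)
      then show "0 \<le> norm (Yu h) / \<omega> ?x \<and> norm (Yu h) / \<omega> ?x \<le> 4 * D * \<kappa> ^ vertices h"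
        using div_le[of "norm (Yu h)"] px by (auto intro: order_trans)
    qed (use \<omega>x px params div_le \<omega>s_pos in \<open>auto intro!: prod_list_nonneg mult_nonneg_nonneg\<close>)
    finally show "norm (Dn (Dn g (map Yu hs)) (replicate ?n \<delta>) ?x) \<le> ?K"
      by (simp only: Dn_append prod_list_vertices)
  qed
  moreover have "?K \<le> B * \<kappa> * 2 * ((4 * D) ^ N * \<kappa> ^ ?f) * (4 * (4 * CV) ^ N * (r ^ (N - ?f) * (Q + L)))"
  proof -
    have c: "0 \<le> ?c" "?c \<le> 1" using \<delta> \<omega>s_pos by auto
    have "?c \<le> 2 * (CV * r) + 2 * (Q * r ^ N / \<omega>s)"
      using norm_\<delta> \<omega>s_pos by (simp add: field_simps)
    then have "?c ^ (N - ?f) \<le> (4 * (CV * r)) ^ (N - ?f) + 4 * (Q * r ^ N / \<omega>s)"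
      using c params \<omega>s_pos hs CV_ge by (intro linear_taylor_power) auto
    \<comment> \<open>A forest has at least as many vertices as trees, so the Taylor order is at
      least the wanted order in \<open>r\<close>; since \<open>?c \<le> 1\<close>, the surplus is
      discarded.\<close>
    moreover have "?c ^ ?n \<le> ?c ^ (N - ?f)" using c len by (intro power_decreasing) auto
    ultimately have "\<omega>s * ?c ^ ?n \<le> \<omega>s * ((4 * (CV * r)) ^ (N - ?f) + 4 * (Q * r ^ N / \<omega>s))"
      using \<omega>s_pos by (intro mult_left_mono) auto
    also have "\<dots> = (4 * CV) ^ (N - ?f) * (r ^ (N - ?f) * \<omega>s) + 4 * (Q * r ^ N)"
      using \<omega>s_pos by (simp add: field_simps power_mult_distrib)
    also have "\<dots> \<le> (4 * (4 * CV) ^ N) * (r ^ (N - ?f) * L) + (4 * (4 * CV) ^ N) * (Q * r ^ (N - ?f))"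
    proof (intro add_mono mult_mono)
      have 1: "1 \<le> 4 * CV" using CV_ge by linarith
      then have "(4 * CV) ^ (N - ?f) \<le> (4 * CV) ^ N" by (intro power_increasing) auto
      then show "(4 * CV) ^ (N - ?f) \<le> 4 * (4 * CV) ^ N" using one_le_power[OF 1, of N] by linarith
      show "4 \<le> 4 * (4 * CV) ^ N" using one_le_power[OF 1, of N] by linarith
    qed (use \<omega>s_le \<omega>s_pos params CV_ge L0 in \<open>auto intro!: power_decreasing\<close>)
    also have "\<dots> = 4 * (4 * CV) ^ N * (r ^ (N - ?f) * (Q + L))" by (simp add: algebra_simps)
    finally have 1: "\<omega>s * ?c ^ ?n \<le> 4 * (4 * CV) ^ N * (r ^ (N - ?f) * (Q + L))" .
    have "?K = B * \<kappa> * 2 * ((4 * D) ^ length hs * \<kappa> ^ ?f) * (\<omega>s * ?c ^ ?n)" by (simp add: mult_ac)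
    also have "\<dots> \<le> B * \<kappa> * 2 * ((4 * D) ^ N * \<kappa> ^ ?f) * (4 * (4 * CV) ^ N * (r ^ (N - ?f) * (Q + L)))"
    proof (rule mult_mono[OF _ 1])
      show "B * \<kappa> * 2 * ((4 * D) ^ length hs * \<kappa> ^ ?f) \<le> B * \<kappa> * 2 * ((4 * D) ^ N * \<kappa> ^ ?f)"
        using params len by (intro mult_left_mono mult_right_mono power_increasing) auto
    qed (use params \<omega>s_pos in auto)
    finally show ?thesis .
  qed
  ultimately show ?thesis by (simp add: Dn_append mult_ac)
qed

lemma deriv_bound_const:
  assumes "deriv_bound N (B * \<kappa>) S \<omega> g" "length ws \<le> N"
  shows "norm (Dn g ws ys) \<le> B * \<kappa> * \<omega>s / \<omega>s ^ length ws * prod_list (map norm ws)"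
proof -
  have "prod_list (map (\<lambda>v. norm v / \<omega>s) ws) = prod_list (map norm ws) / \<omega>s ^ length ws"
    by (induction ws) auto
  then show ?thesis using assms(1)[unfolded deriv_bound_def, rule_format, OF assms(2) S(2)] by simp
qed

text \<open>The true values \<delta> and \<open>Yu h\<close> are exchanged for the predicted ones
  slot by slot. No tree of \<open>hs\<close> is larger than the whole forest, so each exchange is of
  order at least \<open>N - fvertices (mset hs)\<close> in \<open>r\<close>, relative to the bound
  of its slot in units of \<omega>.\<close>

lemma difference_bound:
  fixes g :: "real^'k \<Rightarrow> real^'k"
  assumes g: "Ck N g" "deriv_bound N (B * \<kappa>) S \<omega> g" and hs: "fvertices (mset hs) < N" and \<delta>: "2 * norm \<delta> \<le> \<omega>s"
    and q: "length hs + q < N"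
    and R: "\<And>h. h \<in> set hs \<Longrightarrow> norm (Yu h - V (Some h)) \<le> D * \<kappa> ^ vertices h * r ^ (N - vertices h) * (Q + L)"
  shows "norm (Dn g (replicate q \<delta> @ map Yu hs) ys - Dn g (map (\<lambda>h. V (Some h)) hs @ replicate q (V None)) ys)
    \<le> real N * B * (2 * D + CV) ^ N * \<kappa> ^ Suc (fvertices (mset hs)) * r ^ (N - fvertices (mset hs)) * (Q + L)"
proof -
  let ?C = "2 * D + CV" and ?n = "length hs + q" and ?f = "fvertices (mset hs)"
  let ?\<eta> = "r ^ (N - ?f) * (Q + L)"
  let ?us = "map Yu hs @ replicate q \<delta>" and ?vs = "map (\<lambda>h. V (Some h)) hs @ replicate q (V None)"
  let ?bs = "map (\<lambda>h. (?C * \<omega>s) * \<kappa> ^ vertices h) hs @ replicate q (?C * \<omega>s)"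
  have L0: "0 \<le> L" using \<omega>s_pos \<omega>s_le by simp
  have \<eta>0: "0 \<le> ?\<eta>" using params L0 by simp
  have C1: "1 \<le> ?C" "D \<le> ?C" "CV \<le> ?C" "2 * D \<le> ?C"
    using CV_ge(3) params(3) by linarith+
  have \<omega>u: "\<omega> yu \<le> 2 * \<omega>s" using \<omega>(3)[OF S(3) S(2)] \<delta> norm_ge_zero[of \<delta>] by linarith
  have gn: "Ck ?n g" using Ck_mono[OF g(1)] q by simp
  have perm: "Dn g (replicate q \<delta> @ map Yu hs) = Dn g ?us"
    using gn by (intro Dn_mset_cong) (simp_all add: add.commute)
  have "norm (Dn g ?us ys - Dn g ?vs ys)
      \<le> real (length ?us) * (B * \<kappa> * \<omega>s / \<omega>s ^ ?n) * (?\<eta> / \<omega>s) * prod_list ?bs"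
  proof (rule multilinear_diff_bound)
    show "multilinear (length ?us) (\<lambda>vs. Dn g vs ys)" using multilinear_Dn[OF gn] by simp
    show "norm (Dn g ws ys) \<le> B * \<kappa> * \<omega>s / \<omega>s ^ ?n * prod_list (map norm ws)" if "length ws = length ?us" for ws
      using deriv_bound_const[OF g(2), of ws] that q by simp
    fix i assume i: "i < length ?us"
    show "norm (?us ! i) \<le> ?bs ! i \<and> norm (?vs ! i) \<le> ?bs ! i \<and> norm (?us ! i - ?vs ! i) \<le> ?bs ! i * (?\<eta> / \<omega>s)"
    proof (cases "i < length hs")
      case True
      let ?h = "hs ! i"
      have h: "?h \<in> set hs" using True by simp
      then have v: "vertices ?h \<le> ?f" "vertices ?h < N" using fvertices_mono[of ?h "mset hs"] hs by auto
      have "norm (Yu ?h) \<le> D * \<kappa> ^ vertices ?h * \<omega> yu" using v by (intro Yu)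
      also have "\<dots> \<le> D * \<kappa> ^ vertices ?h * (2 * \<omega>s)" using \<omega>u params by (intro mult_left_mono) auto
      also have "\<dots> = (2 * D) * (\<omega>s * \<kappa> ^ vertices ?h)" by simp
      also have "\<dots> \<le> ?C * (\<omega>s * \<kappa> ^ vertices ?h)"
        using C1(4) params \<omega>s_pos by (intro mult_right_mono) auto
      finally have 1: "norm (Yu ?h) \<le> ?C * \<omega>s * \<kappa> ^ vertices ?h" by (simp add: mult_ac)
      have "norm (V (Some ?h)) \<le> CV * (\<omega>s * \<kappa> ^ vertices ?h)"
        using norm_V_Some[of ?h] by (simp add: mult_ac)
      also have "\<dots> \<le> ?C * (\<omega>s * \<kappa> ^ vertices ?h)"
        using C1(3) params \<omega>s_pos by (intro mult_right_mono) auto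
      finally have 2: "norm (V (Some ?h)) \<le> ?C * \<omega>s * \<kappa> ^ vertices ?h" by (simp add: mult_ac)
      have "norm (Yu ?h - V (Some ?h)) \<le> (D * \<kappa> ^ vertices ?h) * (r ^ (N - vertices ?h) * (Q + L))"
        using R[OF h] by (simp add: mult_ac)
      also have "\<dots> \<le> (?C * \<kappa> ^ vertices ?h) * ?\<eta>"
      proof (rule mult_mono)
        show "D * \<kappa> ^ vertices ?h \<le> ?C * \<kappa> ^ vertices ?h"
          using C1 params by (intro mult_right_mono) auto
        show "r ^ (N - vertices ?h) * (Q + L) \<le> ?\<eta>"
          using params v L0 by (intro mult_right_mono power_decreasing) auto
      qed (use C1 params L0 in auto)
      also have "\<dots> = ?C * \<omega>s * \<kappa> ^ vertices ?h * (?\<eta> / \<omega>s)" using \<omega>s_pos by simp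
      finally have 3: "norm (Yu ?h - V (Some ?h)) \<le> ?C * \<omega>s * \<kappa> ^ vertices ?h * (?\<eta> / \<omega>s)" .
      show ?thesis using 1 2 3 True by (simp add: nth_append)
    next
      case False
      have 1: "norm \<delta> \<le> ?C * \<omega>s"
      proof -
        have "1 * \<omega>s \<le> ?C * \<omega>s" using C1 \<omega>s_pos by (intro mult_right_mono) auto
        then show ?thesis using \<delta> norm_ge_zero[of \<delta>] by linarith
      qed
      have "norm (V None) \<le> CV * r * \<omega>s" by (rule norm_V_None)
      also have "\<dots> \<le> ?C * 1 * \<omega>s" using C1 params \<omega>s_pos CV_ge by (intro mult_right_mono mult_mono) auto
      finally have 2: "norm (V None) \<le> ?C * \<omega>s" by simp
      have "norm (\<delta> - V None) \<le> Q * r ^ N" by (rule norm_\<delta>_diff)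
      also have "\<dots> \<le> (Q + L) * r ^ (N - ?f)" using params L0 by (intro mult_mono power_decreasing) auto
      also have "\<dots> = 1 * ?\<eta>" by simp
      also have "\<dots> \<le> ?C * ?\<eta>" using C1 \<eta>0 by (intro mult_right_mono) auto
      finally have 3: "norm (\<delta> - V None) \<le> ?C * \<omega>s * (?\<eta> / \<omega>s)" using \<omega>s_pos by simp
      show ?thesis using 1 2 3 False i by (simp add: nth_append)
    qed
  qed (use params \<omega>s_pos \<eta>0 in auto)
  also have "prod_list ?bs = (?C ^ ?n * \<kappa> ^ ?f) * \<omega>s ^ ?n"
    by (simp add: prod_list_vertices power_mult_distrib power_add)
  also have "real (length ?us) * (B * \<kappa> * \<omega>s / \<omega>s ^ ?n) * (?\<eta> / \<omega>s) * ((?C ^ ?n * \<kappa> ^ ?f) * \<omega>s ^ ?n)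
      = real ?n * (?C ^ ?n * (B * \<kappa> * \<kappa> ^ ?f * ?\<eta>))"
    using \<omega>s_pos by (simp add: field_simps)
  also have "\<dots> \<le> real N * (?C ^ N * (B * \<kappa> * \<kappa> ^ ?f * ?\<eta>))"
  proof (rule mult_mono)
    have X0: "0 \<le> B * \<kappa> * \<kappa> ^ ?f * ?\<eta>"
      by (rule mult_nonneg_nonneg[OF _ \<eta>0]) (use params in auto)
    have "?C ^ ?n \<le> ?C ^ N" by (rule power_increasing[OF _ C1(1)]) (use q in simp)
    then show "?C ^ ?n * (B * \<kappa> * \<kappa> ^ ?f * ?\<eta>) \<le> ?C ^ N * (B * \<kappa> * \<kappa> ^ ?f * ?\<eta>)"
      using X0 by (rule mult_right_mono)
    have "0 \<le> ?C ^ ?n" using C1(1) by (intro zero_le_power) linarith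
    then show "0 \<le> ?C ^ ?n * (B * \<kappa> * \<kappa> ^ ?f * ?\<eta>)" using X0 by (rule mult_nonneg_nonneg)
  qed (use q in auto)
  finally show ?thesis unfolding perm by (simp add: mult_ac)
qed

text \<open>Either the remainder \<open>Q * r ^ N\<close> dominates \<omega>s up to constants and
  hence \<delta>, or the expansion dominates. Then \<open>r\<close> is bounded below and a factor
  \<open>(4 * CV * r) ^ j\<close>, at least 1, can be inserted. In both cases \<delta> itself has
  the order of a remainder.\<close>

lemma large_increment_bound:
  assumes "\<omega>s < 2 * norm \<delta>" "j \<le> N"
  shows "norm \<delta> \<le> (4 * CV + 1 + 2 * CV * (4 * CV) ^ N) * (r ^ j * (Q + L))"
proof -
  have L0: "0 \<le> L" using \<omega>s_pos \<omega>s_le by simp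
  have CV1: "1 \<le> CV" by (rule CV_ge)
  let ?x = "r ^ j * (Q + L)"
  have x0: "0 \<le> ?x" using params L0 by simp
  have QN: "Q * r ^ N \<le> ?x"
    using mult_mono[of "r ^ N" "r ^ j" Q "Q + L"] params L0 assms by (simp add: power_decreasing mult.commute)
  consider "\<omega>s \<le> 4 * (Q * r ^ N)" | "4 * (Q * r ^ N) < \<omega>s" by linarith
  then show ?thesis
  proof cases
    case 1
    have "CV * r * \<omega>s \<le> CV * 1 * (4 * (Q * r ^ N))"
      using 1 params CV1 \<omega>s_pos by (intro mult_mono) auto
    then have "norm \<delta> \<le> (4 * CV + 1) * (Q * r ^ N)" using norm_\<delta> by (simp add: algebra_simps)
    also have "\<dots> \<le> (4 * CV + 1) * ?x" using QN CV1 by (intro mult_left_mono) auto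
    also have "\<dots> \<le> (4 * CV + 1 + 2 * CV * (4 * CV) ^ N) * ?x"
      using x0 CV1 by (intro mult_right_mono) auto
    finally show ?thesis .
  next
    case 2
    have "\<omega>s < 2 * (CV * r * \<omega>s) + 2 * (Q * r ^ N)" using assms norm_\<delta> by linarith
    then have "\<omega>s * 1 < \<omega>s * (4 * CV * r)" using 2 by (simp add: algebra_simps)
    then have r4: "1 \<le> 4 * CV * r" using \<omega>s_pos by simp
    have "CV * r * \<omega>s \<le> CV * 1 * \<omega>s" using params CV1 \<omega>s_pos by (intro mult_mono) auto
    moreover have "1 * \<omega>s \<le> CV * \<omega>s" using CV1 \<omega>s_pos by (intro mult_right_mono) auto
    ultimately have "norm \<delta> \<le> 2 * (CV * \<omega>s)" using norm_\<delta> 2 \<omega>s_pos by linarith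
    also have "\<dots> = 2 * CV * (1 * \<omega>s)" by simp
    also have "\<dots> \<le> 2 * CV * ((4 * CV * r) ^ j * (Q + L))"
      using one_le_power[OF r4, of j] \<omega>s_le \<omega>s_pos params CV1 by (intro mult_left_mono mult_mono) auto
    also have "\<dots> = 2 * CV * (4 * CV) ^ j * ?x" by (simp add: power_mult_distrib)
    also have "\<dots> \<le> 2 * CV * (4 * CV) ^ N * ?x"
      using CV1 assms x0 by (intro mult_right_mono mult_left_mono power_increasing) auto
    also have "\<dots> \<le> (4 * CV + 1 + 2 * CV * (4 * CV) ^ N) * ?x"
      using x0 CV1 by (intro mult_right_mono) auto
    finally show ?thesis .
  qed
qed

end

text \<open>The first summand serves large increments. The second one collects, for small
  increments, the errors of Taylor's formula, of the exchange of true for predicted values, and of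
  the tail with at least N vertices.\<close>

definition comp_const :: "nat \<Rightarrow> real \<Rightarrow> real \<Rightarrow> real \<Rightarrow> real \<Rightarrow> real \<Rightarrow> real" where
  "comp_const N E B D G K = (let CV = K * G * E * D in
     (3 + 2 * K * G) * B * D ^ N * (4 * CV + 1 + 2 * CV * (4 * CV) ^ N)
     + (8 * B * (4 * D) ^ N * (4 * CV) ^ N + real N * (real N * B * (2 * D + CV) ^ N) + K * G * B * D ^ N))"

context two_point
begin

text \<open>If \<delta> exceeds half the length scale, both terms are bounded separately and the
  size of \<delta> pays for them. Otherwise the difference splits into Taylor error, exchange error
  and tail.\<close>

lemma composition_bound:
  fixes g :: "real^'k \<Rightarrow> real^'k"
  assumes g: "Ck N g" "deriv_bound N (B * \<kappa>) S \<omega> g" and f: "fvertices f < N"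
    and R: "\<And>h. h \<in># f \<Longrightarrow> norm (Yu h - V (Some h)) \<le> D * \<kappa> ^ vertices h * r ^ (N - vertices h) * (Q + L)"
  shows "norm (comp_coeff g Yu yu f
      - (\<Sum>b\<in>forests_le N (int N - 1). Poly_Mapping.lookup (fcut \<xi> b) f *\<^sub>R comp_coeff g Ys ys b))
    \<le> comp_const N E B D G K * (\<kappa> ^ Suc (fvertices f) * r ^ (N - fvertices f) * (Q + L))"
proof -
  let ?j = "N - fvertices f"
  let ?x = "\<kappa> ^ Suc (fvertices f) * r ^ ?j * (Q + L)"
  let ?c1 = "(3 + 2 * K * G) * B * D ^ N * (4 * CV + 1 + 2 * CV * (4 * CV) ^ N)"
  let ?c2 = "8 * B * (4 * D) ^ N * (4 * CV) ^ N" and ?c3 = "real N * (real N * B * (2 * D + CV) ^ N)"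
  let ?c4 = "K * G * B * D ^ N"
  let ?sum = "\<Sum>b\<in>forests_le N (int N - 1). Poly_Mapping.lookup (fcut \<xi> b) f *\<^sub>R comp_coeff g Ys ys b"
  have L0: "0 \<le> L" using \<omega>s_pos \<omega>s_le by simp
  have x0: "0 \<le> ?x" using params L0 by simp
  have CV1: "1 \<le> CV" by (rule CV_ge)
  have c: "0 \<le> ?c1" "0 \<le> ?c2 + ?c3 + ?c4"
    using params CV1 by (auto intro!: add_nonneg_nonneg mult_nonneg_nonneg)
  have CC: "comp_const N E B D G K = ?c1 + (?c2 + ?c3 + ?c4)" by (simp add: comp_const_def Let_def)
  obtain hs where hs: "f = mset hs" by (metis ex_mset)
  have len: "length hs < N" using size_le_fvertices[of f] f hs by simp
  show ?thesis
  proof (cases "2 * norm \<delta> \<le> \<omega>s")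
    case False
    have d: "norm \<delta> \<le> (4 * CV + 1 + 2 * CV * (4 * CV) ^ N) * (r ^ ?j * (Q + L))"
      using False by (intro large_increment_bound) auto
    have \<omega>u: "\<omega> yu \<le> 3 * norm \<delta>" using \<omega>(3)[OF S(3) S(2)] False by linarith
    have "norm (comp_coeff g Yu yu f) \<le> B * D ^ N * \<kappa> ^ Suc (fvertices f) * \<omega> yu"
      using f fvertices_mono[of _ f] Yu params by (intro comp_coeff_bound[OF g S(3) \<omega>u_pos]) force+
    also have "\<dots> \<le> B * D ^ N * \<kappa> ^ Suc (fvertices f) * (3 * norm \<delta>)"
      using \<omega>u params by (intro mult_left_mono) auto
    finally have 1: "norm (comp_coeff g Yu yu f) \<le> B * D ^ N * \<kappa> ^ Suc (fvertices f) * (3 * norm \<delta>)" .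
    have "norm ?sum \<le> K * G * B * D ^ N * \<kappa> ^ Suc (fvertices f) * \<omega>s" by (rule comp_sum_bound[OF g])
    also have "\<dots> \<le> K * G * B * D ^ N * \<kappa> ^ Suc (fvertices f) * (2 * norm \<delta>)"
      using False params by (intro mult_left_mono) auto
    finally have "norm (comp_coeff g Yu yu f - ?sum)
        \<le> ((3 + 2 * K * G) * B * D ^ N * \<kappa> ^ Suc (fvertices f)) * norm \<delta>"
      using 1 norm_triangle_ineq4[of "comp_coeff g Yu yu f" ?sum] by (simp add: algebra_simps)
    also have "\<dots> \<le> ((3 + 2 * K * G) * B * D ^ N * \<kappa> ^ Suc (fvertices f))
        * ((4 * CV + 1 + 2 * CV * (4 * CV) ^ N) * (r ^ ?j * (Q + L)))"
      using d params by (intro mult_left_mono) auto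
    also have "\<dots> = ?c1 * ?x" by (simp add: mult_ac)
    also have "\<dots> \<le> comp_const N E B D G K * ?x"
      unfolding CC using x0 c by (intro mult_right_mono) auto
    finally show ?thesis .
  next
    case True
    let ?A = "Dn g (map Yu hs) yu"
    let ?B = "\<lambda>q. Dn g (replicate q \<delta> @ map Yu hs) ys"
    let ?C = "\<lambda>q. Dn g (map (\<lambda>h. V (Some h)) hs @ replicate q (V None)) ys"
    let ?S = "\<lambda>F. \<Sum>q<N - length hs. (1 / fact q) *\<^sub>R F q"
    let ?tail = "\<Sum>n<N. \<Sum>gs | gs \<in> tuples (trees_le (int N - 1)) n \<and> N \<le> fvertices (mset gs).
          (Poly_Mapping.lookup (fcut \<xi> (mset gs)) (mset hs) / fact n) *\<^sub>R Dn g (map Ys gs) ys"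
    have hsN: "fvertices (mset hs) < N" using f hs by simp
    have sum: "?sum = sym_factor f *\<^sub>R ?S ?C - ?tail"
      unfolding hs V_def using expand_composition[OF g(1) hsN, of \<xi> Ys ys] by (simp only:)
    have coeff: "comp_coeff g Yu yu f = sym_factor f *\<^sub>R ?A"
      using comp_coeff_mset[of hs g Yu yu] Ck_mono[OF g(1), of "length hs"] len hs by simp
    have "norm (?A - ?S ?B) \<le> ?c2 * ?x"
      using taylor_bound[OF g hsN True] by (simp add: hs mult_ac)
    moreover have "norm (?S ?B - ?S ?C) \<le> ?c3 * ?x"
    proof -
      have "norm (?S ?B - ?S ?C) \<le> (\<Sum>q<N - length hs. (real N * B * (2 * D + CV) ^ N) * ?x)"
        unfolding sum_subtractf[symmetric] scaleR_diff_right[symmetric]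
      proof (intro order_trans[OF norm_sum] sum_mono)
        fix q assume "q \<in> {..<N - length hs}"
        then have q: "length hs + q < N" by auto
        have "norm ((1 / fact q) *\<^sub>R (?B q - ?C q)) = norm (?B q - ?C q) / fact q" by simp
        also have "\<dots> \<le> norm (?B q - ?C q) / 1" by (intro divide_left_mono) auto
        also have "\<dots> \<le> (real N * B * (2 * D + CV) ^ N) * ?x"
          using difference_bound[OF g hsN True q] R hs by (simp add: mult_ac)
        finally show "norm ((1 / fact q) *\<^sub>R (?B q - ?C q)) \<le> (real N * B * (2 * D + CV) ^ N) * ?x" .
      qed
      also have "\<dots> = real (N - length hs) * ((real N * B * (2 * D + CV) ^ N) * ?x)" by simp
      also have "\<dots> \<le> real N * ((real N * B * (2 * D + CV) ^ N) * ?x)"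
      proof (rule mult_right_mono)
        show "0 \<le> (real N * B * (2 * D + CV) ^ N) * ?x"
          by (rule mult_nonneg_nonneg[OF _ x0]) (use params CV1 in auto)
      qed simp
      finally show ?thesis by (simp add: mult_ac)
    qed
    ultimately have "norm (?A - ?S ?C) \<le> (?c2 + ?c3) * ?x"
      using norm_triangle_ineq[of "?A - ?S ?B" "?S ?B - ?S ?C"] by (simp add: distrib_right)
    moreover have "norm (sym_factor f *\<^sub>R (?A - ?S ?C)) \<le> 1 * norm (?A - ?S ?C)"
      unfolding norm_scaleR using sym_factor_bounds[of f] by (intro mult_right_mono) auto
    moreover have "norm ?tail \<le> ?c4 * ?x"
    proof -
      have "norm ?tail \<le> K * G * B * D ^ N * \<kappa> ^ Suc (fvertices f) * r ^ ?j * L"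
        unfolding hs by (rule tail_bound[OF g])
      also have "\<dots> \<le> K * G * B * D ^ N * \<kappa> ^ Suc (fvertices f) * r ^ ?j * (Q + L)"
        using params by (intro mult_left_mono) auto
      finally show ?thesis by (simp add: mult_ac)
    qed
    moreover have "comp_coeff g Yu yu f - ?sum = sym_factor f *\<^sub>R (?A - ?S ?C) + ?tail"
      unfolding coeff sum by (simp add: scaleR_diff_right)
    ultimately have "norm (comp_coeff g Yu yu f - ?sum) \<le> (?c2 + ?c3 + ?c4) * ?x"
      using norm_triangle_ineq[of "sym_factor f *\<^sub>R (?A - ?S ?C)" ?tail] by (simp add: distrib_right)
    also have "\<dots> \<le> comp_const N E B D G K * ?x"
      unfolding CC using x0 c by (intro mult_right_mono) auto
    finally show ?thesis .
  qed
qed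

text \<open>The prediction for \<open>Node \<mu> f\<close> involves only trees with fewer than N
  vertices, hence forests \<open>b\<close> with \<open>Suc (fvertices b) < N\<close>, one level less
  than the composition does. The forests with exactly N - 1 vertices make up the difference;
  bounding them directly costs one power of \<open>r\<close>.\<close>

lemma tree_bound:
  fixes \<sigma> :: "'d \<Rightarrow> real^'k \<Rightarrow> real^'k"
  assumes g: "Ck N (\<sigma> \<mu>)" "deriv_bound N (B * \<kappa>) S \<omega> (\<sigma> \<mu>)" and f: "Suc (fvertices f) < N"
    and Ys_Node: "\<And>b. Suc (fvertices b) < N \<Longrightarrow> Ys (Node \<mu> b) = comp_coeff (\<sigma> \<mu>) Ys ys b"
    and Yu_Node: "Yu (Node \<mu> f) = comp_coeff (\<sigma> \<mu>) Yu yu f"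
    and R: "\<And>h. h \<in># f \<Longrightarrow> norm (Yu h - V (Some h)) \<le> D * \<kappa> ^ vertices h * r ^ (N - vertices h) * (Q + L)"
  shows "norm (Yu (Node \<mu> f) - V (Some (Node \<mu> f)))
    \<le> (comp_const N E B D G K + K * G * B * D ^ N) * \<kappa> ^ Suc (fvertices f) * r ^ (N - Suc (fvertices f)) * (Q + L)"
proof -
  let ?F = "\<lambda>b. Poly_Mapping.lookup (fcut \<xi> b) f *\<^sub>R comp_coeff (\<sigma> \<mu>) Ys ys b"
  let ?A = "forests_le N (int N - 1) :: 'd forest set"
  let ?x = "\<kappa> ^ Suc (fvertices f) * r ^ (N - Suc (fvertices f)) * (Q + L)"
  have L0: "0 \<le> L" using \<omega>s_pos \<omega>s_le by simp
  have x0: "0 \<le> ?x" using params L0 by simp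
  have C0: "0 \<le> comp_const N E B D G K"
    unfolding comp_const_def Let_def using params CV_ge by (auto intro!: add_nonneg_nonneg mult_nonneg_nonneg)
  have "V (Some (Node \<mu> f)) = (\<Sum>b | Suc (fvertices b) < N. ?F b)"
  proof -
    have "V (Some (Node \<mu> f)) = (\<Sum>h\<in>Node \<mu> ` {b. Suc (fvertices b) < N}. fcut_coeff \<xi> h (Some (Node \<mu> f)) *\<^sub>R Ys h)"
      unfolding V_def
    proof (rule sum.mono_neutral_right)
      show "finite (trees_le (int N - 1) :: 'd rtree set)" by (rule finite_trees_le)
      show "Node \<mu> ` {b. Suc (fvertices b) < N} \<subseteq> trees_le (int N - 1)"
        by (auto simp: trees_le_def)
      show "\<forall>h\<in>trees_le (int N - 1) - Node \<mu> ` {b. Suc (fvertices b) < N}.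
        fcut_coeff \<xi> h (Some (Node \<mu> f)) *\<^sub>R Ys h = 0"
      proof
        fix h assume h: "h \<in> trees_le (int N - 1) - Node \<mu> ` {b. Suc (fvertices b) < N}"
        obtain \<nu> b where hb: "h = Node \<nu> b" by (cases h)
        then have "\<nu> \<noteq> \<mu>" using h by (auto simp: trees_le_iff)
        then show "fcut_coeff \<xi> h (Some (Node \<mu> f)) *\<^sub>R Ys h = 0"
          by (simp add: hb fcut_coeff_def lookup_fcut_Node)
      qed
    qed
    also have "\<dots> = (\<Sum>b | Suc (fvertices b) < N. fcut_coeff \<xi> (Node \<mu> b) (Some (Node \<mu> f)) *\<^sub>R Ys (Node \<mu> b))"
      by (subst sum.reindex) (auto simp: inj_on_def)
    also have "\<dots> = (\<Sum>b | Suc (fvertices b) < N. ?F b)"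
      by (intro sum.cong refl) (simp add: fcut_coeff_def lookup_fcut_Node Ys_Node)
    finally show ?thesis .
  qed
  moreover have "(\<Sum>b\<in>?A. ?F b) = (\<Sum>b | Suc (fvertices b) < N. ?F b) + (\<Sum>b | Suc (fvertices b) = N. ?F b)"
  proof -
    have A: "?A = {b. Suc (fvertices b) < N} \<union> {b. Suc (fvertices b) = N}"
      by (rule set_eqI, unfold Un_iff mem_Collect_eq forests_le_1_iff) auto
    then have "finite ({b :: 'd forest. Suc (fvertices b) < N} \<union> {b. Suc (fvertices b) = N})"
      using finite_forests_le[of N "int N - 1"] by metis
    then show ?thesis unfolding A by (intro sum.union_disjoint) auto
  qed
  moreover have "norm (\<Sum>b | Suc (fvertices b) = N. ?F b) \<le> (K * G * B * D ^ N) * ?x"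
  proof -
    let ?c = "G * (B * D ^ N) * ?x"
    have c0: "0 \<le> ?c" using params x0 by simp
    have sub: "{b. Suc (fvertices b) = N} \<subseteq> ?A"
      by (rule subsetI, unfold forests_le_1_iff) auto
    have "norm (?F b) \<le> ?c" if b: "Suc (fvertices b) = N" for b
    proof -
      have bA: "b \<in> forests N" using sub b by (auto simp: forests_le_def)
      have "norm (comp_coeff (\<sigma> \<mu>) Ys ys b) \<le> B * D ^ N * \<kappa> ^ (fvertices b + 1) * \<omega>s"
        using comp_coeff_bound[OF g S(2) \<omega>s_pos, of b Ys D] b fvertices_mono[of _ b] Ys params by force
      then have "norm (?F b) \<le> G * (B * D ^ N) * \<kappa> ^ (fvertices f + 1) * r ^ (fvertices b - fvertices f) * \<omega>s"
        using bA b size_le_fvertices[of b] params \<omega>s_pos by (intro fcut_scaled_le) auto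
      also have "\<dots> \<le> G * (B * D ^ N) * \<kappa> ^ (fvertices f + 1) * r ^ (fvertices b - fvertices f) * (Q + L)"
        using params \<omega>s_le by (intro mult_left_mono) auto
      also have "fvertices b - fvertices f = N - Suc (fvertices f)" using b by simp
      finally show ?thesis by (simp add: mult_ac)
    qed
    then have "norm (\<Sum>b | Suc (fvertices b) = N. ?F b) \<le> real (card {b :: 'd forest. Suc (fvertices b) = N}) * ?c"
      by (intro sum_norm_bound) simp
    also have "\<dots> \<le> real (card ?A) * ?c"
      using c0 sub finite_forests_le by (intro mult_right_mono of_nat_mono card_mono) auto
    also have "\<dots> \<le> K * ?c" using K c0 by (intro mult_right_mono) auto
    finally show ?thesis by (simp add: mult_ac)
  qed
  moreover have "norm (Yu (Node \<mu> f) - (\<Sum>b\<in>?A. ?F b)) \<le> comp_const N E B D G K * ?x"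
  proof -
    have "norm (Yu (Node \<mu> f) - (\<Sum>b\<in>?A. ?F b)) \<le> comp_const N E B D G K * (\<kappa> ^ Suc (fvertices f) * r ^ (N - fvertices f) * (Q + L))"
      unfolding Yu_Node using f R by (intro composition_bound[OF g]) auto
    also have "\<dots> \<le> comp_const N E B D G K * ?x"
      using C0 params L0 by (intro mult_left_mono mult_right_mono power_decreasing) auto
    finally show ?thesis .
  qed
  ultimately have "norm (Yu (Node \<mu> f) - V (Some (Node \<mu> f))) \<le> comp_const N E B D G K * ?x + (K * G * B * D ^ N) * ?x"
    using norm_triangle_ineq[of "Yu (Node \<mu> f) - (\<Sum>b\<in>?A. ?F b)" "\<Sum>b | Suc (fvertices b) = N. ?F b"]
    by (simp add: algebra_simps)
  then show ?thesis by (simp add: algebra_simps)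
qed

end

section \<open>Sewing\<close>

fun psum :: "(real \<Rightarrow> real \<Rightarrow> 'v::comm_monoid_add) \<Rightarrow> real list \<Rightarrow> 'v" where
  "psum \<Xi> (x # y # zs) = \<Xi> x y + psum \<Xi> (y # zs)"
| "psum \<Xi> _ = 0"

lemma psum_eq_sum: "psum \<Xi> xs = (\<Sum>n<length xs - 1. \<Xi> (xs ! n) (xs ! Suc n))"
  by (induction \<Xi> xs rule: psum.induct) (simp_all add: sum.lessThan_Suc_shift del: sum.lessThan_Suc)

lemma psum_append: "psum \<Xi> (xs @ y # zs) = psum \<Xi> (xs @ [y]) + psum \<Xi> (y # zs)"
proof (induction xs)
  case (Cons x xs)
  then show ?case by (cases xs) (simp_all add: add.assoc)
qed simp

lemma partitionsD:
  assumes "xs \<in> partitions s t"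
  shows "xs \<noteq> []" "hd xs = s" "last xs = t" "sorted_wrt (<) xs" "s \<le> t"
    "x \<in> set xs \<Longrightarrow> s \<le> x \<and> x \<le> t"
proof -
  have ends: "hd xs \<le> x \<and> x \<le> last xs" if "sorted_wrt (<) xs" "x \<in> set xs" for x :: real and xs
    using that
  proof (induction xs)
    case (Cons y ys)
    show ?case
    proof (cases "ys = []")
      case False
      then have "y < last ys" using Cons.prems(1) by simp
      then show ?thesis using Cons.prems Cons.IH False \<open>y < last ys\<close> by (auto simp: less_imp_le)
    qed (use Cons.prems in simp)
  qed simp
  show "xs \<noteq> []" "hd xs = s" "last xs = t" "sorted_wrt (<) xs"
    using assms by (auto simp: partitions_def)
  then show "s \<le> t" "x \<in> set xs \<Longrightarrow> s \<le> x \<and> x \<le> t"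
    using ends[of xs] hd_in_set[of xs] by auto
qed

lemma partitions_split:
  assumes "xs @ y # zs \<in> partitions s t"
  shows "xs @ [y] \<in> partitions s y" "y # zs \<in> partitions y t"
  using assms by (auto simp: partitions_def sorted_wrt_append hd_append split: if_splits)

lemma partitions_join:
  assumes "xs \<in> partitions s u" "u # zs \<in> partitions u t"
  shows "xs @ zs \<in> partitions s t"
proof -
  have "x \<le> u" if "x \<in> set xs" for x using partitionsD(6)[OF assms(1) that] by simp
  then show ?thesis using assms
    by (force simp: partitions_def sorted_wrt_append hd_append split: if_splits)
qed

text \<open>The fixed point of C = 2^(1-\<theta>) C + 2, the sum of the geometric series produced by
  halving intervals.\<close>

definition sewing_const :: "real \<Rightarrow> real" where
  "sewing_const \<theta> = 2 / (1 - 2 powr (1 - \<theta>))"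

lemma sewing_const:
  assumes "1 < \<theta>"
  shows "0 < sewing_const \<theta>" "2 powr (1 - \<theta>) * sewing_const \<theta> + 2 = sewing_const \<theta>"
proof -
  have "2 powr (1 - \<theta>) < (2::real) powr 0" using assms by (intro powr_less_mono) auto
  moreover define p :: real where "p = 2 powr (1 - \<theta>)"
  ultimately have p: "p < 1" "1 - p \<noteq> 0" by auto
  show "0 < sewing_const \<theta>" unfolding sewing_const_def p_def[symmetric] using p by simp
  have "p * 2 + 2 * (1 - p) = 2" by simp
  then show "2 powr (1 - \<theta>) * sewing_const \<theta> + 2 = sewing_const \<theta>"
    unfolding sewing_const_def p_def[symmetric] using p(2)
    by (metis add_divide_distrib nonzero_mult_div_cancel_right times_divide_eq_right)
qed

definition almost_additive ::
    "real \<Rightarrow> real \<Rightarrow> real \<Rightarrow> real \<Rightarrow> (real \<Rightarrow> real \<Rightarrow> 'v::real_normed_vector) \<Rightarrow> bool" where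
  "almost_additive \<theta> K a b \<Xi> \<longleftrightarrow> (\<forall>s u t. a \<le> s \<and> s \<le> u \<and> u \<le> t \<and> t \<le> b \<longrightarrow>
     norm (\<Xi> s t - \<Xi> s u - \<Xi> u t) \<le> K * (t - s) powr \<theta>)"

text \<open>Split the partition at the interval containing the midpoint: both remaining parts have at most half
  the length, and \<open>2 * (1/2) powr \<theta> < 1\<close> absorbs the induction hypothesis.\<close>

lemma psum_bound:
  assumes \<theta>: "1 < \<theta>" and K: "0 \<le> K" and \<Xi>0: "\<And>s. \<Xi> s s = 0"
    and \<Xi>: "almost_additive \<theta> K a b \<Xi>"
  shows "xs \<in> partitions s t \<Longrightarrow> a \<le> s \<Longrightarrow> t \<le> b \<Longrightarrow>
    norm (psum \<Xi> xs - \<Xi> s t) \<le> sewing_const \<theta> * K * (t - s) powr \<theta>"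
proof (induction "length xs" arbitrary: xs s t rule: less_induct)
  case less
  let ?C = "sewing_const \<theta> * K"
  note xs = partitionsD[OF less.prems(1)]
  have C0: "0 \<le> ?C" using sewing_const[OF \<theta>] K by simp
  show ?case
  proof (cases "s = t")
    case True
    have "tl xs = []"
    proof (rule ccontr)
      assume "tl xs \<noteq> []"
      then obtain x y zs where "xs = x # y # zs" by (metis list.exhaust list.sel(2,3))
      then show False using xs(4) xs(6)[of x] xs(6)[of y] True by auto
    qed
    then have "xs = [s]" using xs(1,2) by (cases xs) auto
    then show ?thesis using True \<Xi>0 by simp
  next
    case False
    define m where "m = (s + t) / 2"
    have st: "s < m" "m < t" using False xs(5) by (auto simp: m_def)
    \<comment> \<open>The two parts end at the last point up to the midpoint and begin at the first
      point beyond it. The interval in between belongs to neither part and may be long.\<close>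
    define as bs where "as = takeWhile (\<lambda>x. x \<le> m) xs" and "bs = dropWhile (\<lambda>x. x \<le> m) xs"
    have ab: "xs = as @ bs" by (simp add: as_def bs_def)
    have "as \<noteq> []" using xs(1,2) st unfolding as_def by (cases xs) auto
    then obtain as' x where as: "as = as' @ [x]" by (metis rev_exhaust)
    have "bs \<noteq> []" using xs(1,3) st last_in_set[OF xs(1)] unfolding bs_def dropWhile_eq_Nil_conv by (metis not_le)
    then obtain y bs' where bs: "bs = y # bs'" by (cases bs) auto
    have "x \<in> set (takeWhile (\<lambda>x. x \<le> m) xs)" using as unfolding as_def[symmetric] by simp
    then have xm: "x \<le> m" using set_takeWhileD by fast
    have my: "m < y" using hd_dropWhile[of "\<lambda>x. x \<le> m" xs] bs unfolding bs_def[symmetric] by auto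
    have xs_eq: "xs = as' @ x # (y # bs')" using ab as bs by simp
    have p1: "as' @ [x] \<in> partitions s x" and "x # (y # bs') \<in> partitions x t"
      using partitions_split[of as' x "y # bs'" s t] less.prems(1) xs_eq by auto
    then have p2: "y # bs' \<in> partitions y t" using partitions_split[of "[x]" y bs' x t] by simp
    have sx: "s \<le> x" and yt: "y \<le> t" using partitionsD(5)[OF p1] partitionsD(5)[OF p2] by auto
    have e1: "norm (psum \<Xi> (as' @ [x]) - \<Xi> s x) \<le> ?C * ((t - s) / 2) powr \<theta>"
    proof -
      have "norm (psum \<Xi> (as' @ [x]) - \<Xi> s x) \<le> ?C * (x - s) powr \<theta>"
        using p1 less.prems xs_eq xm my yt by (intro less.hyps) auto
      also have "\<dots> \<le> ?C * ((t - s) / 2) powr \<theta>"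
        using C0 sx xm \<theta> by (intro mult_left_mono powr_mono2) (auto simp: m_def field_simps)
      finally show ?thesis .
    qed
    have e2: "norm (psum \<Xi> (y # bs') - \<Xi> y t) \<le> ?C * ((t - s) / 2) powr \<theta>"
    proof -
      have "norm (psum \<Xi> (y # bs') - \<Xi> y t) \<le> ?C * (t - y) powr \<theta>"
        using p2 less.prems xs_eq xm my sx by (intro less.hyps) auto
      also have "\<dots> \<le> ?C * ((t - s) / 2) powr \<theta>"
        using C0 yt my \<theta> by (intro mult_left_mono powr_mono2) (auto simp: m_def field_simps)
      finally show ?thesis .
    qed
    have e3: "norm (\<Xi> s t - \<Xi> s x - \<Xi> x t) \<le> K * (t - s) powr \<theta>"
      using \<Xi> less.prems sx xm my yt by (auto simp: almost_additive_def)
    have e4: "norm (\<Xi> x t - \<Xi> x y - \<Xi> y t) \<le> K * (t - s) powr \<theta>"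
    proof -
      have "norm (\<Xi> x t - \<Xi> x y - \<Xi> y t) \<le> K * (t - x) powr \<theta>"
        using \<Xi> less.prems sx xm my yt by (auto simp: almost_additive_def)
      also have "\<dots> \<le> K * (t - s) powr \<theta>"
        using K sx xm my yt \<theta> by (intro mult_left_mono powr_mono2) auto
      finally show ?thesis .
    qed
    have sum: "psum \<Xi> xs = psum \<Xi> (as' @ [x]) + (\<Xi> x y + psum \<Xi> (y # bs'))"
      unfolding xs_eq by (subst psum_append) simp
    \<comment> \<open>Splitting \<open>\<Xi> s t\<close> into three pieces takes two defects, the
      origin of the 2 in \<open>sewing_const\<close>.\<close>
    have eq: "psum \<Xi> xs - \<Xi> s t = (psum \<Xi> (as' @ [x]) - \<Xi> s x) + (psum \<Xi> (y # bs') - \<Xi> y t)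
        - (\<Xi> s t - \<Xi> s x - \<Xi> x t) - (\<Xi> x t - \<Xi> x y - \<Xi> y t)"
      unfolding sum by (simp add: algebra_simps)
    have "norm (psum \<Xi> xs - \<Xi> s t) \<le> norm (psum \<Xi> (as' @ [x]) - \<Xi> s x) + norm (psum \<Xi> (y # bs') - \<Xi> y t)
        + norm (\<Xi> s t - \<Xi> s x - \<Xi> x t) + norm (\<Xi> x t - \<Xi> x y - \<Xi> y t)"
      unfolding eq by (intro order_trans[OF norm_triangle_ineq4] add_mono norm_triangle_ineq order_refl)
    also have "\<dots> \<le> ?C * (2 * ((t - s) / 2) powr \<theta>) + 2 * K * (t - s) powr \<theta>"
      using e1 e2 e3 e4 by simp
    also have "2 * ((t - s) / 2) powr \<theta> = 2 powr (1 - \<theta>) * (t - s) powr \<theta>"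
      using xs(5) by (simp add: powr_divide powr_diff)
    also have "?C * (2 powr (1 - \<theta>) * (t - s) powr \<theta>) + 2 * K * (t - s) powr \<theta>
        = (2 powr (1 - \<theta>) * sewing_const \<theta> + 2) * K * (t - s) powr \<theta>"
      by (simp add: algebra_simps)
    also have "\<dots> = ?C * (t - s) powr \<theta>" unfolding sewing_const(2)[OF \<theta>] ..
    finally show ?thesis .
  qed
qed

text \<open>On each interval of the coarse partition the finer sum differs from the germ by a
  multiple of the length to the power \<theta>. One power of the length adds up to
  \<open>t - s\<close>; the remaining \<theta> - 1 are bounded through the mesh.\<close>

lemma psum_refine:
  assumes \<theta>: "1 < \<theta>" and K: "0 \<le> K" and \<Xi>0: "\<And>s. \<Xi> s s = 0"
    and \<Xi>: "almost_additive \<theta> K a b \<Xi>"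
  shows "xs \<in> partitions s t \<Longrightarrow> ys \<in> partitions s t \<Longrightarrow> set xs \<subseteq> set ys \<Longrightarrow> a \<le> s \<Longrightarrow> t \<le> b \<Longrightarrow>
    (\<forall>n<length xs - 1. xs ! Suc n - xs ! n < \<delta>) \<Longrightarrow>
    norm (psum \<Xi> ys - psum \<Xi> xs) \<le> sewing_const \<theta> * K * \<delta> powr (\<theta> - 1) * (t - s)"
proof (induction xs arbitrary: s ys)
  case (Cons x xs)
  let ?C = "sewing_const \<theta> * K"
  have C0: "0 \<le> ?C" using sewing_const[OF \<theta>] K by simp
  note px = partitionsD[OF Cons.prems(1)] and py = partitionsD[OF Cons.prems(2)]
  have x: "x = s" using px by simp
  show ?case
  proof (cases xs)
    case Nil
    then have "s = t" using px by simp
    then have "psum \<Xi> ys = \<Xi> s t"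
      using psum_bound[OF assms Cons.prems(2,4,5)] \<theta> by simp
    then show ?thesis using Nil \<open>s = t\<close> \<Xi>0 by simp
  next
    case (Cons y zs)
    have "y \<in> set ys" using Cons.prems(3) Cons by auto
    then obtain as bs where ys: "ys = as @ y # bs" by (meson split_list)
    have p1: "as @ [y] \<in> partitions s y" and p2: "y # bs \<in> partitions y t"
      using partitions_split[of as y bs s t] Cons.prems(2) ys by auto
    have p3: "y # zs \<in> partitions y t" using partitions_split(2)[of "[x]" y zs s t] Cons.prems(1) Cons by simp
    have sy: "s < y" using px(4) x Cons by simp
    have yt: "y \<le> t" using partitionsD(5)[OF p3] .
    have "set (y # zs) \<subseteq> set (y # bs)"
    proof
      fix z assume z: "z \<in> set (y # zs)"
      then have "z \<in> set ys" "y \<le> z" using Cons.prems(3) Cons partitionsD(6)[OF p3 z] by auto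
      moreover have "z < y" if "z \<in> set as" for z
        using py(4) that unfolding ys by (auto simp: sorted_wrt_append)
      ultimately show "z \<in> set (y # bs)" unfolding ys by force
    qed
    moreover have "\<forall>n<length (y # zs) - 1. (y # zs) ! Suc n - (y # zs) ! n < \<delta>"
      using Cons.prems(6) Cons by (auto dest: spec[of _ "Suc _"])
    ultimately have 1: "norm (psum \<Xi> (y # bs) - psum \<Xi> (y # zs)) \<le> ?C * \<delta> powr (\<theta> - 1) * (t - y)"
      using Cons.IH[of y "y # bs"] p2 p3 Cons Cons.prems(4,5) sy by simp
    have \<delta>: "y - s < \<delta>" using Cons.prems(6) Cons x by (auto dest: spec[of _ 0])
    have "norm (psum \<Xi> (as @ [y]) - \<Xi> s y) \<le> ?C * (y - s) powr \<theta>"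
      using p1 Cons.prems yt by (intro psum_bound[OF assms]) auto
    also have "(y - s) powr \<theta> = (y - s) powr (\<theta> - 1) * (y - s)"
      using sy by (simp add: powr_diff)
    also have "?C * \<dots> \<le> ?C * (\<delta> powr (\<theta> - 1) * (y - s))"
      using C0 sy \<delta> \<theta> by (intro mult_left_mono mult_right_mono powr_mono2) auto
    finally have 2: "norm (psum \<Xi> (as @ [y]) - \<Xi> s y) \<le> ?C * \<delta> powr (\<theta> - 1) * (y - s)"
      by (simp add: mult_ac)
    have "psum \<Xi> ys - psum \<Xi> (x # xs) = (psum \<Xi> (as @ [y]) - \<Xi> s y) + (psum \<Xi> (y # bs) - psum \<Xi> (y # zs))"
      unfolding ys psum_append[of \<Xi> as y bs] Cons x by simp
    then have "norm (psum \<Xi> ys - psum \<Xi> (x # xs)) \<le> ?C * \<delta> powr (\<theta> - 1) * (y - s) + ?C * \<delta> powr (\<theta> - 1) * (t - y)"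
      using 1 2 norm_triangle_mono by metis
    then show ?thesis by (simp add: algebra_simps)
  qed
qed (simp add: partitions_def)

section \<open>Convergence of Riemann sums along the mesh\<close>

definition fine_partitions :: "real \<Rightarrow> real \<Rightarrow> real \<Rightarrow> real list set" where
  "fine_partitions \<delta> s t = {xs \<in> partitions s t. \<forall>n < length xs - 1. xs ! Suc n - xs ! n < \<delta>}"

text \<open>Both sums are compared with the sum over the common refinement.\<close>

lemma psum_compare:
  assumes \<theta>: "1 < \<theta>" and K: "0 \<le> K" and \<Xi>0: "\<And>s. \<Xi> s s = 0"
    and \<Xi>: "almost_additive \<theta> K a b \<Xi>" and "a \<le> s" "t \<le> b"
    and xs: "xs \<in> fine_partitions \<delta> s t" and ys: "ys \<in> fine_partitions \<delta>' s t"
  shows "norm (psum \<Xi> xs - psum \<Xi> ys) \<le> sewing_const \<theta> * K * (t - s) * (\<delta> powr (\<theta> - 1) + \<delta>' powr (\<theta> - 1))"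
proof -
  let ?zs = "sorted_list_of_set (set xs \<union> set ys)"
  have px: "xs \<in> partitions s t" and py: "ys \<in> partitions s t" using xs ys by (auto simp: fine_partitions_def)
  have "s \<in> set xs" "t \<in> set xs" using partitionsD[OF px] hd_in_set last_in_set by metis+
  moreover have bd: "s \<le> z \<and> z \<le> t" if "z \<in> set ?zs" for z
    using that partitionsD(6)[OF px] partitionsD(6)[OF py] by auto
  ultimately have zne: "?zs \<noteq> []" and z: "s \<in> set ?zs" "t \<in> set ?zs" by auto
  have srt: "sorted_wrt (<) ?zs" using strict_sorted_list_of_set by blast
  have "?zs \<in> partitions (hd ?zs) (last ?zs)" using zne srt by (simp add: partitions_def)
  note zz = partitionsD(6)[OF this]
  have "hd ?zs = s" using zz[OF z(1)] bd[OF hd_in_set[OF zne]] by simp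
  moreover have "last ?zs = t" using zz[OF z(2)] bd[OF last_in_set[OF zne]] by simp
  ultimately have pz: "?zs \<in> partitions s t" using \<open>?zs \<in> partitions (hd ?zs) (last ?zs)\<close> by simp
  have "norm (psum \<Xi> ?zs - psum \<Xi> xs) \<le> sewing_const \<theta> * K * \<delta> powr (\<theta> - 1) * (t - s)"
    using xs assms by (intro psum_refine[OF \<theta> K \<Xi>0 \<Xi> px pz]) (auto simp: fine_partitions_def)
  moreover have "norm (psum \<Xi> ?zs - psum \<Xi> ys) \<le> sewing_const \<theta> * K * \<delta>' powr (\<theta> - 1) * (t - s)"
    using ys assms by (intro psum_refine[OF \<theta> K \<Xi>0 \<Xi> py pz]) (auto simp: fine_partitions_def)
  ultimately have "norm (psum \<Xi> xs - psum \<Xi> ys) \<le> sewing_const \<theta> * K * \<delta> powr (\<theta> - 1) * (t - s)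
      + sewing_const \<theta> * K * \<delta>' powr (\<theta> - 1) * (t - s)"
    using norm_triangle_ineq4[of "psum \<Xi> ?zs - psum \<Xi> ys" "psum \<Xi> ?zs - psum \<Xi> xs"] by simp
  then show ?thesis by (simp add: algebra_simps)
qed

lemma fine_partitions_nonempty:
  assumes "s \<le> t" "0 < \<delta>"
  shows "fine_partitions \<delta> s t \<noteq> {}"
proof (cases "s = t")
  case True
  then have "[s] \<in> fine_partitions \<delta> s t" by (simp add: fine_partitions_def partitions_def)
  then show ?thesis by blast
next
  case False
  then have st: "0 < t - s" using assms by simp
  obtain n :: nat where n: "(t - s) / \<delta> < real n" using reals_Archimedean2 by blast
  moreover have "0 < (t - s) / \<delta>" using st assms(2) by simp
  ultimately have n0: "0 < n" by linarith
  let ?f = "\<lambda>i. s + (t - s) * real i / real n"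
  let ?xs = "map ?f [0..<Suc n]"
  have "?f i < ?f j" if "i < j" for i j using that st n0 by (simp add: divide_strict_right_mono)
  then have "sorted_wrt (<) ?xs" by (auto simp: sorted_wrt_map sorted_wrt_iff_nth_less simp del: upt_Suc)
  moreover have "hd ?xs = s" by (simp add: hd_map upt_rec del: upt_Suc)
  moreover have "last ?xs = t" using n0 by simp
  moreover have "?xs ! Suc i - ?xs ! i < \<delta>" if "i < n" for i
  proof -
    have "?xs ! Suc i - ?xs ! i = ?f (Suc i) - ?f i"
      using that by (simp del: upt_Suc)
    also have "\<dots> = (t - s) / real n" using n0 by (simp add: field_simps)
    also have "\<dots> < \<delta>" using n n0 assms(2) by (simp add: field_simps)
    finally show ?thesis .
  qed
  ultimately have "?xs \<in> fine_partitions \<delta> s t"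
    by (simp add: fine_partitions_def partitions_def del: upt_Suc)
  then show ?thesis by blast
qed

lemma eventually_mesh_filter:
  "eventually P (mesh_filter s t) \<longleftrightarrow> (\<exists>\<delta>>0. \<forall>xs\<in>fine_partitions \<delta> s t. P xs)"
proof -
  have "eventually P (mesh_filter s t) \<longleftrightarrow> (\<exists>\<delta>\<in>{0<..}. eventually P (principal (fine_partitions \<delta> s t)))"
    unfolding mesh_filter_def fine_partitions_def[symmetric]
  proof (rule eventually_INF_base)
    fix \<delta> \<delta>' :: real assume "\<delta> \<in> {0<..}" "\<delta>' \<in> {0<..}"
    then show "\<exists>x\<in>{0<..}. principal (fine_partitions x s t)
        \<le> inf (principal (fine_partitions \<delta> s t)) (principal (fine_partitions \<delta>' s t))"
      by (intro bexI[of _ "min \<delta> \<delta>'"]) (auto simp: fine_partitions_def)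
  qed auto
  then show ?thesis by (simp add: eventually_principal) blast
qed

lemma mesh_filter_neq_bot: "s \<le> t \<Longrightarrow> mesh_filter s t \<noteq> bot"
  using fine_partitions_nonempty by (fastforce simp: trivial_limit_def eventually_mesh_filter)

text \<open>Completeness is used along one sequence of partitions with mesh below 1/(n+1). The
  comparison of arbitrary fine partitions then carries the limit over to the whole mesh filter, with
  a rate.\<close>

lemma sewing_limit_exists:
  fixes \<Xi> :: "real \<Rightarrow> real \<Rightarrow> 'v::banach"
  assumes \<theta>: "1 < \<theta>" and K: "0 \<le> K" and \<Xi>0: "\<And>s. \<Xi> s s = 0"
    and \<Xi>: "almost_additive \<theta> K a b \<Xi>" and "a \<le> s" "s \<le> t" "t \<le> b"
  shows "\<exists>I. (psum \<Xi> \<longlongrightarrow> I) (mesh_filter s t)"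
proof -
  define c where "c = sewing_const \<theta> * K * (t - s)"
  have c0: "0 \<le> c" using sewing_const[OF \<theta>] K assms by (simp add: c_def)
  have cmp: "norm (psum \<Xi> xs - psum \<Xi> ys) \<le> c * (\<delta> powr (\<theta> - 1) + \<delta>' powr (\<theta> - 1))"
    if "xs \<in> fine_partitions \<delta> s t" "ys \<in> fine_partitions \<delta>' s t" for xs ys \<delta> \<delta>'
    unfolding c_def using psum_compare[OF \<theta> K \<Xi>0 \<Xi>] assms that by blast
  define d where "d n = 1 / real (Suc n)" for n
  have d: "0 < d n" for n by (simp add: d_def)
  have "d \<longlonglongrightarrow> 0" unfolding d_def by (rule LIMSEQ_Suc[OF lim_1_over_n])
  then have dlim: "(\<lambda>n. d n powr (\<theta> - 1)) \<longlonglongrightarrow> 0"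
    using \<theta> d by (intro tendsto_zero_powrI[where b = "\<theta> - 1"]) (auto simp: less_imp_le)
  define x where "x n = (SOME xs. xs \<in> fine_partitions (d n) s t)" for n
  have x: "x n \<in> fine_partitions (d n) s t" for n
    unfolding x_def using fine_partitions_nonempty[OF assms(6) d] by (metis some_in_eq)
  have small: "\<exists>\<delta>>0. \<forall>\<delta>'. 0 < \<delta>' \<and> \<delta>' \<le> \<delta> \<longrightarrow> c * (\<delta>' powr (\<theta> - 1)) < e" if "0 < e" for e
  proof -
    have "(\<lambda>n. c * d n powr (\<theta> - 1)) \<longlonglongrightarrow> c * 0" by (intro tendsto_intros dlim)
    then have "eventually (\<lambda>n. c * d n powr (\<theta> - 1) < e) sequentially"
      using that by (intro order_tendstoD(2)[of _ "c * 0"]) auto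
    then obtain n where n: "c * d n powr (\<theta> - 1) < e" by (meson eventually_happens sequentially_bot)
    show ?thesis
    proof (intro exI[of _ "d n"] conjI allI impI)
      fix \<delta>' assume "0 < \<delta>' \<and> \<delta>' \<le> d n"
      then have "c * \<delta>' powr (\<theta> - 1) \<le> c * d n powr (\<theta> - 1)"
        using c0 \<theta> by (intro mult_left_mono powr_mono2) auto
      then show "c * \<delta>' powr (\<theta> - 1) < e" using n by simp
    qed (rule d)
  qed
  have "Cauchy (\<lambda>n. psum \<Xi> (x n))"
  proof (rule CauchyI)
    fix e :: real assume e: "0 < e"
    obtain \<delta> where \<delta>: "0 < \<delta>" "\<And>\<delta>'. 0 < \<delta>' \<Longrightarrow> \<delta>' \<le> \<delta> \<Longrightarrow> c * (\<delta>' powr (\<theta> - 1)) < e / 2"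
      using small[of "e / 2"] e by auto
    have "eventually (\<lambda>n. d n < \<delta>) sequentially" using \<open>d \<longlonglongrightarrow> 0\<close> \<delta>(1) by (rule order_tendstoD)
    then obtain M where M: "\<And>n. M \<le> n \<Longrightarrow> d n < \<delta>" unfolding eventually_sequentially by blast
    have "norm (psum \<Xi> (x m) - psum \<Xi> (x n)) < e" if "M \<le> m" "M \<le> n" for m n
      using cmp[OF x x, of m n] \<delta>(2)[OF d, of m] \<delta>(2)[OF d, of n] M that
      by (fastforce simp: distrib_left less_imp_le)
    then show "\<exists>M. \<forall>m\<ge>M. \<forall>n\<ge>M. norm (psum \<Xi> (x m) - psum \<Xi> (x n)) < e" by blast
  qed
  then obtain I where I: "(\<lambda>n. psum \<Xi> (x n)) \<longlonglongrightarrow> I" using Cauchy_convergent convergent_def by blast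
  have bound: "norm (psum \<Xi> xs - I) \<le> c * \<delta> powr (\<theta> - 1)" if xs: "xs \<in> fine_partitions \<delta> s t" for xs \<delta>
  proof (rule LIMSEQ_le)
    show "(\<lambda>n. norm (psum \<Xi> xs - psum \<Xi> (x n))) \<longlonglongrightarrow> norm (psum \<Xi> xs - I)"
      by (intro tendsto_intros I)
    have "(\<lambda>n. c * (\<delta> powr (\<theta> - 1) + d n powr (\<theta> - 1))) \<longlonglongrightarrow> c * (\<delta> powr (\<theta> - 1) + 0)"
      by (intro tendsto_intros dlim)
    then show "(\<lambda>n. c * (\<delta> powr (\<theta> - 1) + d n powr (\<theta> - 1))) \<longlonglongrightarrow> c * \<delta> powr (\<theta> - 1)" by simp
  qed (use cmp[OF xs x] in auto)
  have "(psum \<Xi> \<longlongrightarrow> I) (mesh_filter s t)"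
  proof (rule tendstoI)
    fix e :: real assume "0 < e"
    then obtain \<delta> where \<delta>: "0 < \<delta>" "c * (\<delta> powr (\<theta> - 1)) < e" using small by blast
    then show "eventually (\<lambda>xs. dist (psum \<Xi> xs) I < e) (mesh_filter s t)"
      unfolding eventually_mesh_filter dist_norm using bound by (intro exI[of _ \<delta>]) (auto intro: order_le_less_trans)
  qed
  then show ?thesis by blast
qed

lemma sewing_limit_bound:
  fixes \<Xi> :: "real \<Rightarrow> real \<Rightarrow> 'v::banach"
  assumes \<theta>: "1 < \<theta>" and K: "0 \<le> K" and \<Xi>0: "\<And>s. \<Xi> s s = 0"
    and \<Xi>: "almost_additive \<theta> K s t \<Xi>" and "s \<le> t" and I: "(psum \<Xi> \<longlongrightarrow> I) (mesh_filter s t)"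
  shows "norm (I - \<Xi> s t) \<le> sewing_const \<theta> * K * (t - s) powr \<theta>"
proof (rule tendsto_upperbound)
  show "((\<lambda>xs. norm (psum \<Xi> xs - \<Xi> s t)) \<longlongrightarrow> norm (I - \<Xi> s t)) (mesh_filter s t)"
    by (intro tendsto_intros I)
  show "\<forall>\<^sub>F xs in mesh_filter s t. norm (psum \<Xi> xs - \<Xi> s t) \<le> sewing_const \<theta> * K * (t - s) powr \<theta>"
    unfolding eventually_mesh_filter
    using psum_bound[OF \<theta> K \<Xi>0 \<Xi>] by (intro exI[of _ 1]) (auto simp: fine_partitions_def)
qed (use mesh_filter_neq_bot assms in auto)

text \<open>Fine partitions of the two parts concatenate to a fine partition of the whole, and for
  these the Riemann sums add exactly.\<close>

lemma sewing_limit_additive: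
  fixes \<Xi> :: "real \<Rightarrow> real \<Rightarrow> 'v::banach"
  assumes "s \<le> u" "u \<le> t"
    and I: "(psum \<Xi> \<longlongrightarrow> I1) (mesh_filter s u)" "(psum \<Xi> \<longlongrightarrow> I2) (mesh_filter u t)" "(psum \<Xi> \<longlongrightarrow> I) (mesh_filter s t)"
  shows "I = I1 + I2"
proof (rule ccontr)
  assume "I \<noteq> I1 + I2"
  define e where "e = norm (I - (I1 + I2)) / 3"
  have e: "0 < e" using \<open>I \<noteq> I1 + I2\<close> by (simp add: e_def)
  obtain d1 where d1: "0 < d1" "\<And>xs. xs \<in> fine_partitions d1 s u \<Longrightarrow> norm (psum \<Xi> xs - I1) < e"
    using tendstoD[OF I(1) e] unfolding eventually_mesh_filter dist_norm by blast
  obtain d2 where d2: "0 < d2" "\<And>xs. xs \<in> fine_partitions d2 u t \<Longrightarrow> norm (psum \<Xi> xs - I2) < e"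
    using tendstoD[OF I(2) e] unfolding eventually_mesh_filter dist_norm by blast
  obtain d3 where d3: "0 < d3" "\<And>xs. xs \<in> fine_partitions d3 s t \<Longrightarrow> norm (psum \<Xi> xs - I) < e"
    using tendstoD[OF I(3) e] unfolding eventually_mesh_filter dist_norm by blast
  define d where "d = min d1 (min d2 d3)"
  have d: "0 < d" "d \<le> d1" "d \<le> d2" "d \<le> d3" using d1 d2 d3 by (auto simp: d_def)
  obtain xs ys where xs: "xs \<in> fine_partitions d s u" and ys: "ys \<in> fine_partitions d u t"
    using fine_partitions_nonempty[OF assms(1) d(1)] fine_partitions_nonempty[OF assms(2) d(1)] by blast
  have px: "xs \<in> partitions s u" and py: "ys \<in> partitions u t" using xs ys by (auto simp: fine_partitions_def)
  obtain xs' where xs': "xs = xs' @ [u]"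
    using partitionsD(1,3)[OF px] by (metis append_butlast_last_id)
  obtain ys' where ys': "ys = u # ys'"
    using partitionsD(1,2)[OF py] by (metis list.collapse)
  have p: "xs' @ u # ys' \<in> partitions s t" using partitions_join[of xs s u ys' t] px py xs' ys' by simp
  have "xs' @ u # ys' \<in> fine_partitions d s t"
    unfolding fine_partitions_def
  proof (intro CollectI conjI allI impI p)
    fix n assume n: "n < length (xs' @ u # ys') - 1"
    show "(xs' @ u # ys') ! Suc n - (xs' @ u # ys') ! n < d"
    proof (cases "n < length xs'")
      case True
      then have "(xs' @ u # ys') ! Suc n = xs ! Suc n" "(xs' @ u # ys') ! n = xs ! n"
        by (auto simp: xs' nth_append less_Suc_eq)
      then show ?thesis using xs True by (auto simp: fine_partitions_def xs')
    next
      case False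
      then obtain k where k: "n = length xs' + k" by (metis le_add_diff_inverse not_less)
      have "(xs' @ u # ys') ! Suc n = ys ! Suc k" "(xs' @ u # ys') ! n = ys ! k"
        by (simp_all add: k ys' nth_append)
      then show ?thesis using ys n k by (auto simp: fine_partitions_def ys')
    qed
  qed
  then have "xs' @ u # ys' \<in> fine_partitions d3 s t" "xs \<in> fine_partitions d1 s u" "ys \<in> fine_partitions d2 u t"
    using xs ys d unfolding fine_partitions_def by (auto intro: less_le_trans)
  then have n: "norm (psum \<Xi> (xs' @ u # ys') - I) < e" "norm (psum \<Xi> xs - I1) < e" "norm (psum \<Xi> ys - I2) < e"
    using d1(2) d2(2) d3(2) by auto
  have "I - (I1 + I2) = (psum \<Xi> xs - I1) + (psum \<Xi> ys - I2) - (psum \<Xi> (xs' @ u # ys') - I)"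
    unfolding psum_append[of \<Xi> xs' u ys'] xs' ys' by simp
  then have "norm (I - (I1 + I2)) \<le> norm (psum \<Xi> xs - I1) + norm (psum \<Xi> ys - I2) + norm (psum \<Xi> (xs' @ u # ys') - I)"
    by (simp only:) (intro order_trans[OF norm_triangle_ineq4] add_mono norm_triangle_ineq order_refl)
  then show False using n e_def by linarith
qed

section \<open>Coherent jets\<close>

lemma vertices_neq_0 [simp]: "(vertices h = 0) = False"
  using vertices_pos[of h] by simp

definition coherent_jet ::
    "nat \<Rightarrow> real \<Rightarrow> ('d \<Rightarrow> real^'k::finite \<Rightarrow> real^'k) \<Rightarrow> real \<Rightarrow> (real^'k) set \<Rightarrow> (real^'k \<Rightarrow> real) \<Rightarrow>
     ('d rtree \<Rightarrow> real^'k) \<Rightarrow> real^'k \<Rightarrow> bool" where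
  "coherent_jet N B \<sigma> \<kappa> S \<omega> Y y \<longleftrightarrow>
     (\<forall>\<mu>. Ck N (\<sigma> \<mu>) \<and> deriv_bound N (B * \<kappa>) S \<omega> (\<sigma> \<mu>)) \<and> 0 < \<kappa> \<and> y \<in> S \<and> 0 < \<omega> y \<and>
     (\<forall>\<mu> f. Suc (fvertices f) < N \<longrightarrow> Y (Node \<mu> f) = comp_coeff (\<sigma> \<mu>) Y y f)"

text \<open>Induction on the size of the tree: coherence expresses the coefficient of
  \<open>Node \<mu> f\<close> through those of the smaller trees in \<open>f\<close>. Inside the
  induction the constant already precedes the fields and the scales, so it depends on none of
  them.\<close>

lemma coherent_bound:
  assumes "0 \<le> B"
  shows "\<exists>D\<ge>1. \<forall>(\<sigma> :: 'd \<Rightarrow> real^'k::finite \<Rightarrow> real^'k) \<kappa> S \<omega> Y y h.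
    coherent_jet N B \<sigma> \<kappa> S \<omega> Y y \<longrightarrow> vertices h < N \<longrightarrow> norm (Y h) \<le> D * \<kappa> ^ vertices h * \<omega> y"
proof -
  have "\<exists>D\<ge>1. \<forall>(\<sigma> :: 'd \<Rightarrow> real^'k::finite \<Rightarrow> real^'k) \<kappa> S \<omega> Y y h.
    coherent_jet N B \<sigma> \<kappa> S \<omega> Y y \<longrightarrow> vertices h < N \<longrightarrow> vertices h \<le> j \<longrightarrow>
    norm (Y h) \<le> D * \<kappa> ^ vertices h * \<omega> y" for j
  proof (induction j)
    case 0
    show ?case by (intro exI[of _ 1]) simp
  next
    case (Suc j)
    then obtain D where D: "1 \<le> D" and IH: "\<forall>(\<sigma> :: 'd \<Rightarrow> real^'k::finite \<Rightarrow> real^'k) \<kappa> S \<omega> Y y h.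
      coherent_jet N B \<sigma> \<kappa> S \<omega> Y y \<longrightarrow> vertices h < N \<longrightarrow> vertices h \<le> j \<longrightarrow>
      norm (Y h) \<le> D * \<kappa> ^ vertices h * \<omega> y"
      by (elim exE conjE)
    let ?D = "max D (B * D ^ N)"
    show ?case
    proof (intro exI[of _ ?D] conjI allI impI)
      fix \<sigma> :: "'d \<Rightarrow> real^'k::finite \<Rightarrow> real^'k" and \<kappa> S \<omega> Y y and h :: "'d rtree"
      assume cj: "coherent_jet N B \<sigma> \<kappa> S \<omega> Y y" and h: "vertices h < N" "vertices h \<le> Suc j"
      note cj' = cj[unfolded coherent_jet_def]
      obtain \<mu> f where hf: "h = Node \<mu> f" by (cases h)
      have "norm (Y h') \<le> D * \<kappa> ^ vertices h' * \<omega> y" if "h' \<in># f" for h'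
        using fvertices_mono[OF that] h hf by (intro IH[rule_format, OF cj]) auto
      then have "norm (comp_coeff (\<sigma> \<mu>) Y y f) \<le> B * D ^ N * \<kappa> ^ Suc (fvertices f) * \<omega> y"
        using cj' h hf D assms by (intro comp_coeff_bound[where S = S]) auto
      then have "norm (Y h) \<le> B * D ^ N * (\<kappa> ^ vertices h * \<omega> y)"
        using cj' h hf by (simp add: mult.assoc)
      also have "\<dots> \<le> ?D * (\<kappa> ^ vertices h * \<omega> y)" using cj' by (intro mult_right_mono) auto
      finally show "norm (Y h) \<le> ?D * \<kappa> ^ vertices h * \<omega> y" by (simp add: mult.assoc)
    qed (use D in auto)
  qed
  from this[of N] obtain D where D: "1 \<le> D" and b: "\<forall>(\<sigma> :: 'd \<Rightarrow> real^'k::finite \<Rightarrow> real^'k) \<kappa> S \<omega> Y y h.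
      coherent_jet N B \<sigma> \<kappa> S \<omega> Y y \<longrightarrow> vertices h < N \<longrightarrow> vertices h \<le> N \<longrightarrow>
      norm (Y h) \<le> D * \<kappa> ^ vertices h * \<omega> y"
    by (elim exE conjE)
  show ?thesis
    by (intro exI[of _ D] conjI allI impI D b[rule_format]) auto
qed

text \<open>The hypotheses of \<open>two_point\<close> on the data, together with coherence at both
  times, bundled into one predicate. This makes it possible to state a bound whose constant precedes
  all the data, while the combinatorial parameters of the locale are produced in the proof.\<close>

definition jet_pair ::
    "nat \<Rightarrow> real \<Rightarrow> real \<Rightarrow> ('d::finite \<Rightarrow> real^'k::finite \<Rightarrow> real^'k) \<Rightarrow> real \<Rightarrow> real \<Rightarrow> real \<Rightarrow> real \<Rightarrow>
     (real^'k) set \<Rightarrow> (real^'k \<Rightarrow> real) \<Rightarrow> ('d rtree \<Rightarrow> real) \<Rightarrow> ('d rtree \<Rightarrow> real^'k) \<Rightarrow> ('d rtree \<Rightarrow> real^'k) \<Rightarrow>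
     real^'k \<Rightarrow> real^'k \<Rightarrow> bool" where
  "jet_pair N E B \<sigma> \<kappa> r L Q S \<omega> \<xi> Ys Yu ys yu \<longleftrightarrow>
     (\<forall>\<mu>. Ck N (\<sigma> \<mu>) \<and> deriv_bound N (B * \<kappa>) S \<omega> (\<sigma> \<mu>)) \<and> 0 < \<kappa> \<and> 0 < r \<and> r \<le> 1 \<and> 0 \<le> Q \<and>
     (\<forall>h\<in>trees_le (int N). \<bar>\<xi> h\<bar> \<le> E * (r / \<kappa>) ^ vertices h) \<and>
     convex S \<and> ys \<in> S \<and> yu \<in> S \<and>
     (\<forall>x\<in>S. 0 < \<omega> x \<and> \<omega> x \<le> L) \<and> (\<forall>x\<in>S. \<forall>y\<in>S. \<omega> x \<le> \<omega> y + norm (x - y)) \<and>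
     (\<forall>\<mu> f. Suc (fvertices f) < N \<longrightarrow> Ys (Node \<mu> f) = comp_coeff (\<sigma> \<mu>) Ys ys f) \<and>
     (\<forall>\<mu> f. Suc (fvertices f) < N \<longrightarrow> Yu (Node \<mu> f) = comp_coeff (\<sigma> \<mu>) Yu yu f) \<and>
     norm (yu - ys - (\<Sum>h\<in>trees_le (int N - 1). \<xi> h *\<^sub>R Ys h)) \<le> Q * r ^ N"

text \<open>The remainder of a composition at \<open>f\<close> needs the remainders of the trees in
  \<open>f\<close>, and the remainder of a tree comes from the composition below its root. Induction
  on the size resolves this dependence, with finitely many increases of the constant.\<close>

lemma jet_pair_bound:
  assumes E: "1 \<le> E" and B: "0 \<le> B"
  shows "\<exists>C\<ge>0. \<forall>(\<sigma> :: 'd::finite \<Rightarrow> real^'k::finite \<Rightarrow> real^'k) \<kappa> r L Q S \<omega> \<xi> Ys Yu ys yu \<mu> f.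
    jet_pair N E B \<sigma> \<kappa> r L Q S \<omega> \<xi> Ys Yu ys yu \<longrightarrow> fvertices f < N \<longrightarrow>
    norm (comp_coeff (\<sigma> \<mu>) Yu yu f
      - (\<Sum>b\<in>forests_le N (int N - 1). Poly_Mapping.lookup (fcut \<xi> b) f *\<^sub>R comp_coeff (\<sigma> \<mu>) Ys ys b))
    \<le> C * (\<kappa> ^ Suc (fvertices f) * r ^ (N - fvertices f) * (Q + L))"
proof -
  \<comment> \<open>The set also covers the forests of the tail in
    \<open>expand_composition\<close>, whose total number of vertices may exceed N; it is still
    finite, so \<open>G\<close> exists.\<close>
  let ?FS = "{f :: 'd forest. set_mset f \<subseteq> trees_le (int N) \<and> size f \<le> N}"
  define G where "G = 1 + (\<Sum>f\<in>?FS. coproduct_mass f * E ^ fvertices f)"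
  define K where "K = 1 + real (card (trees_le (int N - 1) :: 'd rtree set))
    + real (card (forests_le N (int N - 1) :: 'd forest set))
    + (\<Sum>n<N. real (card (tuples (trees_le (int N - 1) :: 'd rtree set) n)))"
  have mass0: "0 \<le> coproduct_mass f * E ^ fvertices f" for f :: "'d forest"
    using E by (auto simp: coproduct_mass_def intro!: mult_nonneg_nonneg sum_nonneg)
  have G1: "1 \<le> G" unfolding G_def using mass0 by (simp add: sum_nonneg)
  have K0: "0 \<le> (\<Sum>n<N. real (card (tuples (trees_le (int N - 1) :: 'd rtree set) n)))"
    by (intro sum_nonneg) auto
  have K1: "1 \<le> K" unfolding K_def using K0 by simp
  have G: "coproduct_mass f * E ^ fvertices f \<le> G" if "f \<in> forests N" "size f \<le> N" for f :: "'d forest"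
  proof -
    have "coproduct_mass f * E ^ fvertices f \<le> (\<Sum>f\<in>?FS. coproduct_mass f * E ^ fvertices f)"
      using that mass0 by (intro member_le_sum finite_multisets_bounded finite_trees_le) (auto simp: forests_def)
    then show ?thesis by (simp add: G_def)
  qed
  have K: "real (card (trees_le (int N - 1) :: 'd rtree set)) \<le> K"
      "real (card (forests_le N (int N - 1) :: 'd forest set)) \<le> K"
      "(\<Sum>n<N. real (card (tuples (trees_le (int N - 1) :: 'd rtree set) n))) \<le> K"
    unfolding K_def using K0 by auto
  obtain D0 where D0: "1 \<le> D0" and D0_bound: "\<forall>(\<sigma> :: 'd \<Rightarrow> real^'k \<Rightarrow> real^'k) \<kappa> S \<omega> Y y h.
    coherent_jet N B \<sigma> \<kappa> S \<omega> Y y \<longrightarrow> vertices h < N \<longrightarrow> norm (Y h) \<le> D0 * \<kappa> ^ vertices h * \<omega> y"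
    using coherent_bound[OF B, of N] by (elim exE conjE)
  have tp: "two_point N E B D G K \<kappa> r L Q S \<omega> \<xi> Ys Yu ys yu"
    if jp: "jet_pair N E B \<sigma> \<kappa> r L Q S \<omega> \<xi> Ys Yu ys yu" and D: "D0 \<le> D"
    for \<sigma> :: "'d \<Rightarrow> real^'k \<Rightarrow> real^'k" and D \<kappa> r L Q S \<omega> \<xi> Ys Yu ys yu
  proof -
    note jp' = jp[unfolded jet_pair_def]
    have pos: "0 < \<kappa>" "0 < \<omega> ys" "0 < \<omega> yu" using jp' by auto
    have "norm (Ys h) \<le> D * \<kappa> ^ vertices h * \<omega> ys" if "vertices h < N" for h
    proof -
      have "norm (Ys h) \<le> D0 * (\<kappa> ^ vertices h * \<omega> ys)"
        using D0_bound[rule_format, of \<sigma> \<kappa> S \<omega> Ys ys h] jp' that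
        by (simp add: mult.assoc coherent_jet_def)
      also have "\<dots> \<le> D * (\<kappa> ^ vertices h * \<omega> ys)" using D pos by (intro mult_right_mono) auto
      finally show ?thesis by (simp add: mult.assoc)
    qed
    moreover have "norm (Yu h) \<le> D * \<kappa> ^ vertices h * \<omega> yu" if "vertices h < N" for h
    proof -
      have "norm (Yu h) \<le> D0 * (\<kappa> ^ vertices h * \<omega> yu)"
        using D0_bound[rule_format, of \<sigma> \<kappa> S \<omega> Yu yu h] jp' that
        by (simp add: mult.assoc coherent_jet_def)
      also have "\<dots> \<le> D * (\<kappa> ^ vertices h * \<omega> yu)" using D pos by (intro mult_right_mono) auto
      finally show ?thesis by (simp add: mult.assoc)
    qed
    ultimately show ?thesis
      using E B D0 D G1 K1 G K jp' by unfold_locales auto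
  qed
  have "\<exists>D\<ge>D0. \<forall>(\<sigma> :: 'd \<Rightarrow> real^'k \<Rightarrow> real^'k) \<kappa> r L Q S \<omega> \<xi> Ys Yu ys yu h.
    jet_pair N E B \<sigma> \<kappa> r L Q S \<omega> \<xi> Ys Yu ys yu \<longrightarrow> vertices h < N \<longrightarrow> vertices h \<le> j \<longrightarrow>
    norm (Yu h - two_point.V N \<xi> Ys (Some h)) \<le> D * \<kappa> ^ vertices h * r ^ (N - vertices h) * (Q + L)" for j
  proof (induction j)
    case 0
    show ?case by (intro exI[of _ D0]) simp
  next
    case (Suc j)
    then obtain D where D: "D0 \<le> D" and IH: "\<forall>(\<sigma> :: 'd \<Rightarrow> real^'k \<Rightarrow> real^'k) \<kappa> r L Q S \<omega> \<xi> Ys Yu ys yu h.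
      jet_pair N E B \<sigma> \<kappa> r L Q S \<omega> \<xi> Ys Yu ys yu \<longrightarrow> vertices h < N \<longrightarrow> vertices h \<le> j \<longrightarrow>
      norm (Yu h - two_point.V N \<xi> Ys (Some h)) \<le> D * \<kappa> ^ vertices h * r ^ (N - vertices h) * (Q + L)"
      by (elim exE conjE)
    let ?D = "comp_const N E B D G K + K * G * B * D ^ N"
    show ?case
    proof (intro exI[of _ "max D ?D"] conjI allI impI)
      fix \<sigma> :: "'d \<Rightarrow> real^'k \<Rightarrow> real^'k" and \<kappa> r L Q S \<omega> \<xi> Ys Yu ys yu and h :: "'d rtree"
      assume jp: "jet_pair N E B \<sigma> \<kappa> r L Q S \<omega> \<xi> Ys Yu ys yu" and h: "vertices h < N" "vertices h \<le> Suc j"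
      note jp' = jp[unfolded jet_pair_def]
      interpret two_point N E B D G K \<kappa> r L Q S \<omega> \<xi> Ys Yu ys yu using tp[OF jp D] .
      obtain \<mu> f where hf: "h = Node \<mu> f" by (cases h)
      have L0: "0 \<le> L" using \<omega>s_pos \<omega>s_le by simp
      have "norm (Yu h' - V (Some h')) \<le> D * \<kappa> ^ vertices h' * r ^ (N - vertices h') * (Q + L)" if "h' \<in># f" for h'
        using fvertices_mono[OF that] h hf by (intro IH[rule_format, OF jp]) auto
      then have "norm (Yu h - V (Some h)) \<le> ?D * \<kappa> ^ Suc (fvertices f) * r ^ (N - Suc (fvertices f)) * (Q + L)"
        unfolding hf using jp' h hf by (intro tree_bound[of \<sigma>]) auto
      also have "\<dots> = ?D * (\<kappa> ^ vertices h * r ^ (N - vertices h) * (Q + L))" by (simp add: hf)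
      also have "\<dots> \<le> max D ?D * (\<kappa> ^ vertices h * r ^ (N - vertices h) * (Q + L))"
        using params L0 by (intro mult_right_mono) auto
      finally show "norm (Yu h - V (Some h)) \<le> max D ?D * \<kappa> ^ vertices h * r ^ (N - vertices h) * (Q + L)"
        by (simp add: mult.assoc)
    qed (use D in auto)
  qed
  from this[of N] obtain D where D: "D0 \<le> D" and R: "\<forall>(\<sigma> :: 'd \<Rightarrow> real^'k \<Rightarrow> real^'k) \<kappa> r L Q S \<omega> \<xi> Ys Yu ys yu h.
    jet_pair N E B \<sigma> \<kappa> r L Q S \<omega> \<xi> Ys Yu ys yu \<longrightarrow> vertices h < N \<longrightarrow> vertices h \<le> N \<longrightarrow>
    norm (Yu h - two_point.V N \<xi> Ys (Some h)) \<le> D * \<kappa> ^ vertices h * r ^ (N - vertices h) * (Q + L)"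
    by (elim exE conjE)
  have "1 \<le> K * G * E * D" using G1 K1 E D0 D
      mult_mono[of 1 K 1 G] mult_mono[of 1 "K * G" 1 E] mult_mono[of 1 "K * G * E" 1 D] by simp
  then have C0: "0 \<le> comp_const N E B D G K"
    unfolding comp_const_def Let_def using G1 K1 E D0 D B by (auto intro!: add_nonneg_nonneg mult_nonneg_nonneg)
  show ?thesis
  proof (intro exI[of _ "comp_const N E B D G K"] conjI allI impI C0)
    fix \<sigma> :: "'d \<Rightarrow> real^'k \<Rightarrow> real^'k" and \<kappa> r L Q S \<omega> \<xi> Ys Yu ys yu \<mu> and f :: "'d forest"
    assume jp: "jet_pair N E B \<sigma> \<kappa> r L Q S \<omega> \<xi> Ys Yu ys yu" and f: "fvertices f < N"
    note jp' = jp[unfolded jet_pair_def]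
    interpret two_point N E B D G K \<kappa> r L Q S \<omega> \<xi> Ys Yu ys yu using tp[OF jp D] .
    show "norm (comp_coeff (\<sigma> \<mu>) Yu yu f
      - (\<Sum>b\<in>forests_le N (int N - 1). Poly_Mapping.lookup (fcut \<xi> b) f *\<^sub>R comp_coeff (\<sigma> \<mu>) Ys ys b))
      \<le> comp_const N E B D G K * (\<kappa> ^ Suc (fvertices f) * r ^ (N - fvertices f) * (Q + L))"
    proof (rule composition_bound)
      fix h assume "h \<in># f"
      then show "norm (Yu h - V (Some h)) \<le> D * \<kappa> ^ vertices h * r ^ (N - vertices h) * (Q + L)"
        using fvertices_mono[of h f] f by (intro R[rule_format, OF jp]) auto
    qed (use jp' f in auto)
  qed
qed

lemma deriv_bound_basis:
  fixes g :: "real^'k::finite \<Rightarrow> 'w::real_inner"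
  assumes "Ck N g" and "\<And>x. x \<in> S \<Longrightarrow> 0 < \<omega> x" and "0 \<le> B"
    and "\<And>is x. length is \<le> N \<Longrightarrow> x \<in> S \<Longrightarrow>
      norm (Dn g (map (\<lambda>i. axis i 1) is) x) \<le> B * \<omega> x / \<omega> x ^ length is"
  shows "deriv_bound N (B * real CARD('k) ^ N) S \<omega> g"
  unfolding deriv_bound_def
proof (intro allI impI ballI)
  fix vs :: "(real^'k) list" and x assume vs: "length vs \<le> N" and x: "x \<in> S"
  let ?n = "length vs"
  have "norm (Dn g (vs @ map (\<lambda>i. axis i 1) []) x) \<le> (B * \<omega> x / \<omega> x ^ ?n) * real CARD('k) ^ ?n * prod_list (map norm vs)"
  proof (rule Dn_basis_bound[OF Ck_mono[OF assms(1) vs]])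
    show "norm (Dn g (map (\<lambda>i. axis i 1) is) x) \<le> B * \<omega> x / \<omega> x ^ ?n" if "length is = ?n" for "is"
      using assms(4)[of "is" x] vs x that by simp
  qed simp
  also have "\<dots> \<le> (B * \<omega> x / \<omega> x ^ ?n) * real CARD('k) ^ N * prod_list (map norm vs)"
    using assms(2)[OF x] assms(3) vs
    by (intro mult_right_mono mult_left_mono power_increasing prod_list_nonneg divide_nonneg_nonneg mult_nonneg_nonneg) (auto simp: Suc_leI)
  also have "\<dots> = B * real CARD('k) ^ N * \<omega> x * (prod_list (map norm vs) / \<omega> x ^ ?n)" by simp
  also have "prod_list (map (\<lambda>v. norm v / \<omega> x) vs) = prod_list (map norm vs) / \<omega> x ^ ?n"
    by (induction vs) auto
  note this[symmetric]
  finally show "norm (Dn g vs x) \<le> B * real CARD('k) ^ N * \<omega> x * prod_list (map (\<lambda>v. norm v / \<omega> x) vs)"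
    by simp
qed

text \<open>A qualitative bound that may depend on the compact set. It serves to show that the
  integrals exist before they are estimated uniformly.\<close>

lemma deriv_bound_compact:
  fixes g :: "real^'k::finite \<Rightarrow> 'w::real_inner"
  assumes "Ck N g" "compact S"
  shows "\<exists>B\<ge>0. deriv_bound N B S (\<lambda>_. 1) g"
proof -
  let ?I = "{is :: 'k list. set is \<subseteq> UNIV \<and> length is \<le> N}"
  have fin: "finite ?I" by (rule finite_lists_length_le) simp
  have "\<exists>B\<ge>0. \<forall>x\<in>S. norm (Dn g (map (\<lambda>i. axis i 1) is) x) \<le> B" if "is \<in> ?I" for "is"
  proof -
    have "continuous_on UNIV (Dn g (map (\<lambda>i. axis i 1) is))"
      using Ck_Dn[of 0 "map (\<lambda>i. axis i 1) is" g] Ck_mono[OF assms(1)] that by simp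
    then have "compact (Dn g (map (\<lambda>i. axis i 1) is) ` S)"
      using assms(2) continuous_on_subset compact_continuous_image by blast
    then obtain B where "\<And>z. z \<in> Dn g (map (\<lambda>i. axis i 1) is) ` S \<Longrightarrow> norm z \<le> B"
      using compact_imp_bounded bounded_iff by metis
    then show ?thesis by (intro exI[of _ "max B 0"]) force
  qed
  then have "\<forall>is\<in>?I. \<exists>B. 0 \<le> B \<and> (\<forall>x\<in>S. norm (Dn g (map (\<lambda>i. axis i 1) is) x) \<le> B)" by blast
  from bchoice[OF this] obtain b where
    b: "\<And>is. is \<in> ?I \<Longrightarrow> 0 \<le> b is \<and> (\<forall>x\<in>S. norm (Dn g (map (\<lambda>i. axis i 1) is) x) \<le> b is)"
    by blast
  let ?B = "\<Sum>is\<in>?I. b is"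
  have "norm (Dn g (map (\<lambda>i. axis i 1) is) x) \<le> ?B" if "length is \<le> N" "x \<in> S" for "is" x
    using b[of "is"] member_le_sum[OF _ _ fin, of "is" b] b that by fastforce
  moreover have "0 \<le> ?B" using b by (intro sum_nonneg) auto
  ultimately show ?thesis
    by (intro exI[of _ "?B * real CARD('k) ^ N"] conjI deriv_bound_basis[OF assms(1)]) auto
qed

section \<open>Local estimate for solutions\<close>

locale rde_solution =
  fixes m \<alpha> :: real and N :: nat
    and X :: "real \<Rightarrow> real \<Rightarrow> ('d::finite forest \<Rightarrow>\<^sub>0 real) \<Rightarrow> real"
    and \<sigma> :: "real^'k::finite \<Rightarrow> real^'d^'k" and y0 :: "real^'k"
    and Y :: "real \<Rightarrow> 'd forest \<Rightarrow>\<^sub>0 real^'k"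
  assumes \<alpha>: "0 < \<alpha>" "real N * \<alpha> \<le> 1" "1 < real (N + 1) * \<alpha>" "\<alpha> < 1"
    and m: "1 < m"
    and rough: "rough_path \<alpha> N X" and smooth: "Ck N \<sigma>" and solution: "is_solution m \<alpha> N X \<sigma> y0 Y"
begin

definition y :: "real \<Rightarrow> real^'k" where "y s = Poly_Mapping.lookup (Y s) {#}"
definition jet :: "real \<Rightarrow> 'd rtree \<Rightarrow> real^'k" where "jet s h = Poly_Mapping.lookup (Y s) {#h#}"
definition \<xi> :: "real \<Rightarrow> real \<Rightarrow> 'd rtree \<Rightarrow> real" where "\<xi> s t = tree_values (X s t)"
definition fld :: "'d \<Rightarrow> real^'k \<Rightarrow> real^'k" where "fld \<mu> x = column \<mu> (\<sigma> x)"
definition coeff :: "'d \<Rightarrow> real \<Rightarrow> 'd forest \<Rightarrow> real^'k" where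
  "coeff \<mu> s = comp_coeff (fld \<mu>) (jet s) (y s)"
text \<open>The value 0 outside \<open>s < t\<close> gives the vanishing diagonal that sewing asks
  for. Partitions increase strictly, so the sums defining the integral meet only the first
  case.\<close>

definition \<Xi> :: "'d \<Rightarrow> real \<Rightarrow> real \<Rightarrow> real^'k" where
  "\<Xi> \<mu> s t = (if s < t then \<Sum>f\<in>forests_le N (int N - 1). \<xi> s t (Node \<mu> f) *\<^sub>R coeff \<mu> s f else 0)"
definition Z :: "real \<Rightarrow> real^'k" where
  "Z s = (\<Sum>\<mu>\<in>UNIV. rough_integral N X (compose_path N (\<lambda>x. column \<mu> (\<sigma> x)) Y) \<mu> 0 s)"
definition drift :: "real \<Rightarrow> real^'k" where "drift r = norm (y r) powr (m - 1) *\<^sub>R y r"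
definition incr :: "real \<Rightarrow> real \<Rightarrow> real^'k" where
  "incr s t = y t - y s - (\<Sum>h\<in>trees_le (int N - 1). \<xi> s t h *\<^sub>R jet s h)"

abbreviation "\<theta> \<equiv> real (N + 1) * \<alpha>"

lemma N_pos: "0 < N"
  using \<alpha> by (cases N) auto

lemma bounded_linear_column: "bounded_linear (column \<mu> :: real^'d^'k \<Rightarrow> real^'k)"
  by (rule linear_conv_bounded_linear[THEN iffD1], rule linearI) (auto simp: column_def vec_eq_iff)

lemma fld_smooth: "Ck N (fld \<mu>)"
  unfolding fld_def by (rule Ck_linear_image[OF bounded_linear_column smooth])

lemma characters: "s \<in> {0..1} \<Longrightarrow> t \<in> {0..1} \<Longrightarrow> X s t \<in> characters N"
  using rough by (simp add: rough_path_def)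

lemma lookup_compose: "fvertices f < N \<Longrightarrow>
  Poly_Mapping.lookup (compose_path N (\<lambda>x. column \<mu> (\<sigma> x)) Y s) f = coeff \<mu> s f"
  unfolding coeff_def jet_def[abs_def] y_def fld_def[abs_def] by (rule lookup_compose_path)

lemma solution_eq:
  assumes "s \<in> {0..1}"
  shows "Y s = Poly_Mapping.single {#} y0 - Poly_Mapping.single {#} (integral {0..s} drift)
    + ((\<Sum>\<mu>\<in>UNIV. Poly_Mapping.single {#} (rough_integral N X (compose_path N (\<lambda>x. column \<mu> (\<sigma> x)) Y) \<mu> 0 s))
      + (\<Sum>\<mu>\<in>UNIV. \<Sum>f \<in> forests_le N (int N - 2).
           Poly_Mapping.single {#Node \<mu> f#} (Poly_Mapping.lookup (compose_path N (\<lambda>x. column \<mu> (\<sigma> x)) Y s) f)))"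
  using solution assms unfolding is_solution_def drift_def[abs_def] y_def[abs_def] Let_def by blast

lemma y_eq:
  assumes "s \<in> {0..1}"
  shows "y s = y0 - integral {0..s} drift + Z s"
  unfolding y_def by (subst solution_eq[OF assms]) (simp add: lookup_add lookup_minus lookup_sum lookup_single Z_def)

lemma jet_Node:
  assumes "s \<in> {0..1}" "Suc (fvertices f) < N"
  shows "jet s (Node \<mu> f) = coeff \<mu> s f"
proof -
  let ?A = "forests_le N (int N - 2) :: 'd forest set"
  have fN: "fvertices f < N" using assms(2) by simp
  have fA: "f \<in> ?A" using forests_le_minus_iff[of f N 2] assms(2) by simp
  have "jet s (Node \<mu> f) = (\<Sum>\<nu>\<in>UNIV. \<Sum>g\<in>?A. if \<nu> = \<mu> \<and> g = f then coeff \<mu> s f else 0)"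
    unfolding jet_def
    by (subst solution_eq[OF assms(1)])
      (auto simp: lookup_add lookup_minus lookup_sum lookup_single when_def lookup_compose fN fA intro!: sum.cong)
  also have "\<dots> = (\<Sum>\<nu>\<in>UNIV. if \<nu> = \<mu> then coeff \<mu> s f else 0)"
    using fA by (intro sum.cong refl) (auto simp: finite_forests_le)
  finally show ?thesis by simp
qed

lemma incr_eq_remainder:
  assumes "s \<in> {0..1}" "t \<in> {0..1}"
  shows "incr s t = remainder X Y {#} s t"
proof -
  have "Y s \<in> Span (utrees_le (int N - 1))"
    using solution assms unfolding is_solution_def tree_path_def by blast
  then show ?thesis
    using remainder_empty[of X s t N Y] characters[OF assms] by (simp add: incr_def y_def \<xi>_def jet_def)
qed

lemma incr_bound:
  "\<exists>Q\<ge>0. \<forall>s\<in>{0..1}. \<forall>t\<in>{0..1}. s \<noteq> t \<longrightarrow> norm (incr s t) \<le> Q * \<bar>t - s\<bar> powr (real N * \<alpha>)"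
proof -
  let ?S = "{norm (remainder X Y {#} s t) / \<bar>t - s\<bar> powr ((real N - real (fvertices ({#} :: 'd forest))) * \<alpha>) |s t.
          s \<in> {0..1} \<and> t \<in> {0..1} \<and> 0 < \<bar>s - t\<bar> \<and> \<bar>s - t\<bar> < 1}"
  have 0: "{#} \<in> forests_le N (int N - 1)" using N_pos by (simp add: forests_le_1_iff)
  have "controlled \<alpha> N X Y" using solution unfolding is_solution_def by blast
  note bspec[OF conjunct2[OF this[unfolded controlled_def]] 0]
  then obtain Q where Q: "\<And>x. x \<in> ?S \<Longrightarrow> x \<le> Q" unfolding bdd_above_def by blast
  \<comment> \<open>Controlledness bounds only pairs at distance less than 1. The remaining two
    pairs, formed by the end points, are included by hand.\<close>
  let ?Q = "max Q (max (norm (incr 1 0)) (norm (incr 0 1)))"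
  have "norm (incr s t) \<le> ?Q * \<bar>t - s\<bar> powr (real N * \<alpha>)" if st: "s \<in> {0..1}" "t \<in> {0..1}" "s \<noteq> t" for s t
  proof (cases "\<bar>s - t\<bar> < 1")
    case True
    have "norm (remainder X Y {#} s t) / \<bar>t - s\<bar> powr ((real N - real (fvertices ({#} :: 'd forest))) * \<alpha>) \<le> Q"
      by (rule Q, rule CollectI, rule exI[of _ s], rule exI[of _ t]) (use st True in simp)
    then have "norm (incr s t) \<le> Q * \<bar>t - s\<bar> powr (real N * \<alpha>)"
      using st incr_eq_remainder[of s t] by (simp add: divide_le_eq)
    also have "\<dots> \<le> ?Q * \<bar>t - s\<bar> powr (real N * \<alpha>)" by (intro mult_right_mono) auto
    finally show ?thesis .
  next
    case False
    then have "s = 0 \<and> t = 1 \<or> s = 1 \<and> t = 0" using st by (auto simp: abs_if split: if_splits)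
    then show ?thesis by auto
  qed
  moreover have "0 \<le> ?Q" by (simp add: le_max_iff_disj)
  ultimately show ?thesis by blast
qed

lemma \<xi>_seminorm:
  assumes "s \<in> {0..1}" "t \<in> {0..1}" "s \<noteq> t" "vertices h \<le> N"
  shows "\<bar>\<xi> s t h\<bar> \<le> rp_seminorm \<alpha> X {#h#} * \<bar>t - s\<bar> powr (\<alpha> * real (vertices h))"
    and "0 \<le> rp_seminorm \<alpha> X {#h#}"
proof -
  have "bdd_above (seminorm_ratios \<alpha> X {#h#})"
    using rough assms(4) by (simp add: rough_path_def trees_le_iff)
  moreover have "\<bar>\<xi> s t h\<bar> / \<bar>t - s\<bar> powr (\<alpha> * real (vertices h)) \<in> seminorm_ratios \<alpha> X {#h#}"
    unfolding seminorm_ratios_def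
    by (rule CollectI, rule exI[of _ s], rule exI[of _ t])
      (use assms in \<open>simp add: \<xi>_def tree_values_def abs_minus_commute\<close>)
  ultimately have 1: "\<bar>\<xi> s t h\<bar> / \<bar>t - s\<bar> powr (\<alpha> * real (vertices h)) \<le> rp_seminorm \<alpha> X {#h#}"
    unfolding rp_seminorm_def by (rule cSup_upper[rotated])
  then show "\<bar>\<xi> s t h\<bar> \<le> rp_seminorm \<alpha> X {#h#} * \<bar>t - s\<bar> powr (\<alpha> * real (vertices h))"
    using assms by (simp add: divide_le_eq)
  show "0 \<le> rp_seminorm \<alpha> X {#h#}" using 1 by (rule order_trans[rotated]) auto
qed

text \<open>The tree expansion of the increment gives a Hoelder bound of order \<alpha> at each
  point \<open>s\<close>. Its constant depends on \<open>jet s\<close>, which is harmless for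
  continuity.\<close>

lemma y_continuous: "continuous_on {0..1} y"
  unfolding continuous_on_def
proof
  fix s :: real assume s: "s \<in> {0..1}"
  obtain Q where Q: "0 \<le> Q" "\<And>s t. s \<in> {0..1} \<Longrightarrow> t \<in> {0..1} \<Longrightarrow> s \<noteq> t \<Longrightarrow> norm (incr s t) \<le> Q * \<bar>t - s\<bar> powr (real N * \<alpha>)"
    using incr_bound by blast
  let ?T = "trees_le (int N - 1) :: 'd rtree set"
  let ?C = "Q + (\<Sum>h\<in>?T. rp_seminorm \<alpha> X {#h#} * norm (jet s h))"
  have bound: "norm (y t - y s) \<le> ?C * \<bar>t - s\<bar> powr \<alpha>" if t: "t \<in> {0..1}" "t \<noteq> s" for t
  proof -
    have d: "0 < \<bar>t - s\<bar>" "\<bar>t - s\<bar> \<le> 1" using s t by auto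
    have le: "\<bar>t - s\<bar> powr (\<alpha> * real n) \<le> \<bar>t - s\<bar> powr \<alpha>" if "0 < n" for n
      using that \<alpha>(1) d by (intro powr_mono') auto
    have "y t - y s = incr s t + (\<Sum>h\<in>?T. \<xi> s t h *\<^sub>R jet s h)" by (simp add: incr_def)
    then have "norm (y t - y s) \<le> norm (incr s t) + norm (\<Sum>h\<in>?T. \<xi> s t h *\<^sub>R jet s h)"
      by (simp only: norm_triangle_ineq)
    also have "\<dots> \<le> Q * \<bar>t - s\<bar> powr \<alpha> + (\<Sum>h\<in>?T. rp_seminorm \<alpha> X {#h#} * norm (jet s h) * \<bar>t - s\<bar> powr \<alpha>)"
    proof (rule add_mono)
      have "norm (incr s t) \<le> Q * \<bar>t - s\<bar> powr (real N * \<alpha>)" using Q(2)[of s t] s t by simp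
      also have "\<dots> \<le> Q * \<bar>t - s\<bar> powr \<alpha>"
        using le[OF N_pos] Q(1) by (intro mult_left_mono) (simp_all add: mult.commute)
      finally show "norm (incr s t) \<le> Q * \<bar>t - s\<bar> powr \<alpha>" .
      show "norm (\<Sum>h\<in>?T. \<xi> s t h *\<^sub>R jet s h) \<le> (\<Sum>h\<in>?T. rp_seminorm \<alpha> X {#h#} * norm (jet s h) * \<bar>t - s\<bar> powr \<alpha>)"
      proof (rule sum_norm_le)
        fix h assume "h \<in> ?T"
        then have h: "vertices h \<le> N" by (simp add: trees_le_iff)
        have "\<bar>\<xi> s t h\<bar> \<le> rp_seminorm \<alpha> X {#h#} * \<bar>t - s\<bar> powr (\<alpha> * real (vertices h))"
          using \<xi>_seminorm(1)[of s t h] s t h by simp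
        also have "\<dots> \<le> rp_seminorm \<alpha> X {#h#} * \<bar>t - s\<bar> powr \<alpha>"
          using le[OF vertices_pos[of h]] \<xi>_seminorm(2)[of s t h] s t h by (intro mult_left_mono) auto
        finally have "\<bar>\<xi> s t h\<bar> * norm (jet s h) \<le> (rp_seminorm \<alpha> X {#h#} * \<bar>t - s\<bar> powr \<alpha>) * norm (jet s h)"
          by (rule mult_right_mono) simp
        then show "norm (\<xi> s t h *\<^sub>R jet s h) \<le> rp_seminorm \<alpha> X {#h#} * norm (jet s h) * \<bar>t - s\<bar> powr \<alpha>"
          by (simp add: mult_ac)
      qed
    qed
    also have "\<dots> = ?C * \<bar>t - s\<bar> powr \<alpha>" by (simp add: sum_distrib_right distrib_right)
    finally show ?thesis .
  qed
  have "((\<lambda>t. \<bar>t - s\<bar>) \<longlongrightarrow> \<bar>s - s\<bar>) (at s within {0..1})" by (intro tendsto_intros)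
  then have "((\<lambda>t. \<bar>t - s\<bar> powr \<alpha>) \<longlongrightarrow> 0) (at s within {0..1})"
    using \<alpha>(1) by (intro tendsto_zero_powrI[where b = \<alpha>]) auto
  then have "((\<lambda>t. ?C * \<bar>t - s\<bar> powr \<alpha>) \<longlongrightarrow> ?C * 0) (at s within {0..1})"
    by (intro tendsto_intros)
  then have lim: "((\<lambda>t. ?C * \<bar>t - s\<bar> powr \<alpha>) \<longlongrightarrow> 0) (at s within {0..1})" by (simp only: mult_zero_right)
  have "\<forall>\<^sub>F t in at s within {0..1}. norm (y t - y s) \<le> ?C * \<bar>t - s\<bar> powr \<alpha>"
    unfolding eventually_at_filter by (intro always_eventually allI impI bound)
  from Lim_null_comparison[OF this lim] have "((\<lambda>t. y t - y s) \<longlongrightarrow> 0) (at s within {0..1})" .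
  then show "(y \<longlongrightarrow> y s) (at s within {0..1})" by (simp add: LIM_zero_iff)
qed

lemma drift_continuous: "continuous_on {0..1} drift"
  unfolding drift_def[abs_def] using m
  by (intro continuous_on_scaleR continuous_on_powr' continuous_on_norm y_continuous continuous_on_const) auto

lemma y_diff:
  assumes "0 \<le> s" "s \<le> t" "t \<le> 1"
  shows "y t - y s = - integral {s..t} drift + (Z t - Z s)"
proof -
  have "drift integrable_on {0..t}"
    using assms by (intro integrable_continuous_real continuous_on_subset[OF drift_continuous]) auto
  then have "integral {0..s} drift + integral {s..t} drift = integral {0..t} drift"
    using assms by (intro Henstock_Kurzweil_Integration.integral_combine) auto
  note int = this[symmetric]
  have "s \<in> {0..1}" "t \<in> {0..1}" using assms by auto
  then show ?thesis unfolding y_eq[OF \<open>s \<in> _\<close>] y_eq[OF \<open>t \<in> _\<close>] int by simp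
qed

lemma y_bounded: "\<exists>M>0. \<forall>s\<in>{0..1}. norm (y s) \<le> M"
proof -
  have "compact (y ` {0..1})" using y_continuous by (intro compact_continuous_image) auto
  then have "bounded (y ` {0..1})" by (rule compact_imp_bounded)
  then obtain M where "0 < M" "\<And>x. x \<in> y ` {0..1} \<Longrightarrow> norm x \<le> M" by (auto simp: bounded_pos)
  then show ?thesis by auto
qed

text \<open>Chen's relation expands the values of X over [s, t]. The part over [s, u] cancels, and
  on [u, t] each coefficient appears through its composition remainder.\<close>

lemma \<Xi>_defect:
  assumes "0 \<le> s" "s < u" "u < t" "t \<le> 1"
  shows "\<Xi> \<mu> s t - \<Xi> \<mu> s u - \<Xi> \<mu> u t = - (\<Sum>f\<in>forests_le N (int N - 1). \<xi> u t (Node \<mu> f) *\<^sub>R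
    (coeff \<mu> u f - (\<Sum>b\<in>forests_le N (int N - 1). Poly_Mapping.lookup (fcut (\<xi> s u) b) f *\<^sub>R coeff \<mu> s b)))"
proof -
  let ?F = "forests_le N (int N - 1) :: 'd forest set"
  have Chen: "\<xi> s t (Node \<mu> b) = \<xi> s u (Node \<mu> b) + (\<Sum>f\<in>?F. \<xi> u t (Node \<mu> f) * Poly_Mapping.lookup (fcut (\<xi> s u) b) f)"
    if "b \<in> ?F" for b
    unfolding \<xi>_def using that assms by (intro Chen_Node[OF rough]) (auto simp: forests_le_1_iff)
  have "\<Xi> \<mu> s t = (\<Sum>b\<in>?F. \<xi> s t (Node \<mu> b) *\<^sub>R coeff \<mu> s b)" using assms by (simp add: \<Xi>_def)
  also have "\<dots> = (\<Sum>b\<in>?F. \<xi> s u (Node \<mu> b) *\<^sub>R coeff \<mu> s b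
      + (\<Sum>f\<in>?F. (\<xi> u t (Node \<mu> f) * Poly_Mapping.lookup (fcut (\<xi> s u) b) f) *\<^sub>R coeff \<mu> s b))"
    by (intro sum.cong refl) (simp add: Chen scaleR_add_left scaleR_sum_left)
  also have "\<dots> = \<Xi> \<mu> s u + (\<Sum>b\<in>?F. \<Sum>f\<in>?F. (\<xi> u t (Node \<mu> f) * Poly_Mapping.lookup (fcut (\<xi> s u) b) f) *\<^sub>R coeff \<mu> s b)"
    using assms by (simp add: \<Xi>_def sum.distrib)
  also have "(\<Sum>b\<in>?F. \<Sum>f\<in>?F. (\<xi> u t (Node \<mu> f) * Poly_Mapping.lookup (fcut (\<xi> s u) b) f) *\<^sub>R coeff \<mu> s b)
      = (\<Sum>f\<in>?F. \<xi> u t (Node \<mu> f) *\<^sub>R (\<Sum>b\<in>?F. Poly_Mapping.lookup (fcut (\<xi> s u) b) f *\<^sub>R coeff \<mu> s b))"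
    by (subst sum.swap) (simp add: scaleR_sum_right)
  finally show ?thesis
    using assms by (simp add: \<Xi>_def sum_subtractf scaleR_diff_right)
qed

text \<open>Constants as provided by \<open>jet_pair_bound\<close> and \<open>comp_coeff_bound\<close>; they do not depend on the path.\<close>

definition est_const :: "real \<Rightarrow> real \<Rightarrow> bool" where
  "est_const B C \<longleftrightarrow> 0 \<le> C \<and>
     (\<forall>\<kappa> r L Q S \<omega> \<zeta> Ys Yu ys yu \<mu> f. jet_pair N 1 B fld \<kappa> r L Q S \<omega> \<zeta> Ys Yu ys yu \<longrightarrow> fvertices f < N \<longrightarrow>
       norm (comp_coeff (fld \<mu>) Yu yu f
         - (\<Sum>b\<in>forests_le N (int N - 1). Poly_Mapping.lookup (fcut \<zeta> b) f *\<^sub>R comp_coeff (fld \<mu>) Ys ys b))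
       \<le> C * (\<kappa> ^ Suc (fvertices f) * r ^ (N - fvertices f) * (Q + L))) \<and>
     (\<forall>\<kappa> S \<omega> Ys ys \<mu> f. coherent_jet N B fld \<kappa> S \<omega> Ys ys \<longrightarrow> fvertices f < N \<longrightarrow>
       norm (comp_coeff (fld \<mu>) Ys ys f) \<le> C * \<kappa> ^ Suc (fvertices f) * \<omega> ys)"

text \<open>The hypotheses of the local estimate in natural units: time in units of \<tau>, space in
  units of \<omega>, which is bounded by \<open>L\<close>, and fields of size
  \<open>B * \<kappa>\<close> times \<omega>. In these units X has size at most \<epsilon> on every
  tree.\<close>

definition window ::
    "real \<Rightarrow> real \<Rightarrow> real \<Rightarrow> real \<Rightarrow> real \<Rightarrow> (real^'k) set \<Rightarrow> (real^'k \<Rightarrow> real) \<Rightarrow> real \<Rightarrow> real \<Rightarrow> bool" where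
  "window B \<epsilon> \<kappa> \<tau> L S \<omega> a b \<longleftrightarrow> 0 \<le> a \<and> a < b \<and> b \<le> 1 \<and> b - a \<le> \<tau> \<and> 0 < \<tau> \<and> 0 < \<kappa> \<and> 0 \<le> B \<and> 0 \<le> \<epsilon> \<and> \<epsilon> \<le> 1 \<and>
     (\<forall>\<mu>. deriv_bound N (B * \<kappa>) S \<omega> (fld \<mu>)) \<and> convex S \<and> (\<forall>r\<in>{a..b}. y r \<in> S) \<and>
     (\<forall>x\<in>S. 0 < \<omega> x \<and> \<omega> x \<le> L) \<and> (\<forall>x\<in>S. \<forall>x'\<in>S. \<omega> x \<le> \<omega> x' + norm (x - x')) \<and>
     (\<forall>s t h. a \<le> s \<longrightarrow> s < t \<longrightarrow> t \<le> b \<longrightarrow> vertices h \<le> N \<longrightarrow>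
        \<bar>\<xi> s t h\<bar> \<le> \<epsilon> * (((t - s) / \<tau>) powr \<alpha> / \<kappa>) ^ vertices h)"

lemma ratio_powr:
  assumes "0 < x" "x \<le> 1"
  shows "0 < x powr \<alpha>" "x powr \<alpha> \<le> 1"
  using assms \<alpha>(1) by (auto simp: powr_le1)

context
  fixes B \<epsilon> \<kappa> \<tau> L :: real and S :: "(real^'k) set" and \<omega> :: "real^'k \<Rightarrow> real" and a b C :: real
  assumes win: "window B \<epsilon> \<kappa> \<tau> L S \<omega> a b" and C: "est_const B C"
begin

lemmas win' = win[unfolded window_def]

abbreviation rr :: "real \<Rightarrow> real \<Rightarrow> real" where "rr s t \<equiv> ((t - s) / \<tau>) powr \<alpha>"

lemma rr_bounds:
  assumes "a \<le> s" "s < t" "t \<le> b"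
  shows "0 < rr s t" "rr s t \<le> 1"
  using assms win' by (auto intro!: ratio_powr)

lemma window_\<xi>:
  assumes "a \<le> s" "s < t" "t \<le> b" "vertices h \<le> N"
  shows "\<bar>\<xi> s t h\<bar> \<le> \<epsilon> * (rr s t / \<kappa>) ^ vertices h"
  using win' assms by blast

lemma L_nonneg: "0 \<le> L"
proof -
  have "y a \<in> S" using win' by auto
  then show ?thesis using win' by (meson less_imp_le order_trans)
qed

lemma window_coherent_jet:
  assumes "a \<le> s" "s \<le> b"
  shows "coherent_jet N B fld \<kappa> S \<omega> (jet s) (y s)"
proof -
  have "s \<in> {0..1}" "y s \<in> S" using assms win' by auto
  then show ?thesis using win' fld_smooth jet_Node by (auto simp: coherent_jet_def coeff_def)
qed

lemma window_jet_pair: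
  assumes "a \<le> s" "s < u" "u \<le> b" and "0 \<le> Q" "norm (incr s u) \<le> Q * rr s u ^ N"
  shows "jet_pair N 1 B fld \<kappa> (rr s u) L Q S \<omega> (\<xi> s u) (jet s) (jet u) (y s) (y u)"
proof -
  have "\<bar>\<xi> s u h\<bar> \<le> 1 * (rr s u / \<kappa>) ^ vertices h" if "h \<in> trees_le (int N)" for h
  proof -
    have "\<bar>\<xi> s u h\<bar> \<le> \<epsilon> * (rr s u / \<kappa>) ^ vertices h"
      using assms that by (intro window_\<xi>) (auto simp: trees_le_iff)
    also have "\<dots> \<le> 1 * (rr s u / \<kappa>) ^ vertices h" using win' by (intro mult_right_mono) auto
    finally show ?thesis .
  qed
  then show ?thesis
    using window_coherent_jet[of s] window_coherent_jet[of u] assms win' rr_bounds[of s u]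
    unfolding jet_pair_def coherent_jet_def incr_def by auto
qed

lemma coeff_bound:
  assumes "a \<le> s" "s \<le> b" "fvertices f < N"
  shows "norm (coeff \<mu> s f) \<le> C * \<kappa> ^ Suc (fvertices f) * L"
proof -
  have "y s \<in> S" using assms win' by auto
  then have "\<omega> (y s) \<le> L" using win' by blast
  have "norm (coeff \<mu> s f) \<le> C * \<kappa> ^ Suc (fvertices f) * \<omega> (y s)"
    unfolding coeff_def using C window_coherent_jet[OF assms(1,2)] assms(3) unfolding est_const_def by blast
  also have "\<dots> \<le> C * \<kappa> ^ Suc (fvertices f) * L"
    using \<open>\<omega> (y s) \<le> L\<close> C win' by (intro mult_left_mono) (auto simp: est_const_def)
  finally show ?thesis .
qed

text \<open>The powers of \<kappa> from X and from the coefficient cancel, the root of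
  \<open>Node \<mu> f\<close> included.\<close>

lemma \<Xi>_term_bound:
  assumes "a \<le> s" "s < t" "t \<le> b" "fvertices f < N"
  shows "norm (\<xi> s t (Node \<mu> f) *\<^sub>R coeff \<mu> s f) \<le> C * \<epsilon> * L * rr s t ^ Suc (fvertices f)"
proof -
  have "\<bar>\<xi> s t (Node \<mu> f)\<bar> \<le> \<epsilon> * (rr s t / \<kappa>) ^ vertices (Node \<mu> f)"
    using assms by (intro window_\<xi>) auto
  then have "norm (\<xi> s t (Node \<mu> f) *\<^sub>R coeff \<mu> s f)
      \<le> (\<epsilon> * (rr s t / \<kappa>) ^ Suc (fvertices f)) * (C * \<kappa> ^ Suc (fvertices f) * L)"
    unfolding norm_scaleR using coeff_bound[of s f \<mu>] assms by (intro mult_mono) (use win' in auto)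
  also have "\<dots> = C * \<epsilon> * L * rr s t ^ Suc (fvertices f)" using win' by (simp add: power_divide)
  finally show ?thesis .
qed

lemma \<Xi>_bound:
  assumes "a \<le> s" "s < t" "t \<le> b"
  shows "norm (\<Xi> \<mu> s t) \<le> real (card (forests_le N (int N - 1) :: 'd forest set)) * (C * \<epsilon> * L)"
proof -
  have "norm (\<xi> s t (Node \<mu> f) *\<^sub>R coeff \<mu> s f) \<le> C * \<epsilon> * L" if "f \<in> forests_le N (int N - 1)" for f
  proof -
    have "norm (\<xi> s t (Node \<mu> f) *\<^sub>R coeff \<mu> s f) \<le> C * \<epsilon> * L * rr s t ^ Suc (fvertices f)"
      using that assms by (intro \<Xi>_term_bound) (auto simp: forests_le_1_iff)
    also have "\<dots> \<le> C * \<epsilon> * L * 1"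
      using C win' L_nonneg rr_bounds[OF assms] by (intro mult_left_mono power_le_one) (auto simp: est_const_def)
    finally show ?thesis by simp
  qed
  then show ?thesis unfolding \<Xi>_def using assms by (simp add: sum_norm_bound)
qed

text \<open>For each \<open>f\<close> the outer value of X contributes
  \<open>Suc (fvertices f)\<close> powers of the time ratio and the composition remainder
  \<open>N - fvertices f\<close>, altogether N + 1, which is the exponent \<theta> > 1. The outer
  value also brings the factor \<epsilon>, and the remainder brings \<open>Q + L\<close>
  linearly.\<close>

lemma window_almost_additive:
  assumes Q: "0 \<le> Q" "\<And>s u. a \<le> s \<Longrightarrow> s < u \<Longrightarrow> u \<le> b \<Longrightarrow> norm (incr s u) \<le> Q * rr s u ^ N"
  shows "almost_additive \<theta> (real (card (forests_le N (int N - 1) :: 'd forest set)) * (C * \<epsilon> * (Q + L)) / \<tau> powr \<theta>) a b (\<Xi> \<mu>)"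
  unfolding almost_additive_def
proof (intro allI impI)
  fix s u t assume stu: "a \<le> s \<and> s \<le> u \<and> u \<le> t \<and> t \<le> b"
  let ?F = "forests_le N (int N - 1) :: 'd forest set"
  let ?K = "real (card ?F) * (C * \<epsilon> * (Q + L)) / \<tau> powr \<theta>"
  have C0: "0 \<le> C" using C by (simp add: est_const_def)
  have K0: "0 \<le> ?K" using C0 win' Q(1) L_nonneg by simp
  show "norm (\<Xi> \<mu> s t - \<Xi> \<mu> s u - \<Xi> \<mu> u t) \<le> ?K * (t - s) powr \<theta>"
  proof (cases "s = u \<or> u = t")
    case True
    then have "\<Xi> \<mu> s t - \<Xi> \<mu> s u - \<Xi> \<mu> u t = 0" by (elim disjE) (simp_all add: \<Xi>_def)
    then show ?thesis using mult_nonneg_nonneg[OF K0, of "(t - s) powr \<theta>"] by simp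
  next
    case False
    then have su: "s < u" "u < t" using stu by auto
    let ?R = "\<lambda>f. coeff \<mu> u f - (\<Sum>b\<in>?F. Poly_Mapping.lookup (fcut (\<xi> s u) b) f *\<^sub>R coeff \<mu> s b)"
    have "norm (\<xi> u t (Node \<mu> f) *\<^sub>R ?R f) \<le> C * \<epsilon> * (Q + L) * rr s t ^ Suc N" if f: "f \<in> ?F" for f
    proof -
      have fN: "fvertices f < N" using f by (simp add: forests_le_1_iff)
      have "jet_pair N 1 B fld \<kappa> (rr s u) L Q S \<omega> (\<xi> s u) (jet s) (jet u) (y s) (y u)"
        using Q(1) Q(2)[of s u] stu su by (intro window_jet_pair) auto
      then have "norm (?R f) \<le> C * (\<kappa> ^ Suc (fvertices f) * rr s u ^ (N - fvertices f) * (Q + L))"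
        using C fN unfolding est_const_def coeff_def by blast
      moreover have "\<bar>\<xi> u t (Node \<mu> f)\<bar> \<le> \<epsilon> * (rr u t / \<kappa>) ^ vertices (Node \<mu> f)"
        using stu su fN by (intro window_\<xi>) auto
      ultimately have "norm (\<xi> u t (Node \<mu> f) *\<^sub>R ?R f)
          \<le> (\<epsilon> * (rr u t / \<kappa>) ^ Suc (fvertices f)) * (C * (\<kappa> ^ Suc (fvertices f) * rr s u ^ (N - fvertices f) * (Q + L)))"
        unfolding norm_scaleR by (intro mult_mono) (use win' in auto)
      also have "\<dots> = C * \<epsilon> * (Q + L) * (rr u t ^ Suc (fvertices f) * rr s u ^ (N - fvertices f))"
        using win' by (simp add: power_divide)
      also have "\<dots> \<le> C * \<epsilon> * (Q + L) * (rr s t ^ Suc (fvertices f) * rr s t ^ (N - fvertices f))"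
      proof (intro mult_left_mono mult_mono power_mono)
        show "rr u t \<le> rr s t" "rr s u \<le> rr s t"
          using su win' \<alpha>(1) by (auto intro!: powr_mono2 divide_right_mono)
      qed (use C0 win' Q(1) L_nonneg in auto)
      also have "rr s t ^ Suc (fvertices f) * rr s t ^ (N - fvertices f) = rr s t ^ Suc N"
        using fN by (simp flip: power_add power_Suc)
      finally show ?thesis .
    qed
    then have "norm (\<Sum>f\<in>?F. \<xi> u t (Node \<mu> f) *\<^sub>R ?R f) \<le> real (card ?F) * (C * \<epsilon> * (Q + L) * rr s t ^ Suc N)"
      by (rule sum_norm_bound)
    also have "rr s t ^ Suc N = ((t - s) / \<tau>) powr \<theta>"
      using su win' by (subst powr_realpow[symmetric]) (auto simp: powr_powr mult.commute)
    also have "\<dots> = (t - s) powr \<theta> / \<tau> powr \<theta>" using su win' by (intro powr_divide)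
    finally show ?thesis
      using \<Xi>_defect[of s u t \<mu>] stu su win' by (simp add: mult_ac)
  qed
qed

end

end

text \<open>Stated outside the locale, because the constant has to be chosen before m, \<alpha>, X,
  \<sigma> and the solution.\<close>

lemma est_const_uniform:
  assumes B: "0 \<le> B"
  shows "\<exists>C. \<forall>m \<alpha> (X :: real \<Rightarrow> real \<Rightarrow> ('d::finite forest \<Rightarrow>\<^sub>0 real) \<Rightarrow> real)
    (\<sigma> :: real^'k::finite \<Rightarrow> real^'d^'k) y0 Y.
    rde_solution m \<alpha> N X \<sigma> y0 Y \<longrightarrow> rde_solution.est_const N \<sigma> B C"
proof -
  obtain C where C: "0 \<le> C" and jet: "\<forall>(\<sigma> :: 'd \<Rightarrow> real^'k \<Rightarrow> real^'k) \<kappa> r L Q S \<omega> \<xi> Ys Yu ys yu \<mu> f.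
    jet_pair N 1 B \<sigma> \<kappa> r L Q S \<omega> \<xi> Ys Yu ys yu \<longrightarrow> fvertices f < N \<longrightarrow>
    norm (comp_coeff (\<sigma> \<mu>) Yu yu f
      - (\<Sum>b\<in>forests_le N (int N - 1). Poly_Mapping.lookup (fcut \<xi> b) f *\<^sub>R comp_coeff (\<sigma> \<mu>) Ys ys b))
    \<le> C * (\<kappa> ^ Suc (fvertices f) * r ^ (N - fvertices f) * (Q + L))"
    using jet_pair_bound[OF order_refl B, of N] by (elim exE conjE)
  obtain D where D: "1 \<le> D" and coh: "\<forall>(\<sigma> :: 'd \<Rightarrow> real^'k \<Rightarrow> real^'k) \<kappa> S \<omega> Y y h.
    coherent_jet N B \<sigma> \<kappa> S \<omega> Y y \<longrightarrow> vertices h < N \<longrightarrow> norm (Y h) \<le> D * \<kappa> ^ vertices h * \<omega> y"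
    using coherent_bound[OF B, of N] by (elim exE conjE)
  let ?C = "max C (B * D ^ N)"
  have "rde_solution.est_const N \<sigma> B ?C" if "rde_solution m \<alpha> N X \<sigma> y0 Y"
    for m \<alpha> and X :: "real \<Rightarrow> real \<Rightarrow> ('d forest \<Rightarrow>\<^sub>0 real) \<Rightarrow> real" and \<sigma> :: "real^'k \<Rightarrow> real^'d^'k" and y0 Y
  proof -
    interpret rde_solution m \<alpha> N X \<sigma> y0 Y by fact
    show ?thesis unfolding est_const_def
    proof (intro conjI allI impI)
      fix \<kappa> r L Q S \<omega> \<zeta> Ys Yu ys yu \<mu> and f :: "'d forest"
      assume jp: "jet_pair N 1 B fld \<kappa> r L Q S \<omega> \<zeta> Ys Yu ys yu" and f: "fvertices f < N"
      have nn: "0 \<le> \<kappa> ^ Suc (fvertices f) * r ^ (N - fvertices f) * (Q + L)"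
      proof -
        have "0 < \<omega> ys \<and> \<omega> ys \<le> L" using jp unfolding jet_pair_def by blast
        then show ?thesis using jp unfolding jet_pair_def by auto
      qed
      show "norm (comp_coeff (fld \<mu>) Yu yu f
         - (\<Sum>b\<in>forests_le N (int N - 1). Poly_Mapping.lookup (fcut \<zeta> b) f *\<^sub>R comp_coeff (fld \<mu>) Ys ys b))
         \<le> ?C * (\<kappa> ^ Suc (fvertices f) * r ^ (N - fvertices f) * (Q + L))"
        by (rule order_trans[OF jet[rule_format, OF jp f] mult_right_mono[OF max.cobounded1 nn]])
    next
      fix \<kappa> S \<omega> Ys ys \<mu> and f :: "'d forest"
      assume cj: "coherent_jet N B fld \<kappa> S \<omega> Ys ys" and f: "fvertices f < N"
      note cj' = cj[unfolded coherent_jet_def]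
      have "norm (comp_coeff (fld \<mu>) Ys ys f) \<le> B * D ^ N * \<kappa> ^ Suc (fvertices f) * \<omega> ys"
      proof (rule comp_coeff_bound)
        show "norm (Ys h) \<le> D * \<kappa> ^ vertices h * \<omega> ys" if "h \<in># f" for h
          using fvertices_mono[OF that] f by (intro coh[rule_format, OF cj]) simp
      qed (use cj' f D B in auto)
      also have "\<dots> \<le> ?C * \<kappa> ^ Suc (fvertices f) * \<omega> ys"
        using cj' by (intro mult_right_mono) auto
      finally show "norm (comp_coeff (fld \<mu>) Ys ys f) \<le> ?C * \<kappa> ^ Suc (fvertices f) * \<omega> ys" .
    qed (use C in auto)
  qed
  then show ?thesis by blast
qed

lemma deriv_bound_mono:
  fixes g :: "'v::real_normed_vector \<Rightarrow> 'w::real_normed_vector"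
  assumes "deriv_bound N B S \<omega> g" "B \<le> B'" "\<And>x. x \<in> S \<Longrightarrow> 0 \<le> \<omega> x"
  shows "deriv_bound N B' S \<omega> g"
  unfolding deriv_bound_def
proof (intro allI impI ballI)
  fix vs :: "'v list" and x assume "length vs \<le> N" "x \<in> S"
  then have "norm (Dn g vs x) \<le> B * (\<omega> x * prod_list (map (\<lambda>v. norm v / \<omega> x) vs))"
    using assms(1) unfolding deriv_bound_def by (simp add: mult.assoc)
  also have "\<dots> \<le> B' * (\<omega> x * prod_list (map (\<lambda>v. norm v / \<omega> x) vs))"
    using assms(2) assms(3)[OF \<open>x \<in> S\<close>] by (intro mult_right_mono mult_nonneg_nonneg prod_list_nonneg) auto
  finally show "norm (Dn g vs x) \<le> B' * \<omega> x * prod_list (map (\<lambda>v. norm v / \<omega> x) vs)"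
    by (simp add: mult.assoc)
qed

section \<open>Existence of the rough integrals\<close>

context rde_solution
begin

text \<open>One window over all of [0, 1] with \<epsilon> = 1. Its constants depend on the path,
  which does no harm since it serves only the convergence of Riemann sums.\<close>

lemma global_window: "\<exists>B \<kappa> S. window B 1 \<kappa> 1 1 S (\<lambda>_. 1) 0 1"
proof -
  obtain M where M: "0 < M" "\<forall>s\<in>{0..1}. norm (y s) \<le> M" using y_bounded by blast
  let ?S = "cball 0 M :: (real^'k) set"
  have "\<forall>\<mu>. \<exists>B. 0 \<le> B \<and> deriv_bound N B ?S (\<lambda>_. 1) (fld \<mu>)"
    using deriv_bound_compact[OF fld_smooth] compact_cball by blast
  from choice[OF this] obtain B where B: "\<And>\<mu>. 0 \<le> B \<mu>" "\<And>\<mu>. deriv_bound N (B \<mu>) ?S (\<lambda>_. 1) (fld \<mu>)" by blast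
  let ?B = "\<Sum>\<mu>\<in>UNIV. B \<mu>"
  have Bs: "deriv_bound N ?B ?S (\<lambda>_. 1) (fld \<mu>)" for \<mu>
    using B by (intro deriv_bound_mono[OF B(2)] member_le_sum) auto
  let ?s = "\<lambda>h. rp_seminorm \<alpha> X {#h#}"
  let ?T = "trees_le (int N) :: 'd rtree set"
  \<comment> \<open>Being at least 1, \<open>k\<close> dominates every seminorm also after it is
    raised to the power \<open>vertices h\<close>. With \<kappa> = 1/k the rough path has size 1,
    and the factor \<open>k\<close> in \<open>?B * k\<close> compensates \<kappa> in the bound of
    the fields.\<close>
  define k where "k = 1 + (\<Sum>h\<in>?T. ?s h)"
  have s0: "0 \<le> ?s h" if "h \<in> ?T" for h using \<xi>_seminorm(2)[of 0 1 h] that by (simp add: trees_le_iff)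
  have k: "1 \<le> k" unfolding k_def using s0 by (simp add: sum_nonneg)
  have sk: "?s h \<le> k ^ vertices h" if h: "h \<in> ?T" for h
  proof -
    have "?s h \<le> (\<Sum>h\<in>?T. ?s h)" using h s0 by (intro member_le_sum) (auto simp: finite_trees_le)
    also have "\<dots> \<le> k ^ 1" by (simp add: k_def)
    also have "\<dots> \<le> k ^ vertices h" using k vertices_pos[of h] by (intro power_increasing) auto
    finally show ?thesis .
  qed
  have "\<bar>\<xi> s t h\<bar> \<le> 1 * (((t - s) / 1) powr \<alpha> / (1 / k)) ^ vertices h"
    if "0 \<le> s" "s < t" "t \<le> 1" "vertices h \<le> N" for s t h
  proof -
    have "\<bar>\<xi> s t h\<bar> \<le> ?s h * \<bar>t - s\<bar> powr (\<alpha> * real (vertices h))" using that by (intro \<xi>_seminorm) auto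
    also have "\<dots> \<le> k ^ vertices h * \<bar>t - s\<bar> powr (\<alpha> * real (vertices h))"
      using sk that by (intro mult_right_mono) (auto simp: trees_le_iff)
    also have "\<dots> = 1 * (((t - s) / 1) powr \<alpha> / (1 / k)) ^ vertices h"
      using that by (simp add: power_mult_distrib powr_powr flip: powr_realpow)
    finally show ?thesis .
  qed
  moreover have "0 \<le> ?B * k" using B(1) k by (intro mult_nonneg_nonneg sum_nonneg) auto
  ultimately have "window (?B * k) 1 (1 / k) 1 1 ?S (\<lambda>_. 1) 0 1"
    using k M(2) Bs unfolding window_def by auto
  then show ?thesis by blast
qed

lemma \<theta>_gt_1: "1 < \<theta>"
  using \<alpha> by simp

lemma ratio_power: "0 < x \<Longrightarrow> (x powr \<alpha>) ^ N = x powr (real N * \<alpha>)"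
  by (simp add: powr_powr mult.commute flip: powr_realpow)

lemma \<Xi>_limit_exists:
  assumes "0 \<le> s" "s \<le> t" "t \<le> 1"
  shows "\<exists>I. (psum (\<Xi> \<mu>) \<longlongrightarrow> I) (mesh_filter s t)"
proof -
  obtain B \<kappa> S where w: "window B 1 \<kappa> 1 1 S (\<lambda>_. 1) 0 1" using global_window by blast
  have "0 \<le> B" using w by (simp add: window_def)
  from est_const_uniform[OF this, of N] obtain C where C: "est_const B C"
    using rde_solution_axioms by blast
  have C0: "0 \<le> C" using C by (simp add: est_const_def)
  obtain Q where Q: "0 \<le> Q" "\<And>s t. s \<in> {0..1} \<Longrightarrow> t \<in> {0..1} \<Longrightarrow> s \<noteq> t \<Longrightarrow> norm (incr s t) \<le> Q * \<bar>t - s\<bar> powr (real N * \<alpha>)"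
    using incr_bound by blast
  have "norm (incr s u) \<le> Q * (((u - s) / 1) powr \<alpha>) ^ N" if "0 \<le> s" "s < u" "u \<le> 1" for s u
    using Q(2)[of s u] that by (simp add: ratio_power)
  from window_almost_additive[OF w C Q(1) this, of \<mu>] show ?thesis
    by (rule sewing_limit_exists[OF \<theta>_gt_1 _ _ _ assms, rotated 2]) (use C0 Q(1) in \<open>auto simp: \<Xi>_def\<close>)
qed

text \<open>\<open>Lim\<close> denotes an unspecified value if there is no limit. Only a proof of
  convergence identifies the integral in the equation with a limit of Riemann sums.\<close>

lemma rough_integral_eq:
  assumes "(psum (\<Xi> \<mu>) \<longlongrightarrow> I) (mesh_filter s t)" "s \<le> t"
  shows "rough_integral N X (compose_path N (\<lambda>x. column \<mu> (\<sigma> x)) Y) \<mu> s t = I"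
proof -
  let ?U = "compose_path N (\<lambda>x. column \<mu> (\<sigma> x)) Y"
  have germ: "germ N X ?U \<mu> u v = \<Xi> \<mu> u v" if "u < v" for u v
    unfolding germ_def \<Xi>_def using that
    by (auto simp: forests_le_1_iff lookup_compose \<xi>_def tree_values_def intro!: sum.cong)
  have "(\<Sum>n<length xs - 1. germ N X ?U \<mu> (xs ! n) (xs ! Suc n)) = psum (\<Xi> \<mu>) xs" if "xs \<in> partitions s t" for xs
    unfolding psum_eq_sum using partitionsD(4)[OF that]
    by (intro sum.cong refl germ) (auto simp: sorted_wrt_iff_nth_less)
  then have "\<forall>\<^sub>F xs in mesh_filter s t. psum (\<Xi> \<mu>) xs = (\<Sum>n<length xs - 1. germ N X ?U \<mu> (xs ! n) (xs ! Suc n))"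
    unfolding eventually_mesh_filter by (intro exI[of _ 1]) (auto simp: fine_partitions_def)
  then have "((\<lambda>xs. \<Sum>n<length xs - 1. germ N X ?U \<mu> (xs ! n) (xs ! Suc n)) \<longlongrightarrow> I) (mesh_filter s t)"
    using assms(1) by (rule Lim_transform_eventually[rotated])
  then show ?thesis
    unfolding rough_integral_def using mesh_filter_neq_bot[OF assms(2)] by (intro tendsto_Lim)
qed

definition RI :: "'d \<Rightarrow> real \<Rightarrow> real \<Rightarrow> real^'k" where
  "RI \<mu> s t = rough_integral N X (compose_path N (\<lambda>x. column \<mu> (\<sigma> x)) Y) \<mu> s t"

lemma RI_limit:
  assumes "0 \<le> s" "s \<le> t" "t \<le> 1"
  shows "(psum (\<Xi> \<mu>) \<longlongrightarrow> RI \<mu> s t) (mesh_filter s t)"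
  using \<Xi>_limit_exists[OF assms] rough_integral_eq assms unfolding RI_def by metis

lemma Z_diff:
  assumes "0 \<le> s" "s \<le> t" "t \<le> 1"
  shows "Z t - Z s = (\<Sum>\<mu>\<in>UNIV. RI \<mu> s t)"
proof -
  have "RI \<mu> 0 t = RI \<mu> 0 s + RI \<mu> s t" for \<mu>
    using assms by (intro sewing_limit_additive[OF assms(1,2) RI_limit RI_limit RI_limit]) auto
  then show ?thesis unfolding Z_def RI_def[symmetric] by (simp add: sum.distrib)
qed

lemma sum_jet_eq:
  assumes "s \<in> {0..1}"
  shows "(\<Sum>h\<in>trees_le (int N - 1). \<xi> s t h *\<^sub>R jet s h)
    = (\<Sum>\<mu>\<in>UNIV. \<Sum>f | Suc (fvertices f) < N. \<xi> s t (Node \<mu> f) *\<^sub>R coeff \<mu> s f)"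
proof -
  let ?A = "{f :: 'd forest. Suc (fvertices f) < N}"
  have T: "trees_le (int N - 1) = case_prod Node ` (UNIV \<times> ?A)"
  proof (rule set_eqI)
    fix h :: "'d rtree"
    obtain \<mu> f where "h = Node \<mu> f" by (cases h)
    then show "h \<in> trees_le (int N - 1) \<longleftrightarrow> h \<in> case_prod Node ` (UNIV \<times> ?A)"
      by (auto simp: trees_le_iff)
  qed
  have "inj_on (case_prod Node) (UNIV \<times> ?A)" by (auto simp: inj_on_def)
  then have "(\<Sum>h\<in>trees_le (int N - 1). \<xi> s t h *\<^sub>R jet s h)
      = (\<Sum>(\<mu>, f)\<in>UNIV \<times> ?A. \<xi> s t (Node \<mu> f) *\<^sub>R jet s (Node \<mu> f))"
    unfolding T by (subst sum.reindex) (auto simp: case_prod_beta comp_def)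
  also have "\<dots> = (\<Sum>(\<mu>, f)\<in>UNIV \<times> ?A. \<xi> s t (Node \<mu> f) *\<^sub>R coeff \<mu> s f)"
    using jet_Node[OF assms] by (intro sum.cong) auto
  finally show ?thesis by (simp add: sum.cartesian_product)
qed

text \<open>One summand per component \<mu> and per forest; \<open>sewing_const \<theta>\<close>
  accounts for the sewing error, the 1 for germ terms that are estimated directly.\<close>

definition loc_const :: "real \<Rightarrow> real" where
  "loc_const C = real CARD('d) * (real (card (forests_le N (int N - 1) :: 'd forest set)) * C * (sewing_const \<theta> + 1))"

section \<open>Absorbing the remainder on a window\<close>

context
  fixes B \<epsilon> \<kappa> \<tau> L :: real and S :: "(real^'k) set" and \<omega> :: "real^'k \<Rightarrow> real" and a b C :: real
  assumes win: "window B \<epsilon> \<kappa> \<tau> L S \<omega> a b" and C: "est_const B C"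
begin

lemmas win1 = win[unfolded window_def]

abbreviation rs :: "real \<Rightarrow> real \<Rightarrow> real" where "rs s t \<equiv> ((t - s) / \<tau>) powr \<alpha>"

lemma RI_bound:
  assumes Q: "0 \<le> Q" "\<And>s u. a \<le> s \<Longrightarrow> s < u \<Longrightarrow> u \<le> b \<Longrightarrow> norm (incr s u) \<le> Q * rs s u ^ N"
    and st: "a \<le> s" "s < t" "t \<le> b"
  shows "norm (RI \<mu> s t - \<Xi> \<mu> s t) \<le> sewing_const \<theta> * (real (card (forests_le N (int N - 1) :: 'd forest set)) * (C * \<epsilon> * (Q + L))) * rs s t ^ Suc N"
proof -
  let ?K = "real (card (forests_le N (int N - 1) :: 'd forest set)) * (C * \<epsilon> * (Q + L)) / \<tau> powr \<theta>"
  have C0: "0 \<le> C" using C by (simp add: est_const_def)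
  have K0: "0 \<le> ?K" using C0 win1 Q(1) L_nonneg[OF win C] by simp
  have "almost_additive \<theta> ?K a b (\<Xi> \<mu>)" by (rule window_almost_additive[OF win C Q])
  then have "almost_additive \<theta> ?K s t (\<Xi> \<mu>)" using st unfolding almost_additive_def by auto
  then have "norm (RI \<mu> s t - \<Xi> \<mu> s t) \<le> sewing_const \<theta> * ?K * (t - s) powr \<theta>"
    using st win1 by (intro sewing_limit_bound[OF \<theta>_gt_1 K0 _ _ _ RI_limit]) (auto simp: \<Xi>_def)
  also have "\<dots> = sewing_const \<theta> * (real (card (forests_le N (int N - 1) :: 'd forest set)) * (C * \<epsilon> * (Q + L))) * ((t - s) powr \<theta> / \<tau> powr \<theta>)" by simp
  also have "(t - s) powr \<theta> / \<tau> powr \<theta> = ((t - s) / \<tau>) powr \<theta>"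
    using st win1 by (intro powr_divide[symmetric])
  also have "\<dots> = rs s t ^ Suc N"
    using st win1 by (subst powr_realpow[symmetric]) (auto simp: powr_powr mult.commute)
  finally show ?thesis .
qed

lemma incr_window_bound:
  assumes Q: "0 \<le> Q" "\<And>s u. a \<le> s \<Longrightarrow> s < u \<Longrightarrow> u \<le> b \<Longrightarrow> norm (incr s u) \<le> Q * rs s u ^ N"
    and drift: "\<And>r. a \<le> r \<Longrightarrow> r \<le> b \<Longrightarrow> norm (drift r) \<le> L / \<tau>"
    and st: "a \<le> s" "s < t" "t \<le> b"
  shows "norm (incr s t) \<le> (L + loc_const C * \<epsilon> * (Q + L)) * rs s t ^ N"
proof -
  let ?F = "forests_le N (int N - 1) :: 'd forest set"
  let ?A = "{f :: 'd forest. Suc (fvertices f) < N}" and ?B = "{f :: 'd forest. Suc (fvertices f) = N}"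
  let ?term = "\<lambda>\<mu> f. \<xi> s t (Node \<mu> f) *\<^sub>R coeff \<mu> s f"
  have C0: "0 \<le> C" using C by (simp add: est_const_def)
  have L0: "0 \<le> L" by (rule L_nonneg[OF win C])
  have r: "0 < rs s t" "rs s t \<le> 1" using rr_bounds[OF win C st] by auto
  have F: "?F = ?A \<union> ?B" by (rule set_eqI, unfold Un_iff mem_Collect_eq forests_le_1_iff) auto
  then have fin: "finite (?A \<union> ?B)" using finite_forests_le[of N "int N - 1"] by metis
  have \<Xi>_eq: "\<Xi> \<mu> s t = (\<Sum>f\<in>?A. ?term \<mu> f) + (\<Sum>f\<in>?B. ?term \<mu> f)" for \<mu>
    unfolding \<Xi>_def F using st fin by (simp add: sum.union_disjoint disjoint_iff)
  have s01: "s \<in> {0..1}" using st win1 by auto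
  have y: "y t - y s = - integral {s..t} drift + (\<Sum>\<mu>\<in>UNIV. RI \<mu> s t)"
    using st win1 y_diff[of s t] Z_diff[of s t] by auto
  \<comment> \<open>The expansion of Y uses trees with fewer than N vertices, whereas the germ
    reaches trees with N vertices. These top terms stay behind, next to the drift and the sewing
    error.\<close>
  have eq: "incr s t = - integral {s..t} drift + (\<Sum>\<mu>\<in>UNIV. (RI \<mu> s t - \<Xi> \<mu> s t) + (\<Sum>f\<in>?B. ?term \<mu> f))"
    unfolding incr_def y sum_jet_eq[OF s01] \<Xi>_eq by (simp add: sum.distrib sum_subtractf)
  have 1: "norm (integral {s..t} drift) \<le> L * rs s t ^ N"
  proof -
    have "norm (integral {s..t} drift) \<le> L / \<tau> * (t - s)"
      using st win1 drift
      by (intro integral_bound continuous_on_subset[OF drift_continuous]) auto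
    also have "\<dots> = L * ((t - s) / \<tau>) powr 1" using st win1 by simp
    \<comment> \<open>In units of \<tau> the time is at most 1, and
      \<open>real N * \<alpha> \<le> 1\<close>, so the drift fits into a remainder of order
      \<open>real N * \<alpha>\<close>.\<close>
    also have "\<dots> \<le> L * ((t - s) / \<tau>) powr (real N * \<alpha>)"
      using L0 st win1 \<alpha>(2) by (intro mult_left_mono powr_mono') auto
    also have "\<dots> = L * rs s t ^ N" using st win1 by (simp add: ratio_power)
    finally show ?thesis .
  qed
  have 2: "norm ((RI \<mu> s t - \<Xi> \<mu> s t) + (\<Sum>f\<in>?B. ?term \<mu> f))
      \<le> (real (card (forests_le N (int N - 1) :: 'd forest set)) * C * (sewing_const \<theta> + 1)) * \<epsilon> * (Q + L) * rs s t ^ N" for \<mu>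
  proof -
    have a: "norm (RI \<mu> s t - \<Xi> \<mu> s t) \<le> sewing_const \<theta> * (real (card (forests_le N (int N - 1) :: 'd forest set)) * (C * \<epsilon> * (Q + L))) * rs s t ^ N"
    proof -
      have "norm (RI \<mu> s t - \<Xi> \<mu> s t) \<le> sewing_const \<theta> * (real (card (forests_le N (int N - 1) :: 'd forest set)) * (C * \<epsilon> * (Q + L))) * rs s t ^ Suc N"
        by (rule RI_bound[OF Q st])
      also have "\<dots> \<le> sewing_const \<theta> * (real (card (forests_le N (int N - 1) :: 'd forest set)) * (C * \<epsilon> * (Q + L))) * rs s t ^ N"
        using r C0 L0 Q(1) win1 sewing_const(1)[OF \<theta>_gt_1]
        by (intro mult_left_mono power_decreasing) auto
      finally show ?thesis .
    qed
    have "norm (\<Sum>f\<in>?B. ?term \<mu> f) \<le> real (card ?B) * (C * \<epsilon> * L * rs s t ^ N)"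
    proof (rule sum_norm_bound)
      fix f assume "f \<in> ?B"
      then show "norm (?term \<mu> f) \<le> C * \<epsilon> * L * rs s t ^ N"
        using \<Xi>_term_bound[OF win C st, of f \<mu>] by auto
    qed
    also have "\<dots> \<le> real (card (forests_le N (int N - 1) :: 'd forest set)) * (C * \<epsilon> * L * rs s t ^ N)"
    proof (rule mult_right_mono)
      have "card ?B \<le> card ?F" using F fin by (metis card_mono sup_ge2)
      then show "real (card ?B) \<le> real (card ?F)" by simp
    qed (use C0 L0 win1 in auto)
    also have "\<dots> \<le> real (card (forests_le N (int N - 1) :: 'd forest set)) * (C * \<epsilon> * (Q + L) * rs s t ^ N)"
      using C0 Q(1) win1 by (intro mult_left_mono mult_right_mono) auto
    finally have "norm (\<Sum>f\<in>?B. ?term \<mu> f) \<le> real (card (forests_le N (int N - 1) :: 'd forest set)) * (C * \<epsilon> * (Q + L) * rs s t ^ N)" .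
    then show ?thesis
      using a norm_triangle_ineq[of "RI \<mu> s t - \<Xi> \<mu> s t" "\<Sum>f\<in>?B. ?term \<mu> f"]
      by (simp add: algebra_simps)
  qed
  have "norm (incr s t) \<le> norm (integral {s..t} drift)
      + norm (\<Sum>\<mu>\<in>UNIV. (RI \<mu> s t - \<Xi> \<mu> s t) + (\<Sum>f\<in>?B. ?term \<mu> f))"
    unfolding eq by (rule order_trans[OF norm_triangle_ineq]) simp
  also have "\<dots> \<le> L * rs s t ^ N + real CARD('d) * ((real (card (forests_le N (int N - 1) :: 'd forest set)) * C * (sewing_const \<theta> + 1)) * \<epsilon> * (Q + L) * rs s t ^ N)"
    by (intro add_mono 1 sum_norm_bound 2)
  also have "\<dots> = (L + loc_const C * \<epsilon> * (Q + L)) * rs s t ^ N"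
    by (simp add: loc_const_def algebra_simps)
  finally show ?thesis .
qed

text \<open>The controlled remainder \<open>incr\<close> enters its own estimate with the small factor \<open>\<epsilon>\<close>, so its (finite)
  optimal constant \<open>Q\<close> can be absorbed.\<close>

lemma local_estimate:
  assumes drift: "\<And>r. a \<le> r \<Longrightarrow> r \<le> b \<Longrightarrow> norm (drift r) \<le> L / \<tau>"
    and small: "loc_const C * \<epsilon> \<le> 1 / 2"
  shows "norm (Z b - Z a) \<le> 4 * loc_const C * \<epsilon> * L"
proof -
  have C0: "0 \<le> C" using C by (simp add: est_const_def)
  have L0: "0 \<le> L" by (rule L_nonneg[OF win C])
  have ab: "a < b" "0 \<le> a" "b \<le> 1" "0 < \<tau>" "0 \<le> \<epsilon>" using win1 by auto
  define QS where "QS = {norm (incr s u) / rs s u ^ N |s u. a \<le> s \<and> s < u \<and> u \<le> b}"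
  obtain Q0 where Q0: "0 \<le> Q0" "\<And>s t. s \<in> {0..1} \<Longrightarrow> t \<in> {0..1} \<Longrightarrow> s \<noteq> t \<Longrightarrow> norm (incr s t) \<le> Q0 * \<bar>t - s\<bar> powr (real N * \<alpha>)"
    using incr_bound by blast
  have bdd: "bdd_above QS"
  proof (rule bdd_aboveI)
    fix q assume "q \<in> QS"
    then obtain s u where su: "a \<le> s" "s < u" "u \<le> b" and q: "q = norm (incr s u) / rs s u ^ N"
      unfolding QS_def by blast
    have "norm (incr s u) \<le> Q0 * (u - s) powr (real N * \<alpha>)" using Q0(2)[of s u] su ab by simp
    also have "(u - s) powr (real N * \<alpha>) = \<tau> powr (real N * \<alpha>) * rs s u ^ N"
    proof -
      have "rs s u ^ N = ((u - s) / \<tau>) powr (real N * \<alpha>)" using su ab by (intro ratio_power) simp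
      then show ?thesis using su ab by (simp add: powr_divide)
    qed
    finally show "q \<le> Q0 * \<tau> powr (real N * \<alpha>)"
      unfolding q using rr_bounds[OF win C su] by (simp add: divide_le_eq mult.assoc)
  qed
  have ne: "QS \<noteq> {}" unfolding QS_def using ab by blast
  \<comment> \<open>A finite supremum by controlledness; without finiteness the estimate of
    \<open>Q\<close> by itself would say nothing.\<close>
  define Q where "Q = Sup QS"
  have Qle: "norm (incr s u) \<le> Q * rs s u ^ N" if su: "a \<le> s" "s < u" "u \<le> b" for s u
  proof -
    have "norm (incr s u) / rs s u ^ N \<le> Q"
      unfolding Q_def using su by (intro cSup_upper bdd) (auto simp: QS_def)
    then show ?thesis using rr_bounds[OF win C su] by (simp add: divide_le_eq)
  qed
  have Q_nonneg: "0 \<le> Q"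
  proof -
    have "0 \<le> Q * rs a b ^ N" using Qle[of a b] ab norm_ge_zero order_trans by blast
    moreover have "0 < rs a b ^ N" using rr_bounds[OF win C, of a b] ab by (intro zero_less_power) simp
    ultimately show ?thesis by (metis mult_neg_pos not_le)
  qed
  have "Q \<le> L + loc_const C * \<epsilon> * (Q + L)"
    unfolding Q_def
  proof (rule cSup_least[OF ne], fold Q_def)
    fix q assume "q \<in> QS"
    then obtain s u where su: "a \<le> s" "s < u" "u \<le> b" and q: "q = norm (incr s u) / rs s u ^ N"
      unfolding QS_def by blast
    show "q \<le> L + loc_const C * \<epsilon> * (Q + L)"
      unfolding q using incr_window_bound[OF Q_nonneg Qle drift su] rr_bounds[OF win C su]
      by (simp add: divide_le_eq)
  qed
  \<comment> \<open>Half of \<open>Q\<close> moves to the left, hence \<open>Q \<le> 3 * L\<close>;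
    then \<open>Q + L \<le> 4 * L\<close> is the source of the 4 in the claim.\<close>
  also have "\<dots> \<le> L + 1 / 2 * (Q + L)" using small Q_nonneg L0 by (intro add_left_mono mult_right_mono) auto
  finally have Q3: "Q \<le> 3 * L" by (simp add: field_simps)
  have "norm (RI \<mu> a b) \<le> (real (card (forests_le N (int N - 1) :: 'd forest set)) * C * (sewing_const \<theta> + 1)) * (4 * \<epsilon> * L)" for \<mu>
  proof -
    have sc: "0 < sewing_const \<theta>" by (rule sewing_const(1)[OF \<theta>_gt_1])
    have "norm (RI \<mu> a b - \<Xi> \<mu> a b) \<le> sewing_const \<theta> * (real (card (forests_le N (int N - 1) :: 'd forest set)) * (C * \<epsilon> * (Q + L))) * rs a b ^ Suc N"
      using ab by (intro RI_bound[OF Q_nonneg Qle]) auto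
    also have "\<dots> \<le> sewing_const \<theta> * (real (card (forests_le N (int N - 1) :: 'd forest set)) * (C * \<epsilon> * (4 * L))) * 1"
      using rr_bounds[OF win C, of a b] ab C0 L0 Q3 Q_nonneg sc
      by (intro mult_mono mult_left_mono power_le_one mult_nonneg_nonneg) auto
    finally have "norm (RI \<mu> a b - \<Xi> \<mu> a b) \<le> sewing_const \<theta> * (real (card (forests_le N (int N - 1) :: 'd forest set)) * (C * \<epsilon> * (4 * L)))" by simp
    moreover have "norm (\<Xi> \<mu> a b) \<le> real (card (forests_le N (int N - 1) :: 'd forest set)) * (C * \<epsilon> * L)" using ab by (intro \<Xi>_bound[OF win C]) auto
    moreover have "0 \<le> real (card (forests_le N (int N - 1) :: 'd forest set)) * (C * \<epsilon> * L)" using C0 L0 ab by simp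
    ultimately show ?thesis
      using norm_triangle_sub[of "RI \<mu> a b" "\<Xi> \<mu> a b"] by (simp add: algebra_simps)
  qed
  then have "norm (\<Sum>\<mu>\<in>UNIV. RI \<mu> a b) \<le> real CARD('d) * ((real (card (forests_le N (int N - 1) :: 'd forest set)) * C * (sewing_const \<theta> + 1)) * (4 * \<epsilon> * L))"
    by (intro sum_norm_bound)
  then show ?thesis using Z_diff[of a b] ab by (simp add: loc_const_def mult_ac)
qed

end

end

section \<open>Coming down from infinity\<close>

text \<open>Its square is 1 minus the fraction of M^2 that is lost at the rate
  \<open>(M / 4) powr m * M\<close> during the time \<open>(2 * M) powr (1 - m)\<close>.\<close>

definition decay_const :: "real \<Rightarrow> real" where
  "decay_const m = sqrt (1 - 2 powr (1 - m) * 4 powr (- m))"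

text \<open>Chosen such that decay together with a noise of \<open>noise_const m * (2 * M)\<close>
  still leaves the factor \<open>(1 + decay_const m) / 2\<close>, which is below 1.\<close>

definition noise_const :: "real \<Rightarrow> real" where
  "noise_const m = (1 - decay_const m) / 4"

lemma decay_const:
  assumes "1 < m"
  shows "1 / 2 \<le> decay_const m" "decay_const m < 1" "0 < noise_const m" "2 * noise_const m \<le> 1 / 8"
    "(decay_const m)\<^sup>2 = 1 - 2 powr (1 - m) * 4 powr (- m)"
proof -
  define p :: real where "p = 2 powr (1 - m) * 4 powr (- m)"
  have "2 powr (1 - m) < (2::real) powr 0" "4 powr (- m) < (4::real) powr (- 1)"
    using assms by (intro powr_less_mono; simp)+
  then have "p < 1 * (1 / 4)" unfolding p_def
    by (intro mult_strict_mono) (auto simp: powr_minus)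
  then have p: "0 < p" "p < 1 / 4" by (auto simp: p_def)
  have q: "decay_const m = sqrt (1 - p)" by (simp add: decay_const_def p_def)
  show "1 / 2 \<le> decay_const m" unfolding q using p by (intro real_le_rsqrt) (simp add: power2_eq_square)
  show 1: "decay_const m < 1" unfolding q using p by simp
  show "0 < noise_const m" using 1 by (simp add: noise_const_def)
  have "3 / 4 \<le> decay_const m" unfolding q using p by (intro real_le_rsqrt) (simp add: power2_eq_square)
  then show "2 * noise_const m \<le> 1 / 8" by (simp add: noise_const_def)
  show "(decay_const m)\<^sup>2 = 1 - 2 powr (1 - m) * 4 powr (- m)"
    unfolding q p_def[symmetric] using p by simp
qed

text \<open>All that is kept of the rough equation: over times up to \<open>M powr (1 - m)\<close>,
  the time scale of the damping at height \<open>M\<close>, the noise is a small multiple of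
  \<open>M\<close> as soon as \<open>M\<close> is at least \<open>M0\<close>.\<close>

locale damped_path =
  fixes m M0 :: real and y Z :: "real \<Rightarrow> 'v::euclidean_space"
  assumes m: "1 < m" and M0: "0 < M0"
    and cont: "continuous_on {0..1} y"
    and diff: "\<And>s t. 0 \<le> s \<Longrightarrow> s \<le> t \<Longrightarrow> t \<le> 1 \<Longrightarrow>
      y t - y s = - integral {s..t} (\<lambda>r. norm (y r) powr (m - 1) *\<^sub>R y r) + (Z t - Z s)"
    and noise: "\<And>M s t. M0 \<le> M \<Longrightarrow> 0 \<le> s \<Longrightarrow> s < t \<Longrightarrow> t \<le> 1 \<Longrightarrow> t - s \<le> M powr (1 - m) \<Longrightarrow>
      (\<And>r. s \<le> r \<Longrightarrow> r \<le> t \<Longrightarrow> norm (y r) \<le> M) \<Longrightarrow> norm (Z t - Z s) \<le> noise_const m * M"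
begin

abbreviation "\<nu> \<equiv> 2 * noise_const m"

lemma drift_cont: "continuous_on {0..1} (\<lambda>r. norm (y r) powr (m - 1) *\<^sub>R y r)"
  using m by (intro continuous_on_scaleR continuous_on_powr' continuous_on_norm cont continuous_on_const) auto

section \<open>One step of damping\<close>

context
  fixes M s t
  assumes M: "M0 \<le> 2 * M" and s: "0 \<le> s" and st: "s \<le> t" and t: "t \<le> 1"
    and len: "t - s \<le> (2 * M) powr (1 - m)" and start: "norm (y s) \<le> M"
    and bnd: "\<And>r. s \<le> r \<Longrightarrow> r \<le> t \<Longrightarrow> norm (y r) \<le> 2 * M"
begin

text \<open>The path without the noise accumulated since \<open>s\<close>. It is differentiable,
  with minus the drift of \<open>y\<close> as derivative, so its squared norm obeys a differential
  inequality.\<close>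

definition x where "x r = y r - (Z r - Z s)"

lemma M_pos: "0 < M"
  using M M0 by simp

lemma x_dist:
  assumes "s \<le> r" "r \<le> t"
  shows "norm (y r - x r) \<le> \<nu> * M"
proof (cases "r = s")
  case True
  then show ?thesis using M_pos decay_const[OF m] by (simp add: x_def)
next
  case False
  then have "norm (Z r - Z s) \<le> noise_const m * (2 * M)"
    using assms s t len bnd M by (intro noise) auto
  then show ?thesis by (simp add: x_def)
qed

lemma x_deriv:
  assumes "s \<le> r" "r \<le> t"
  shows "((\<lambda>r. x r \<bullet> x r) has_real_derivative
    - 2 * (norm (y r) powr (m - 1) * (y r \<bullet> x r))) (at r within {s..t})"
proof -
  let ?d = "\<lambda>r. norm (y r) powr (m - 1) *\<^sub>R y r"
  have "((\<lambda>u. integral {s..u} ?d) has_vector_derivative ?d r) (at r within {s..t})"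
    using assms s t by (intro integral_has_vector_derivative continuous_on_subset[OF drift_cont]) auto
  then have "((\<lambda>u. y s - integral {s..u} ?d) has_vector_derivative 0 - ?d r) (at r within {s..t})"
    by (intro has_vector_derivative_diff has_vector_derivative_const)
  then have "((\<lambda>u. y s - integral {s..u} ?d) has_vector_derivative - ?d r) (at r within {s..t})" by simp
  moreover have "x u = y s - integral {s..u} ?d" if "u \<in> {s..t}" for u
    using diff[of s u] that s t by (simp add: x_def algebra_simps)
  ultimately have xd: "(x has_vector_derivative - ?d r) (at r within {s..t})"
    using assms by (intro has_vector_derivative_transform[of r "{s..t}" x]) auto
  have "((\<lambda>r. x r \<bullet> x r) has_vector_derivative (x r \<bullet> (- ?d r) + (- ?d r) \<bullet> x r)) (at r within {s..t})"
    using bounded_bilinear.has_vector_derivative[OF bounded_bilinear_inner xd xd] .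
  then show ?thesis
    by (simp add: has_real_derivative_iff_has_vector_derivative inner_commute)
qed

lemma x_cont: "continuous_on {s..t} x"
proof -
  let ?d = "\<lambda>r. norm (y r) powr (m - 1) *\<^sub>R y r"
  have c: "continuous_on {s..t} (\<lambda>u. y s - integral {s..u} ?d)"
    using s t by (intro continuous_intros indefinite_integral_continuous_1 integrable_continuous_real
        continuous_on_subset[OF drift_cont]) auto
  show ?thesis
  proof (rule continuous_on_eq[OF c])
    show "y s - integral {s..u} ?d = x u" if "u \<in> {s..t}" for u
      using diff[of s u] that s t by (simp add: x_def algebra_simps)
  qed
qed

text \<open>\<open>x\<close> and \<open>y\<close> differ by at most M/8. Where |x| is at least M/2,
  the norm of \<open>y\<close> is therefore at least M/4 and the inner product of the two at least
  M^2/8.\<close>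

lemma damping:
  assumes "s \<le> r" "r \<le> t" "M / 2 \<le> norm (x r)"
  shows "- 2 * (norm (y r) powr (m - 1) * (y r \<bullet> x r)) \<le> - ((M / 4) powr m * M)"
proof -
  have d: "norm (y r - x r) \<le> M / 8"
  proof -
    have "\<nu> * M \<le> 1 / 8 * M" using decay_const(4)[OF m] M_pos by (intro mult_right_mono) auto
    then show ?thesis using x_dist[OF assms(1,2)] by linarith
  qed
  have "norm (x r) \<le> norm (y r) + norm (y r - x r)"
    using norm_triangle_sub[of "x r" "y r"] by (simp add: norm_minus_commute)
  then have ny: "M / 4 \<le> norm (y r)" using d assms(3) M_pos by linarith
  have "- ((y r - x r) \<bullet> x r) \<le> norm (y r - x r) * norm (x r)"
    using Cauchy_Schwarz_ineq2[of "y r - x r" "x r"] by linarith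
  also have "\<dots> \<le> M / 8 * norm (x r)" using d by (intro mult_right_mono) auto
  finally have "norm (x r) * norm (x r) - M / 8 * norm (x r) \<le> y r \<bullet> x r"
    by (simp add: inner_diff_left dot_square_norm power2_eq_square)
  moreover have "M / 2 * (M / 4) \<le> norm (x r) * (norm (x r) - M / 8)"
    using assms(3) M_pos by (intro mult_mono) auto
  ultimately have yx: "M * M / 8 \<le> y r \<bullet> x r" by (simp add: algebra_simps)
  have "(M / 4) powr (m - 1) * (M * M / 8) \<le> norm (y r) powr (m - 1) * (y r \<bullet> x r)"
    using ny yx M_pos m by (intro mult_mono powr_mono2) auto
  moreover have "2 * ((M / 4) powr (m - 1) * (M * M / 8)) = (M / 4) powr m * M"
    using M_pos by (simp add: powr_diff)
  ultimately show ?thesis by linarith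
qed

text \<open>Above the level \<open>B\<close> the squared norm of \<open>x\<close> decreases. After
  the last time at or below \<open>B\<close> it could only have fallen, so being above
  \<open>B\<close> at \<open>t\<close> means being above \<open>B\<close> throughout, and the decay
  acts on the whole interval.\<close>

lemma x_upper:
  assumes B: "M / 2 \<le> B" and large: "B < norm (x t)"
  shows "B < norm (x s)" and "norm (x t)^2 \<le> norm (x s)^2 - (t - s) * ((M / 4) powr m * M)"
proof -
  let ?\<phi> = "\<lambda>r. x r \<bullet> x r" and ?\<phi>' = "\<lambda>r. - 2 * (norm (y r) powr (m - 1) * (y r \<bullet> x r))"
  have mvt: "?\<phi> t - ?\<phi> u \<le> - ((M / 4) powr m * M) * (t - u)"
    if u: "s \<le> u" "u < t" and ge: "\<And>r. u < r \<Longrightarrow> r \<le> t \<Longrightarrow> B < norm (x r)" for u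
  proof -
    have "\<exists>r\<in>{u<..<t}. ?\<phi> t - ?\<phi> u = (\<lambda>h. h * ?\<phi>' r) (t - u)"
    proof (rule mvt_simple)
      show "u < t" by fact
      fix r assume r: "u \<le> r" "r \<le> t"
      have "(?\<phi> has_real_derivative ?\<phi>' r) (at r within {s..t})" using r u by (intro x_deriv) auto
      then have "(?\<phi> has_real_derivative ?\<phi>' r) (at r within {u..t})"
        by (rule DERIV_subset) (use u in auto)
      then show "(?\<phi> has_derivative (\<lambda>h. h * ?\<phi>' r)) (at r within {u..t})"
        unfolding has_field_derivative_def by (rule has_derivative_eq_rhs) (auto simp: fun_eq_iff)
    qed
    then obtain r where r: "u < r" "r < t" "?\<phi> t - ?\<phi> u = (t - u) * ?\<phi>' r" by auto
    have "?\<phi>' r \<le> - ((M / 4) powr m * M)" using r u ge[of r] B by (intro damping) auto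
    then have "(t - u) * ?\<phi>' r \<le> (t - u) * (- ((M / 4) powr m * M))" using u by (intro mult_left_mono) auto
    then show ?thesis using r(3) by (simp add: mult.commute)
  qed
  have above: "B < norm (x r)" if r: "s \<le> r" "r \<le> t" for r
  proof (rule ccontr)
    assume neg: "\<not> B < norm (x r)"
    let ?A = "{u \<in> {s..t}. norm (x u) \<le> B}"
    have "?A = {s..t} \<inter> (\<lambda>u. norm (x u)) -` {..B}" by auto
    then have "closed ?A"
      using continuous_closed_preimage[OF continuous_on_norm[OF x_cont] closed_atLeastAtMost closed_atMost] by metis
    moreover have "bounded ?A" by (rule bounded_subset[of "{s..t}"]) auto
    moreover have rA: "r \<in> ?A" using neg r by auto
    ultimately obtain u where u: "u \<in> ?A" "\<And>v. v \<in> ?A \<Longrightarrow> v \<le> u"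
      using compact_attains_sup[of ?A] compact_eq_bounded_closed by blast
    have "u \<noteq> t" using u(1) large by auto
    then have ut: "u < t" using u(1) by auto
    have "B < norm (x v)" if "u < v" "v \<le> t" for v
      using u(2)[of v] u(1) that by force
    then have "?\<phi> t - ?\<phi> u \<le> - ((M / 4) powr m * M) * (t - u)" using u(1) ut by (intro mvt) auto
    also have "\<dots> \<le> 0" using ut M_pos by (simp add: mult_le_0_iff)
    finally have "norm (x t)^2 \<le> norm (x u)^2" by (simp add: dot_square_norm)
    then have "norm (x t) \<le> norm (x u)" by (rule power2_le_imp_le) simp
    then show False using u(1) large by auto
  qed
  show "B < norm (x s)" using above[of s] st by simp
  show "norm (x t)^2 \<le> norm (x s)^2 - (t - s) * ((M / 4) powr m * M)"
  proof (cases "s = t")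
    case False
    then show ?thesis using mvt[of s] above st by (simp add: dot_square_norm algebra_simps)
  qed simp
qed

lemma core_bound: "norm (y t) \<le> (1 + \<nu>) * M"
proof -
  have "norm (x t) \<le> M"
  proof (rule ccontr)
    assume "\<not> norm (x t) \<le> M"
    then have "M < norm (x s)" using M_pos by (intro x_upper(1)) auto
    then show False using start by (simp add: x_def)
  qed
  then show ?thesis using x_dist[of t] st norm_triangle_sub[of "y t" "x t"] by (simp add: algebra_simps)
qed

text \<open>If \<open>x\<close> ended above \<open>decay_const m * M\<close>, the decay would have
  acted all the time and pushed the square of its norm down to
  \<open>(decay_const m * M)\<^sup>2\<close>.\<close>

lemma core_decay:
  assumes "t - s = (2 * M) powr (1 - m)"
  shows "norm (y t) \<le> (1 + decay_const m) / 2 * M"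
proof -
  let ?q = "decay_const m"
  have "norm (x t) \<le> ?q * M"
  proof (rule ccontr)
    assume n: "\<not> norm (x t) \<le> ?q * M"
    have "1 / 2 * M \<le> ?q * M" using decay_const[OF m] M_pos by (intro mult_right_mono) auto
    then have "norm (x t)^2 \<le> norm (x s)^2 - (t - s) * ((M / 4) powr m * M)"
      using n by (intro x_upper(2)[of "?q * M"]) auto
    also have "norm (x s)^2 \<le> M^2" using start by (simp add: x_def power_mono)
    then have "norm (x s)^2 - (t - s) * ((M / 4) powr m * M) \<le> M^2 - (t - s) * ((M / 4) powr m * M)" by simp
    also have "(t - s) * ((M / 4) powr m * M) = (2 powr (1 - m) * 4 powr (- m)) * M^2"
      unfolding assms using M_pos
      by (simp add: powr_mult powr_divide powr_diff powr_minus power2_eq_square field_simps)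
    also have "M^2 - (2 powr (1 - m) * 4 powr (- m)) * M^2 = (?q * M)^2"
      by (simp add: power_mult_distrib decay_const(5)[OF m] algebra_simps)
    finally have "norm (x t) \<le> ?q * M"
      by (rule power2_le_imp_le) (use decay_const[OF m] M_pos in auto)
    then show False using n by simp
  qed
  then have "norm (y t) \<le> ?q * M + \<nu> * M" using x_dist[of t] st norm_triangle_sub[of "y t" "x t"] by simp
  also have "\<dots> = (1 + ?q) / 2 * M" by (simp add: noise_const_def field_simps)
  finally show ?thesis .
qed

end

text \<open>A continuity argument: at the first time with norm \<open>2 * M\<close> the bound
  \<open>2 * M\<close> holds up to then, so \<open>core_bound\<close> applies and gives a value
  strictly below \<open>2 * M\<close>.\<close>

lemma window_bounded:
  assumes M: "M0 \<le> 2 * M" and s: "0 \<le> s" and st: "s \<le> t" and t: "t \<le> 1"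
    and len: "t - s \<le> (2 * M) powr (1 - m)" and start: "norm (y s) \<le> M"
  shows "norm (y t) \<le> 2 * M"
proof (rule ccontr)
  assume n: "\<not> norm (y t) \<le> 2 * M"
  have Mp: "0 < M" using M M0 by simp
  let ?A = "{u \<in> {s..t}. 2 * M \<le> norm (y u)}"
  have c: "continuous_on {s..t} (\<lambda>u. norm (y u))"
    using s t by (intro continuous_on_norm continuous_on_subset[OF cont]) auto
  have "?A = {s..t} \<inter> (\<lambda>u. norm (y u)) -` {2 * M..}" by auto
  then have "closed ?A"
    using continuous_closed_preimage[OF c closed_atLeastAtMost closed_atLeast] by metis
  moreover have "bounded ?A" by (rule bounded_subset[of "{s..t}"]) auto
  moreover have "t \<in> ?A" using n st by auto
  ultimately obtain u where u: "u \<in> ?A" "\<And>v. v \<in> ?A \<Longrightarrow> u \<le> v"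
    using compact_attains_inf[of ?A] compact_eq_bounded_closed by blast
  have "\<exists>v\<ge>s. v \<le> u \<and> norm (y v) = 2 * M"
    using u(1) start Mp by (intro IVT' continuous_on_subset[OF c]) auto
  then obtain v where v: "s \<le> v" "v \<le> u" "norm (y v) = 2 * M" by blast
  then have "v = u" using u(2)[of v] u(1) by auto
  have below: "norm (y r) \<le> 2 * M" if "s \<le> r" "r \<le> u" for r
    using u(2)[of r] u(1) that v(3) \<open>v = u\<close> by (cases "r = u") force+
  have "norm (y u) \<le> (1 + \<nu>) * M"
    using u(1) st t s len start M below by (intro core_bound[of M s u]) auto
  also have "\<dots> < 2 * M" using Mp decay_const(4)[OF m] by (intro mult_strict_right_mono) auto
  finally show False using v(3) \<open>v = u\<close> by simp
qed

lemma window_decay: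
  assumes M: "M0 \<le> 2 * M" and s: "0 \<le> s" and t: "t \<le> 1"
    and len: "t - s = (2 * M) powr (1 - m)" and start: "norm (y s) \<le> M"
  shows "norm (y t) \<le> (1 + decay_const m) / 2 * M"
proof -
  have st: "s \<le> t" using len powr_ge_zero[of "2 * M" "1 - m"] by linarith
  have "norm (y r) \<le> 2 * M" if "s \<le> r" "r \<le> t" for r
    using assms that by (intro window_bounded[of M s r]) auto
  then show ?thesis using assms st by (intro core_decay) auto
qed

section \<open>Iteration over descending levels\<close>

abbreviation "q \<equiv> (1 + decay_const m) / 2"

text \<open>Successive bounds for |y| at the times \<open>time n\<close>. They fall by the factor
  \<open>q\<close> until they reach \<open>M0\<close> and stay there: the damping is not iterated
  below the height of the noise.\<close>

fun level :: "nat \<Rightarrow> real" where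
  "level 0 = max (norm (y 0)) M0"
| "level (Suc n) = max (q * level n) M0"

fun time :: "nat \<Rightarrow> real" where
  "time 0 = 0"
| "time (Suc n) = time n + (2 * level n) powr (1 - m)"

lemma q: "0 < q" "q < 1"
  using decay_const[OF m] by auto

lemma level_ge: "M0 \<le> level n" "0 < level n"
  using M0 by (cases n; simp add: less_max_iff_disj)+

lemma level_le: "level n \<le> level 0"
proof (induction n)
  case (Suc n)
  have "q * level n \<le> 1 * level n" using q level_ge(2)[of n] by (intro mult_right_mono) auto
  then have "q * level n \<le> level 0" using Suc by linarith
  then show ?case by simp
qed simp

lemma time_nonneg: "0 \<le> time n"
  by (induction n) auto

lemma level_bound: "time n \<le> 1 \<Longrightarrow> norm (y (time n)) \<le> level n"
proof (induction n)
  case (Suc n)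
  have "time n \<le> 1" using Suc.prems powr_ge_zero[of "2 * level n" "1 - m"] unfolding time.simps by linarith
  then have "norm (y (time (Suc n))) \<le> q * level n"
    using Suc level_ge[of n] time_nonneg[of n] by (intro window_decay[of "level n" "time n"]) auto
  then show ?case by simp
qed simp

text \<open>The solution c of \<open>c * q powr (m - 1) + 2 powr (1 - m) = c\<close>. As long as the
  levels fall geometrically, the waiting times grow geometrically, so their sum is at most a
  multiple of a power of the last level.\<close>

definition sum_const :: real where "sum_const = 2 powr (1 - m) / (1 - q powr (m - 1))"

lemma sum_const: "0 < sum_const" "sum_const * q powr (m - 1) + 2 powr (1 - m) = sum_const"
  "2 powr (1 - m) \<le> sum_const"
proof -
  define p where "p = q powr (m - 1)"
  have "q powr (m - 1) < 1 powr (m - 1)" using q m by (intro powr_less_mono2) auto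
  then have p: "0 \<le> p" "0 < 1 - p" by (auto simp: p_def)
  have c: "sum_const * (1 - p) = 2 powr (1 - m)" using p by (simp add: sum_const_def p_def[symmetric])
  show s: "0 < sum_const" using p by (simp add: sum_const_def p_def[symmetric])
  show "sum_const * q powr (m - 1) + 2 powr (1 - m) = sum_const"
    unfolding p_def[symmetric] c[symmetric] by (simp add: algebra_simps)
  have "0 \<le> sum_const * p" using s p by simp
  then show "2 powr (1 - m) \<le> sum_const" unfolding c[symmetric] by (simp add: algebra_simps)
qed

lemma time_level: "M0 < level n \<Longrightarrow> time (Suc n) \<le> sum_const * level n powr (1 - m)"
proof (induction n)
  case 0
  have "time (Suc 0) = 2 powr (1 - m) * level 0 powr (1 - m)"
    using level_ge(2)[of 0] by (simp add: powr_mult)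
  also have "\<dots> \<le> sum_const * level 0 powr (1 - m)" using sum_const by (intro mult_right_mono) auto
  finally show ?case .
next
  case (Suc n)
  have eq: "level (Suc n) = q * level n" using Suc.prems by auto
  have "q * level n < 1 * level n" using q level_ge(2)[of n] by (intro mult_strict_right_mono) auto
  then have "M0 < level n" using Suc.prems eq by linarith
  then have "time (Suc (Suc n)) \<le> sum_const * level n powr (1 - m) + (2 * level (Suc n)) powr (1 - m)"
    using Suc.IH by simp
  also have "level n powr (1 - m) = q powr (m - 1) * level (Suc n) powr (1 - m)"
  proof -
    have "c powr (m - 1) * c powr (1 - m) = 1" if "0 < c" for c :: real
      using that by (simp flip: powr_add)
    then have "q powr (m - 1) * q powr (1 - m) = 1" using q(1) by blast
    moreover have "(q * level n) powr (1 - m) = q powr (1 - m) * level n powr (1 - m)"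
      using q level_ge(2)[of n] by (intro powr_mult)
    ultimately show ?thesis unfolding eq by (metis mult.assoc mult_1)
  qed
  also have "(2 * level (Suc n)) powr (1 - m) = 2 powr (1 - m) * level (Suc n) powr (1 - m)"
    using level_ge(2)[of "Suc n"] by (intro powr_mult)
  also have "sum_const * (q powr (m - 1) * level (Suc n) powr (1 - m)) + 2 powr (1 - m) * level (Suc n) powr (1 - m)
      = (sum_const * q powr (m - 1) + 2 powr (1 - m)) * level (Suc n) powr (1 - m)"
    by (simp add: algebra_simps)
  finally show ?case unfolding sum_const(2) .
qed

lemma time_unbounded: "real n * (2 * level 0) powr (1 - m) \<le> time n"
proof (induction n)
  case (Suc n)
  have "(2 * level 0) powr (1 - m) \<le> (2 * level n) powr (1 - m)"
    using level_le[of n] level_ge[of n] m by (intro powr_mono2') auto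
  then show ?case using Suc by (simp add: algebra_simps)
qed simp

text \<open>With \<open>n\<close> such that \<open>t\<close> lies between \<open>time n\<close> and
  \<open>time (Suc n)\<close>, the norm is at most twice \<open>level n\<close>. Either that level
  is \<open>M0\<close>, or \<open>time_level\<close> turns \<open>t < time (Suc n)\<close> into a
  bound of the level by a power of \<open>t\<close>, in which the initial value no longer
  appears.\<close>

lemma coming_down:
  assumes t: "0 < t" "t \<le> 1"
  shows "norm (y t) \<le> 2 * max 1 (sum_const powr (1 / (m - 1))) * max (t powr (- 1 / (m - 1))) M0"
proof -
  let ?c = "sum_const powr (1 / (m - 1))" and ?tm = "t powr (- 1 / (m - 1))"
  have "\<exists>n. t < time n"
  proof -
    have p: "0 < (2 * level 0) powr (1 - m)" using level_ge(2)[of 0] by simp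
    obtain n where "t / (2 * level 0) powr (1 - m) < real n" using reals_Archimedean2 by blast
    then have "t < real n * (2 * level 0) powr (1 - m)" using p by (simp add: divide_less_eq)
    then show ?thesis using time_unbounded[of n] by (intro exI[of _ n]) linarith
  qed
  then have ex: "t < time (LEAST n. t < time n)" by (rule LeastI_ex)
  have "(LEAST n. t < time n) \<noteq> 0"
  proof
    assume "(LEAST n. t < time n) = 0"
    then have "t < time 0" using ex by (simp only:)
    then show False using t by simp
  qed
  then obtain n where n: "(LEAST n. t < time n) = Suc n" using not0_implies_Suc by blast
  have t1: "t < time (Suc n)" using ex n by simp
  have t2: "time n \<le> t" using not_less_Least[of n "\<lambda>n. t < time n"] n by simp
  have "norm (y t) \<le> 2 * level n"
    using t t1 t2 time_nonneg[of n] level_ge[of n] level_bound[of n]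
    by (intro window_bounded[of "level n" "time n" t]) auto
  also have "level n \<le> max (?c * ?tm) M0"
  proof (cases "M0 < level n")
    case True
    then have "t \<le> sum_const * level n powr (1 - m)" using time_level[of n] t1 by linarith
    then have "t * level n powr (m - 1) \<le> sum_const"
    proof -
      assume "t \<le> sum_const * level n powr (1 - m)"
      then have "t * level n powr (m - 1) \<le> sum_const * level n powr (1 - m) * level n powr (m - 1)"
        by (intro mult_right_mono) auto
      also have "\<dots> = sum_const" using level_ge(2)[of n] by (simp add: mult.assoc flip: powr_add)
      finally show ?thesis .
    qed
    then have "level n powr (m - 1) \<le> sum_const / t" using t by (simp add: field_simps)
    then have "(level n powr (m - 1)) powr (1 / (m - 1)) \<le> (sum_const / t) powr (1 / (m - 1))"
      using m by (intro powr_mono2) auto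
    then have "level n \<le> (sum_const / t) powr (1 / (m - 1))"
      using m level_ge(2)[of n] by (simp add: powr_powr)
    also have "\<dots> = ?c * ?tm"
    proof -
      have "?tm = inverse (t powr (1 / (m - 1)))" using powr_minus[of t "1 / (m - 1)"] by simp
      moreover have "(sum_const / t) powr (1 / (m - 1)) = ?c / t powr (1 / (m - 1))"
        using t sum_const(1) by (intro powr_divide)
      ultimately show ?thesis by (simp only: divide_inverse)
    qed
    finally show ?thesis by simp
  qed simp
  also have "max (?c * ?tm) M0 \<le> max 1 ?c * max ?tm M0"
  proof (rule max.boundedI)
    show "?c * ?tm \<le> max 1 ?c * max ?tm M0" by (intro mult_mono) auto
    have "1 * M0 \<le> max 1 ?c * max ?tm M0" using M0 by (intro mult_mono) auto
    then show "M0 \<le> max 1 ?c * max ?tm M0" by simp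
  qed
  finally show ?thesis by simp
qed

end

section \<open>The a priori bound\<close>

lemma norm_column_le: "norm (column \<mu> (A :: real^'d::finite^'k::finite)) \<le> norm A"
  unfolding norm_vec_def[of "column \<mu> A"] norm_vec_def[of A]
  by (rule L2_set_mono) (simp_all add: column_def component_le_norm_cart)

lemma increments_chain:
  fixes Z :: "real \<Rightarrow> 'v::real_normed_vector"
  assumes "0 < \<tau>" "0 \<le> c" and c: "\<And>a b. s \<le> a \<Longrightarrow> a < b \<Longrightarrow> b \<le> t \<Longrightarrow> b - a \<le> \<tau> \<Longrightarrow> norm (Z b - Z a) \<le> c"
  shows "s \<le> u \<Longrightarrow> u \<le> t \<Longrightarrow> u - s \<le> real n * \<tau> \<Longrightarrow> norm (Z u - Z s) \<le> real n * c"
proof (induction n arbitrary: u)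
  case (Suc n)
  show ?case
  proof (cases "u - s \<le> \<tau>")
    case True
    have "norm (Z u - Z s) \<le> c" using c[of s u] True Suc.prems assms(2) by (cases "u = s") auto
    also have "\<dots> \<le> real (Suc n) * c" using assms(2) by (simp add: algebra_simps)
    finally show ?thesis .
  next
    case False
    then have "norm (Z (u - \<tau>) - Z s) \<le> real n * c"
      using Suc.prems assms(1) by (intro Suc.IH) (auto simp: algebra_simps)
    moreover have "norm (Z u - Z (u - \<tau>)) \<le> c" using False Suc.prems assms(1) by (intro c) auto
    ultimately show ?thesis
      using norm_triangle_ineq[of "Z u - Z (u - \<tau>)" "Z (u - \<tau>) - Z s"] by (simp add: algebra_simps)
  qed
qed simp

lemma japanese_bracket:
  "1 \<le> japanese_bracket x" "japanese_bracket x \<le> 1 + norm x"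
  "japanese_bracket x \<le> japanese_bracket y + norm (x - y)"
proof -
  show "1 \<le> japanese_bracket x" by (simp add: japanese_bracket_def)
  show "japanese_bracket x \<le> 1 + norm x"
    unfolding japanese_bracket_def by (rule real_le_lsqrt) (auto simp: power2_eq_square algebra_simps)
  have "norm x \<le> norm y + norm (x - y)" by (metis add.commute norm_triangle_sub)
  then have "(norm x)\<^sup>2 \<le> (norm y + norm (x - y))\<^sup>2" by (intro power_mono) auto
  then have "japanese_bracket x \<le> sqrt (1\<^sup>2 + (norm y + norm (x - y))\<^sup>2)"
    unfolding japanese_bracket_def by (intro real_sqrt_le_mono) simp
  \<comment> \<open>Minkowski's inequality in the plane for the vectors (1, |y|) and (0, |x -
    y|).\<close>
  also have "\<dots> = sqrt ((1 + 0)\<^sup>2 + (norm y + norm (x - y))\<^sup>2)" by simp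
  also have "\<dots> \<le> sqrt (1\<^sup>2 + (norm y)\<^sup>2) + sqrt (0\<^sup>2 + (norm (x - y))\<^sup>2)" by (rule real_sqrt_sum_squares_triangle_ineq)
  finally show "japanese_bracket x \<le> japanese_bracket y + norm (x - y)"
    by (simp add: japanese_bracket_def)
qed

section \<open>Noise level and smallness of the rough path\<close>

context rde_solution
begin

lemma fld_axis_bound:
  assumes "length is \<le> N"
  shows "norm (Dn (fld \<mu>) (map (\<lambda>i. axis i 1) is) x) \<le> norm (partial_deriv (count_list is) \<sigma> x)"
proof -
  have s: "Ck (length is) \<sigma>" using Ck_mono[OF smooth assms] .
  have "Dn (fld \<mu>) (map (\<lambda>i. axis i 1) is) = (\<lambda>x. column \<mu> (Dn \<sigma> (map (\<lambda>i. axis i 1) is) x))"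
    unfolding fld_def[abs_def] using s by (intro Dn_linear_image bounded_linear_column) simp
  then show ?thesis by (simp add: partial_deriv_eq(1)[OF s] norm_column_le)
qed

definition noise_level :: "real \<Rightarrow> real" where
  "noise_level e = (MAX h \<in> trees_le (int N). rp_seminorm \<alpha> X {#h#} powr (1 / (e * real (vertices h))))"

lemma noise_level_ge:
  "h \<in> trees_le (int N) \<Longrightarrow> rp_seminorm \<alpha> X {#h#} powr (1 / (e * real (vertices h))) \<le> noise_level e"
  unfolding noise_level_def by (intro Max_ge finite_imageI finite_trees_le imageI)

text \<open>The hypothesis on \<open>M\<close> bounds the seminorm of \<open>h\<close> by
  \<epsilon>^|h| M^(e|h|). Since |h| \<ge> 1 and \<epsilon> \<le> 1, a full factor \<epsilon> is
  available for every tree.\<close>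

lemma \<xi>_small:
  assumes e: "0 < e" and \<epsilon>: "0 < \<epsilon>" "\<epsilon> \<le> 1" and M: "0 < M" "noise_level e \<le> \<epsilon> powr (1 / e) * M"
    and st: "0 \<le> s" "s < t" "t \<le> 1" and h: "vertices h \<le> N"
  shows "\<bar>\<xi> s t h\<bar> \<le> \<epsilon> * (M powr e * (t - s) powr \<alpha>) ^ vertices h"
proof -
  let ?v = "real (vertices h)" and ?s = "rp_seminorm \<alpha> X {#h#}"
  have v: "1 \<le> ?v" using vertices_pos[of h] by simp
  have s0: "0 \<le> ?s" using \<xi>_seminorm(2)[of s t h] st h by simp
  have "?s \<le> (\<epsilon> powr (1 / e) * M) powr (e * ?v)"
  proof -
    have "?s = (?s powr (1 / (e * ?v))) powr (e * ?v)"
      using s0 e v by (cases "?s = 0") (auto simp: powr_powr)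
    also have "\<dots> \<le> (\<epsilon> powr (1 / e) * M) powr (e * ?v)"
      using noise_level_ge[of h e] M h e v by (intro powr_mono2) (auto simp: trees_le_iff)
    finally show ?thesis .
  qed
  also have "\<dots> = (\<epsilon> powr (1 / e)) powr (e * ?v) * M powr (e * ?v)"
    using M by (intro powr_mult)
  also have "(\<epsilon> powr (1 / e)) powr (e * ?v) = \<epsilon> powr ?v" using e by (simp add: powr_powr)
  also have "\<epsilon> powr ?v * M powr (e * ?v) \<le> \<epsilon> powr 1 * M powr (e * ?v)"
    using \<epsilon> v by (intro mult_right_mono powr_mono') auto
  finally have s: "?s \<le> \<epsilon> * M powr (e * ?v)" using \<epsilon> by simp
  have "\<bar>\<xi> s t h\<bar> \<le> ?s * (t - s) powr (\<alpha> * ?v)" using \<xi>_seminorm(1)[of s t h] st h by simp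
  also have "\<dots> \<le> \<epsilon> * M powr (e * ?v) * (t - s) powr (\<alpha> * ?v)" using s by (intro mult_right_mono) auto
  also have "\<dots> = \<epsilon> * (M powr e * (t - s) powr \<alpha>) ^ vertices h"
    using M st by (simp add: power_mult_distrib powr_powr flip: powr_realpow)
  finally show ?thesis .
qed

lemma norm_drift:
  assumes "norm (y r) \<le> M"
  shows "norm (drift r) \<le> M powr m"
proof (cases "y r = 0")
  case False
  have "norm (drift r) = norm (y r) powr (m - 1) * norm (y r) powr 1" by (simp add: drift_def)
  also have "\<dots> = norm (y r) powr m" using False by (simp only: powr_add[symmetric]) simp
  also have "\<dots> \<le> M powr m" using assms m by (intro powr_mono2) auto
  finally show ?thesis .
qed (simp add: drift_def)

lemma bound_from_noise:
  assumes e: "0 < e" and \<epsilon>: "0 < \<epsilon>" "\<epsilon> \<le> 1"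
    and noise: "\<And>M s t. 1 \<le> M \<Longrightarrow> noise_level e \<le> \<epsilon> powr (1 / e) * M \<Longrightarrow> 0 \<le> s \<Longrightarrow> s < t \<Longrightarrow> t \<le> 1 \<Longrightarrow>
      t - s \<le> M powr (1 - m) \<Longrightarrow> (\<And>r. s \<le> r \<Longrightarrow> r \<le> t \<Longrightarrow> norm (y r) \<le> M) \<Longrightarrow>
      norm (Z t - Z s) \<le> noise_const m * M"
    and t: "0 < t" "t \<le> 1"
  shows "norm (y t) \<le> 2 * max 1 (damped_path.sum_const m powr (1 / (m - 1))) / \<epsilon> powr (1 / e)
    * max (t powr (- 1 / (m - 1))) (noise_level e)"
proof -
  let ?d = "\<epsilon> powr (1 / e)" and ?T = "t powr (- 1 / (m - 1))"
  let ?c = "2 * max 1 (damped_path.sum_const m powr (1 / (m - 1)))"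
  \<comment> \<open>The noise estimates ask for heights at least 1. In the result this 1 is covered
    by the power of \<open>t\<close>, which is at least 1 for \<open>t \<le> 1\<close>.\<close>
  let ?M0 = "max 1 (noise_level e / ?d)"
  have d: "0 < ?d" "?d \<le> 1" using \<epsilon> e by (auto simp: powr_le1)
  have T: "1 \<le> ?T"
  proof -
    have "t powr 0 \<le> t powr (- 1 / (m - 1))" using t m by (intro powr_mono') auto
    then show ?thesis using t by simp
  qed
  interpret dp: damped_path m ?M0 y Z
  proof
    show "y v - y u = - integral {u..v} (\<lambda>r. norm (y r) powr (m - 1) *\<^sub>R y r) + (Z v - Z u)"
      if "0 \<le> u" "u \<le> v" "v \<le> 1" for u v
      using y_diff[OF that] by (simp add: drift_def[abs_def])
    show "norm (Z v - Z u) \<le> noise_const m * M"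
      if "?M0 \<le> M" "0 \<le> u" "u < v" "v \<le> 1" "v - u \<le> M powr (1 - m)"
        "\<And>r. u \<le> r \<Longrightarrow> r \<le> v \<Longrightarrow> norm (y r) \<le> M" for M u v
      using that d by (intro noise) (auto simp: divide_le_eq mult.commute)
  qed (use m y_continuous in auto)
  have 1: "norm (y t) \<le> ?c * max ?T ?M0" by (rule dp.coming_down[OF t])
  have 2: "max ?T ?M0 \<le> max ?T (noise_level e) / ?d"
  proof (intro max.boundedI)
    have "?T * ?d \<le> ?T * 1" using d T by (intro mult_left_mono) auto
    then show "?T \<le> max ?T (noise_level e) / ?d" using d by (simp add: le_divide_eq le_max_iff_disj)
    then show "1 \<le> max ?T (noise_level e) / ?d" using T by linarith
    show "noise_level e / ?d \<le> max ?T (noise_level e) / ?d" using d by (intro divide_right_mono) auto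
  qed
  have "?c * max ?T ?M0 \<le> ?c * (max ?T (noise_level e) / ?d)" by (rule mult_left_mono[OF 2]) simp
  with 1 have "norm (y t) \<le> ?c * (max ?T (noise_level e) / ?d)" by (rule order_trans)
  then show ?thesis by (simp only: times_divide_eq_right times_divide_eq_left)
qed

end

text \<open>A value of \<open>\<epsilon>\<close> for which \<open>local_estimate\<close> gives a sufficiently small noise.\<close>

definition small_param :: "real \<Rightarrow> real \<Rightarrow> real" where
  "small_param m l = min (1 / (2 * (l + 1))) (noise_const m / (8 * (l + 1)))"

lemma small_param:
  assumes "1 < m" "0 \<le> l"
  shows "0 < small_param m l" "small_param m l \<le> 1" "l * small_param m l \<le> 1 / 2" "8 * (l * small_param m l) \<le> noise_const m"
proof -
  let ?e = "small_param m l"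
  have n: "0 < noise_const m" by (rule decay_const(3)[OF assms(1)])
  show e: "0 < ?e" using n assms by (simp add: small_param_def)
  have "?e \<le> 1 / (2 * (l + 1))" "?e \<le> noise_const m / (8 * (l + 1))" by (auto simp: small_param_def)
  then have *: "2 * ((l + 1) * ?e) \<le> 1" "8 * ((l + 1) * ?e) \<le> noise_const m"
    using assms by (simp_all add: field_simps)
  have **: "(l + 1) * ?e = l * ?e + ?e" "0 \<le> l * ?e" using e assms by (simp_all add: algebra_simps)
  show "?e \<le> 1" "l * ?e \<le> 1 / 2" "8 * (l * ?e) \<le> noise_const m"
    using * ** e by linarith+
qed

section \<open>The two growth regimes\<close>

context rde_solution
begin

lemma loc_const_nonneg: "est_const B C \<Longrightarrow> 0 \<le> loc_const C"
  using sewing_const(1)[OF \<theta>_gt_1] by (simp add: loc_const_def est_const_def)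

text \<open>Bounded fields have length scale 1, and the drift is at most M^m, so a window may last
  M^(-m). The exponent m\<alpha> of the noise level is the power of M in \<tau>^(-\<alpha>). The
  damping time M^(1-m) is covered by about M windows, each with an increment of order
  \<epsilon>.\<close>

lemma noise_bounded_coeffs:
  assumes B: "0 \<le> B" "bounded_coeffs N B \<sigma>" and C: "est_const (B * real CARD('k) ^ N) C"
    and \<epsilon>: "\<epsilon> = small_param m (loc_const C)"
    and M: "1 \<le> M" "noise_level (m * \<alpha>) \<le> \<epsilon> powr (1 / (m * \<alpha>)) * M"
    and st: "0 \<le> s" "s < t" "t \<le> 1" "t - s \<le> M powr (1 - m)"
    and y: "\<And>r. s \<le> r \<Longrightarrow> r \<le> t \<Longrightarrow> norm (y r) \<le> M"
  shows "norm (Z t - Z s) \<le> noise_const m * M"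
proof -
  let ?\<tau> = "M powr (- m)" and ?l = "loc_const C"
  note l0 = loc_const_nonneg[OF C]
  note sp = small_param[OF m l0, folded \<epsilon>]
  have \<tau>: "0 < ?\<tau>" using M by simp
  have "norm (Z b - Z a) \<le> 4 * ?l * \<epsilon> * 1" if ab: "s \<le> a" "a < b" "b \<le> t" "b - a \<le> ?\<tau>" for a b
  proof (rule local_estimate)
    show "window (B * real CARD('k) ^ N) \<epsilon> 1 ?\<tau> 1 UNIV (\<lambda>_. 1) a b"
      unfolding window_def
    proof (intro conjI allI impI ballI)
      show "deriv_bound N (B * real CARD('k) ^ N * 1) UNIV (\<lambda>_. 1) (fld \<mu>)" for \<mu>
        unfolding mult_1_right
      proof (rule deriv_bound_basis[OF fld_smooth])
        fix "is" :: "'k list" and x :: "real^'k" assume i: "length is \<le> N"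
        have "norm (partial_deriv (count_list is) \<sigma> x) \<le> B"
          using B(2) i partial_deriv_eq(2)[OF Ck_mono[OF smooth i]] by (simp add: bounded_coeffs_def)
        then show "norm (Dn (fld \<mu>) (map (\<lambda>i. axis i 1) is) x) \<le> B * 1 / 1 ^ length is"
          using fld_axis_bound[OF i, of \<mu> x] by simp
      qed (use B in auto)
      show "\<bar>\<xi> u v h\<bar> \<le> \<epsilon> * (((v - u) / ?\<tau>) powr \<alpha> / 1) ^ vertices h"
        if uv: "a \<le> u" "u < v" "v \<le> b" "vertices h \<le> N" for u v h
      proof -
        have "\<bar>\<xi> u v h\<bar> \<le> \<epsilon> * (M powr (m * \<alpha>) * (v - u) powr \<alpha>) ^ vertices h"
          using uv ab st M sp m \<alpha>(1) by (intro \<xi>_small) auto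
        also have "M powr (m * \<alpha>) * (v - u) powr \<alpha> = ((v - u) / ?\<tau>) powr \<alpha> / 1"
        proof -
          have "((v - u) / ?\<tau>) powr \<alpha> = (v - u) powr \<alpha> / ?\<tau> powr \<alpha>"
            using uv M by (intro powr_divide)
          also have "?\<tau> powr \<alpha> = inverse (M powr (m * \<alpha>))" by (simp add: powr_powr flip: powr_minus)
          finally show ?thesis by (simp add: divide_inverse mult.commute)
        qed
        finally show ?thesis .
      qed
    qed (use ab st \<tau> B sp in auto)
    show "norm (drift r) \<le> 1 / ?\<tau>" if "a \<le> r" "r \<le> b" for r
      using norm_drift[of r M] y[of r] that ab M by (simp add: powr_minus divide_inverse)
  qed (use C sp in auto)
  then have chain: "norm (Z b - Z a) \<le> 4 * ?l * \<epsilon>" if "s \<le> a" "a < b" "b \<le> t" "b - a \<le> ?\<tau>" for a b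
    using that by simp
  \<comment> \<open>At most \<open>2 * M\<close> windows because \<open>1 \<le> M\<close>; with the
    4 of the local estimate this gives the 8 in \<open>small_param\<close>.\<close>
  define n where "n = nat \<lceil>M\<rceil>"
  have n: "M \<le> real n" "real n \<le> 2 * M" using M by (auto simp: n_def) linarith
  have "M powr (1 - m) = M * ?\<tau>" using M by (simp add: powr_diff powr_minus divide_inverse)
  also have "\<dots> \<le> real n * ?\<tau>" using n \<tau> by (intro mult_right_mono) auto
  finally have "norm (Z t - Z s) \<le> real n * (4 * ?l * \<epsilon>)"
    using st l0 sp \<tau> by (intro increments_chain[of ?\<tau> _ s t Z] chain) auto
  also have "\<dots> \<le> (2 * M) * (4 * ?l * \<epsilon>)" using n l0 sp by (intro mult_right_mono) auto
  also have "\<dots> = 8 * (?l * \<epsilon>) * M" by simp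
  also have "\<dots> \<le> noise_const m * M" using sp M by (intro mult_right_mono) auto
  finally show ?thesis .
qed

text \<open>The length scale is now the Japanese bracket, at most 2M on the ball of radius M, so a
  single window of the full damping time is admissible. On that ball \<open>1 \<le> \<gamma>\<close>
  bounds the bracket to the power \<gamma> - 1 by (2M)^(\<gamma>-1), whence \<kappa> =
  M^(\<gamma>-1). The exponent \<open>e\<close> is the one in \<kappa> \<tau>^\<alpha> =
  M^(-e).\<close>

lemma noise_polynomial_growth:
  assumes B: "0 \<le> B" "polynomial_growth N \<gamma> B \<sigma>" and \<gamma>: "1 \<le> \<gamma>" "\<gamma> < (m - 1) * \<alpha> + 1"
    and C: "est_const (B * 2 powr (\<gamma> - 1) * real CARD('k) ^ N) C"
    and \<epsilon>: "\<epsilon> = small_param m (loc_const C)" and e: "e = (m - 1) * \<alpha> - \<gamma> + 1"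
    and M: "1 \<le> M" "noise_level e \<le> \<epsilon> powr (1 / e) * M"
    and st: "0 \<le> s" "s < t" "t \<le> 1" "t - s \<le> M powr (1 - m)"
    and y: "\<And>r. s \<le> r \<Longrightarrow> r \<le> t \<Longrightarrow> norm (y r) \<le> M"
  shows "norm (Z t - Z s) \<le> noise_const m * M"
proof -
  let ?\<tau> = "M powr (1 - m)" and ?\<kappa> = "M powr (\<gamma> - 1)" and ?l = "loc_const C"
  let ?S = "cball 0 M :: (real^'k) set"
  note l0 = loc_const_nonneg[OF C]
  note sp = small_param[OF m l0, folded \<epsilon>]
  have e0: "0 < e" using \<gamma> e by simp
  have jb: "0 < japanese_bracket x" for x :: "real^'k" using japanese_bracket(1)[of x] by linarith
  have jM: "japanese_bracket x \<le> 2 * M" if "x \<in> ?S" for x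
    using japanese_bracket(2)[of x] that M by simp
  have "norm (Z t - Z s) \<le> 4 * ?l * \<epsilon> * (2 * M)"
  proof (rule local_estimate)
    show "window (B * 2 powr (\<gamma> - 1) * real CARD('k) ^ N) \<epsilon> ?\<kappa> ?\<tau> (2 * M) ?S japanese_bracket s t"
      unfolding window_def
    proof (intro conjI allI impI ballI)
      show "deriv_bound N (B * 2 powr (\<gamma> - 1) * real CARD('k) ^ N * ?\<kappa>) ?S japanese_bracket (fld \<mu>)" for \<mu>
      proof -
        have "deriv_bound N ((B * 2 powr (\<gamma> - 1) * ?\<kappa>) * real CARD('k) ^ N) ?S japanese_bracket (fld \<mu>)"
        proof (rule deriv_bound_basis[OF fld_smooth])
          fix "is" :: "'k list" and x :: "real^'k" assume i: "length is \<le> N" and x: "x \<in> ?S"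
          let ?j = "japanese_bracket x" and ?n = "length is"
          have "norm (partial_deriv (count_list is) \<sigma> x) \<le> B * ?j powr (\<gamma> - real ?n)"
            using B(2)[unfolded polynomial_growth_def, rule_format, of "count_list is" x] i
              partial_deriv_eq(2)[OF Ck_mono[OF smooth i]] by simp
          also have "?j powr (\<gamma> - real ?n) = ?j powr (\<gamma> - 1) * (?j / ?j ^ ?n)"
            using jb[of x] by (simp add: powr_diff powr_realpow)
          also have "B * \<dots> \<le> B * ((2 * M) powr (\<gamma> - 1) * (?j / ?j ^ ?n))"
            using B \<gamma> jM[OF x] jb[of x] by (intro mult_left_mono mult_right_mono powr_mono2) (auto simp: less_imp_le)
          also have "(2 * M) powr (\<gamma> - 1) = 2 powr (\<gamma> - 1) * ?\<kappa>" using M by (intro powr_mult)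
          finally show "norm (Dn (fld \<mu>) (map (\<lambda>i. axis i 1) is) x) \<le> (B * 2 powr (\<gamma> - 1) * ?\<kappa>) * ?j / ?j ^ ?n"
            using fld_axis_bound[OF i, of \<mu> x] by (simp add: mult_ac)
        qed (use B jb in auto)
        then show ?thesis by (simp add: mult_ac)
      qed
      show "\<bar>\<xi> u v h\<bar> \<le> \<epsilon> * (((v - u) / ?\<tau>) powr \<alpha> / ?\<kappa>) ^ vertices h"
        if uv: "s \<le> u" "u < v" "v \<le> t" "vertices h \<le> N" for u v h
      proof -
        have "\<bar>\<xi> u v h\<bar> \<le> \<epsilon> * (M powr e * (v - u) powr \<alpha>) ^ vertices h"
          using uv st M sp e0 by (intro \<xi>_small) auto
        also have "M powr e * (v - u) powr \<alpha> = ((v - u) / ?\<tau>) powr \<alpha> / ?\<kappa>"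
        proof -
          have "e = - ((1 - m) * \<alpha>) - (\<gamma> - 1)" unfolding e by (simp add: algebra_simps)
          then have "M powr e = inverse (M powr ((1 - m) * \<alpha>)) / ?\<kappa>"
            by (simp only: powr_diff powr_minus)
          moreover have "((v - u) / ?\<tau>) powr \<alpha> = (v - u) powr \<alpha> / M powr ((1 - m) * \<alpha>)"
            using uv M by (simp add: powr_divide powr_powr)
          ultimately show ?thesis by (simp add: divide_inverse mult_ac)
        qed
        finally show ?thesis .
      qed
    qed (use st y M B sp jb jM japanese_bracket(3) in auto)
    show "norm (drift r) \<le> (2 * M) / ?\<tau>" if "s \<le> r" "r \<le> t" for r
    proof -
      have "norm (drift r) \<le> M powr m" using norm_drift[of r M] y[of r] that by simp
      also have "\<dots> = M powr (1 - (1 - m))" by simp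
      also have "\<dots> = M / ?\<tau>" using M by (simp only: powr_diff) simp
      also have "\<dots> \<le> (2 * M) / ?\<tau>" using M by (intro divide_right_mono) auto
      finally show ?thesis .
    qed
  qed (use C sp in auto)
  also have "\<dots> = 8 * (?l * \<epsilon>) * M" by simp
  also have "\<dots> \<le> noise_const m * M" using sp M by (intro mult_right_mono) auto
  finally show ?thesis .
qed

end

theorem theorem1p4:
  fixes m \<alpha> C\<^sub>\<sigma> :: real and N :: nat
  assumes "m > 1" and "0 < \<alpha>" and "\<alpha> < 1"
    and "real N * \<alpha> \<le> 1" and "1 < real (N + 1) * \<alpha>"
  shows
    "(\<exists>C::real. \<forall>(X :: real \<Rightarrow> real \<Rightarrow> ('d::finite forest \<Rightarrow>\<^sub>0 real) \<Rightarrow> real)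
        (\<sigma> :: real^'k::finite \<Rightarrow> real^'d^'k) (y0 :: real^'k) (Y :: real \<Rightarrow> 'd forest \<Rightarrow>\<^sub>0 real^'k).
        rough_path \<alpha> N X \<and> Ck N \<sigma> \<and> is_solution m \<alpha> N X \<sigma> y0 Y \<and> bounded_coeffs N C\<^sub>\<sigma> \<sigma> \<longrightarrow>
        (\<forall>t\<in>{0<..1}. norm (Poly_Mapping.lookup (Y t) {#})
           \<le> C * max (t powr (- 1 / (m - 1)))
                 (MAX h \<in> trees_le (int N).
                    rp_seminorm \<alpha> X {#h#} powr (1 / (m * \<alpha> * real (vertices h))))))
     \<and>
     (\<forall>\<gamma>::real. 1 \<le> \<gamma> \<and> \<gamma> < (m - 1) * \<alpha> + 1 \<longrightarrow>
      (\<exists>C::real. \<forall>(X :: real \<Rightarrow> real \<Rightarrow> ('d::finite forest \<Rightarrow>\<^sub>0 real) \<Rightarrow> real)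
        (\<sigma> :: real^'k::finite \<Rightarrow> real^'d^'k) (y0 :: real^'k) (Y :: real \<Rightarrow> 'd forest \<Rightarrow>\<^sub>0 real^'k).
        rough_path \<alpha> N X \<and> Ck N \<sigma> \<and> is_solution m \<alpha> N X \<sigma> y0 Y \<and> polynomial_growth N \<gamma> C\<^sub>\<sigma> \<sigma> \<longrightarrow>
        (\<forall>t\<in>{0<..1}. norm (Poly_Mapping.lookup (Y t) {#})
           \<le> C * max (t powr (- 1 / (m - 1)))
                 (MAX h \<in> trees_le (int N).
                    rp_seminorm \<alpha> X {#h#} powr
                      (1 / (((m - 1) * \<alpha> - \<gamma> + 1) * real (vertices h)))))))"
proof (intro conjI allI impI)
  \<comment> \<open>A copy of \<open>loc_const\<close> that does not refer to the locale: the final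
    constant is named before X, \<sigma> and the solution are introduced.\<close>
  define K :: "real \<Rightarrow> real" where "K C = real CARD('d) * (real (card (forests_le N (int N - 1) :: 'd forest set)) * C
    * (sewing_const (real (N + 1) * \<alpha>) + 1))" for C
  \<comment> \<open>\<open>sum_const\<close> is a function of m alone, so it may occur in the
    uniform constant.\<close>
  let ?c = "2 * max 1 (damped_path.sum_const m powr (1 / (m - 1)))"
  have rde: "rde_solution m \<alpha> N X \<sigma> y0 Y"
    if "rough_path \<alpha> N X" "Ck N \<sigma>" "is_solution m \<alpha> N X \<sigma> y0 Y"
    for X :: "real \<Rightarrow> real \<Rightarrow> ('d forest \<Rightarrow>\<^sub>0 real) \<Rightarrow> real" and \<sigma> :: "real^'k \<Rightarrow> real^'d^'k" and y0 Y
    using that assms by unfold_locales auto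
  show "\<exists>C::real. \<forall>(X :: real \<Rightarrow> real \<Rightarrow> ('d forest \<Rightarrow>\<^sub>0 real) \<Rightarrow> real)
        (\<sigma> :: real^'k \<Rightarrow> real^'d^'k) (y0 :: real^'k) (Y :: real \<Rightarrow> 'd forest \<Rightarrow>\<^sub>0 real^'k).
        rough_path \<alpha> N X \<and> Ck N \<sigma> \<and> is_solution m \<alpha> N X \<sigma> y0 Y \<and> bounded_coeffs N C\<^sub>\<sigma> \<sigma> \<longrightarrow>
        (\<forall>t\<in>{0<..1}. norm (Poly_Mapping.lookup (Y t) {#})
           \<le> C * max (t powr (- 1 / (m - 1)))
                 (MAX h \<in> trees_le (int N).
                    rp_seminorm \<alpha> X {#h#} powr (1 / (m * \<alpha> * real (vertices h)))))"
  proof -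
    \<comment> \<open>The estimates require a nonnegative bound, while the given constant is an
      arbitrary real.\<close>
    let ?B = "max C\<^sub>\<sigma> 0"
    have "0 \<le> ?B * real CARD('k) ^ N" by simp
    from est_const_uniform[OF this, of N] obtain C where
      C: "\<forall>m \<alpha> (X :: real \<Rightarrow> real \<Rightarrow> ('d forest \<Rightarrow>\<^sub>0 real) \<Rightarrow> real) (\<sigma> :: real^'k \<Rightarrow> real^'d^'k) y0 Y.
        rde_solution m \<alpha> N X \<sigma> y0 Y \<longrightarrow> rde_solution.est_const N \<sigma> (?B * real CARD('k) ^ N) C" ..
    let ?e = "m * \<alpha>" and ?\<epsilon> = "small_param m (K C)"
    show ?thesis
    proof (intro exI[of _ "?c / ?\<epsilon> powr (1 / ?e)"] allI impI ballI)
      fix X :: "real \<Rightarrow> real \<Rightarrow> ('d forest \<Rightarrow>\<^sub>0 real) \<Rightarrow> real" and \<sigma> :: "real^'k \<Rightarrow> real^'d^'k" and y0 Y and t :: real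
      assume sol: "rough_path \<alpha> N X \<and> Ck N \<sigma> \<and> is_solution m \<alpha> N X \<sigma> y0 Y \<and> bounded_coeffs N C\<^sub>\<sigma> \<sigma>"
        and t: "t \<in> {0<..1}"
      interpret rde_solution m \<alpha> N X \<sigma> y0 Y using sol by (intro rde) auto
      have C': "est_const (?B * real CARD('k) ^ N) C" using C rde_solution_axioms by blast
      have KC: "K C = loc_const C" by (simp add: K_def loc_const_def)
      have "bounded_coeffs N ?B \<sigma>" using sol by (auto simp: bounded_coeffs_def le_max_iff_disj)
      note noise = noise_bounded_coeffs[OF _ this C', of ?\<epsilon>]
      have "norm (y t) \<le> ?c / ?\<epsilon> powr (1 / ?e) * max (t powr (- 1 / (m - 1))) (noise_level ?e)"
        using small_param[OF assms(1) loc_const_nonneg[OF C']] assms t KC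
        by (intro bound_from_noise noise) auto
      then show "norm (Poly_Mapping.lookup (Y t) {#}) \<le> ?c / ?\<epsilon> powr (1 / ?e) * max (t powr (- 1 / (m - 1)))
          (MAX h \<in> trees_le (int N). rp_seminorm \<alpha> X {#h#} powr (1 / (m * \<alpha> * real (vertices h))))"
        by (simp only: y_def noise_level_def)
    qed
  qed
  fix \<gamma> :: real
  assume \<gamma>: "1 \<le> \<gamma> \<and> \<gamma> < (m - 1) * \<alpha> + 1"
  show "\<exists>C::real. \<forall>(X :: real \<Rightarrow> real \<Rightarrow> ('d forest \<Rightarrow>\<^sub>0 real) \<Rightarrow> real)
        (\<sigma> :: real^'k \<Rightarrow> real^'d^'k) (y0 :: real^'k) (Y :: real \<Rightarrow> 'd forest \<Rightarrow>\<^sub>0 real^'k).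
        rough_path \<alpha> N X \<and> Ck N \<sigma> \<and> is_solution m \<alpha> N X \<sigma> y0 Y \<and> polynomial_growth N \<gamma> C\<^sub>\<sigma> \<sigma> \<longrightarrow>
        (\<forall>t\<in>{0<..1}. norm (Poly_Mapping.lookup (Y t) {#})
           \<le> C * max (t powr (- 1 / (m - 1)))
                 (MAX h \<in> trees_le (int N).
                    rp_seminorm \<alpha> X {#h#} powr
                      (1 / (((m - 1) * \<alpha> - \<gamma> + 1) * real (vertices h)))))"
  proof -
    let ?B = "max C\<^sub>\<sigma> 0"
    let ?B' = "?B * 2 powr (\<gamma> - 1) * real CARD('k) ^ N"
    have "0 \<le> ?B'" by simp
    from est_const_uniform[OF this, of N] obtain C where
      C: "\<forall>m \<alpha> (X :: real \<Rightarrow> real \<Rightarrow> ('d forest \<Rightarrow>\<^sub>0 real) \<Rightarrow> real) (\<sigma> :: real^'k \<Rightarrow> real^'d^'k) y0 Y.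
        rde_solution m \<alpha> N X \<sigma> y0 Y \<longrightarrow> rde_solution.est_const N \<sigma> ?B' C" ..
    let ?e = "(m - 1) * \<alpha> - \<gamma> + 1" and ?\<epsilon> = "small_param m (K C)"
    show ?thesis
    proof (intro exI[of _ "?c / ?\<epsilon> powr (1 / ?e)"] allI impI ballI)
      fix X :: "real \<Rightarrow> real \<Rightarrow> ('d forest \<Rightarrow>\<^sub>0 real) \<Rightarrow> real" and \<sigma> :: "real^'k \<Rightarrow> real^'d^'k" and y0 Y and t :: real
      assume sol: "rough_path \<alpha> N X \<and> Ck N \<sigma> \<and> is_solution m \<alpha> N X \<sigma> y0 Y \<and> polynomial_growth N \<gamma> C\<^sub>\<sigma> \<sigma>"
        and t: "t \<in> {0<..1}"
      interpret rde_solution m \<alpha> N X \<sigma> y0 Y using sol by (intro rde) auto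
      have C': "est_const ?B' C" using C rde_solution_axioms by blast
      have KC: "K C = loc_const C" by (simp add: K_def loc_const_def)
      have "polynomial_growth N \<gamma> ?B \<sigma>"
        unfolding polynomial_growth_def
      proof (intro allI impI)
        fix \<beta> :: "'k \<Rightarrow> nat" and x assume "mi_order \<beta> \<le> N"
        then have "norm (partial_deriv \<beta> \<sigma> x) \<le> C\<^sub>\<sigma> * japanese_bracket x powr (\<gamma> - real (mi_order \<beta>))"
          using sol by (simp add: polynomial_growth_def)
        also have "\<dots> \<le> ?B * japanese_bracket x powr (\<gamma> - real (mi_order \<beta>))" by (intro mult_right_mono) auto
        finally show "norm (partial_deriv \<beta> \<sigma> x) \<le> ?B * japanese_bracket x powr (\<gamma> - real (mi_order \<beta>))" .
      qed
      note noise = noise_polynomial_growth[OF _ this _ _ C', of ?\<epsilon> ?e]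
      have "norm (y t) \<le> ?c / ?\<epsilon> powr (1 / ?e) * max (t powr (- 1 / (m - 1))) (noise_level ?e)"
        using small_param[OF assms(1) loc_const_nonneg[OF C']] \<gamma> t KC
        by (intro bound_from_noise noise) auto
      then show "norm (Poly_Mapping.lookup (Y t) {#}) \<le> ?c / ?\<epsilon> powr (1 / ?e) * max (t powr (- 1 / (m - 1)))
          (MAX h \<in> trees_le (int N). rp_seminorm \<alpha> X {#h#} powr (1 / (((m - 1) * \<alpha> - \<gamma> + 1) * real (vertices h))))"
        by (simp only: y_def noise_level_def)
    qed
  qed
qed

end
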